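(* Let $L$ be a planar triangulation with $n_L\ge 3$ vertices, embedded in the plane, and let $H$ be its planar conjugated triangulation. Let $T$ be a face of the first class and $P$ a face of the second class of $H$. Then either $T$ and $P$ have exactly one common edge (together with its two endpoints), or they have no common element at all; in particular, they can never have exactly one common vertex and nothing else.
   Context: A planar triangulation is a maximal planar simple graph; fix a plane embedding of $L$, so all faces of $L$ are triangles. The planar conjugated triangulation $H$ of $L$ is the plane graph whose vertices are the midpoints of the edges of $L$, and in which, for every bounded face of $L$, the three midpoints of its three boundary edges are joined pairwise by three segments (medians) drawn inside that face; nothing is drawn inside the unbounded face of $L$. A face of $H$ is of the first class if it is the triangle bounded by the three medians of a bounded face of $L$; a bounded face of $H$ is of the second class if it contains a vertex of $L$ in its interior. *)

theory Defs
  imports "HOL-Analysis.Analysis"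
begin

definition simple_graph :: "'v set \<Rightarrow> 'v set set \<Rightarrow> bool" where
  "simple_graph V E \<longleftrightarrow> finite V \<and> (\<forall>e\<in>E. e \<subseteq> V \<and> card e = 2)"

(* Edges are drawn as arbitrary Jordan arcs; the orientation of an arc is immaterial. *)
definition plane_embedding ::
    "'v set \<Rightarrow> 'v set set \<Rightarrow> ('v \<Rightarrow> complex) \<Rightarrow> ('v set \<Rightarrow> real \<Rightarrow> complex) \<Rightarrow> bool" where
  "plane_embedding V E p \<gamma> \<longleftrightarrow>
     inj_on p V \<and>
     (\<forall>e\<in>E. arc (\<gamma> e) \<and> {pathstart (\<gamma> e), pathfinish (\<gamma> e)} = p ` e \<and>
             path_image (\<gamma> e) \<inter> p ` V = p ` e) \<and>
     (\<forall>e\<in>E. \<forall>e'\<in>E. e \<noteq> e' \<longrightarrow> path_image (\<gamma> e) \<inter> path_image (\<gamma> e') \<subseteq> p ` (e \<inter> e'))"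

definition planar :: "'v set \<Rightarrow> 'v set set \<Rightarrow> bool" where
  "planar V E \<longleftrightarrow> simple_graph V E \<and> (\<exists>p \<gamma>. plane_embedding V E p \<gamma>)"

definition planar_triangulation :: "'v set \<Rightarrow> 'v set set \<Rightarrow> bool" where
  "planar_triangulation V E \<longleftrightarrow> planar V E \<and> (\<forall>E'. E \<subset> E' \<longrightarrow> \<not> planar V E')"

definition drawing ::
    "'v set \<Rightarrow> 'v set set \<Rightarrow> ('v \<Rightarrow> complex) \<Rightarrow> ('v set \<Rightarrow> real \<Rightarrow> complex) \<Rightarrow> complex set" where
  "drawing V E p \<gamma> = p ` V \<union> (\<Union>e\<in>E. path_image (\<gamma> e))"

definition faces ::
    "'v set \<Rightarrow> 'v set set \<Rightarrow> ('v \<Rightarrow> complex) \<Rightarrow> ('v set \<Rightarrow> real \<Rightarrow> complex) \<Rightarrow> complex set set" where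
  "faces V E p \<gamma> = components (- drawing V E p \<gamma>)"

definition bounded_faces ::
    "'v set \<Rightarrow> 'v set set \<Rightarrow> ('v \<Rightarrow> complex) \<Rightarrow> ('v set \<Rightarrow> real \<Rightarrow> complex) \<Rightarrow> complex set set" where
  "bounded_faces V E p \<gamma> = {F \<in> faces V E p \<gamma>. bounded F}"

definition boundary_vertices :: "'v set \<Rightarrow> ('v \<Rightarrow> complex) \<Rightarrow> complex set \<Rightarrow> 'v set" where
  "boundary_vertices V p F = {v \<in> V. p v \<in> frontier F}"

definition boundary_edges ::
    "'v set set \<Rightarrow> ('v set \<Rightarrow> real \<Rightarrow> complex) \<Rightarrow> complex set \<Rightarrow> 'v set set" where
  "boundary_edges E \<gamma> F = {e \<in> E. path_image (\<gamma> e) \<subseteq> frontier F}"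

(* The midpoint is taken with respect to the parametrisation of the arc.  For a straight edge
   drawn as a linepath this is the usual midpoint; reparametrising the arc turns any of its
   inner points into the midpoint. *)
definition edge_midpoint :: "('v set \<Rightarrow> real \<Rightarrow> complex) \<Rightarrow> 'v set \<Rightarrow> complex" where
  "edge_midpoint \<gamma> e = \<gamma> e (1 / 2)"

(* The conjugated triangulation is a graph whose vertices are the edges of the given graph (each
   placed at its midpoint); a median is the pair of the two edges whose midpoints it joins. *)
definition face_medians ::
    "'v set set \<Rightarrow> ('v set \<Rightarrow> real \<Rightarrow> complex) \<Rightarrow> complex set \<Rightarrow> 'v set set set" where
  "face_medians E \<gamma> F = {s. s \<subseteq> boundary_edges E \<gamma> F \<and> card s = 2}"

definition medians ::
    "'v set \<Rightarrow> 'v set set \<Rightarrow> ('v \<Rightarrow> complex) \<Rightarrow> ('v set \<Rightarrow> real \<Rightarrow> complex) \<Rightarrow> 'v set set set" where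
  "medians V E p \<gamma> = (\<Union>F \<in> bounded_faces V E p \<gamma>. face_medians E \<gamma> F)"

(* The drawing of a median need not be indexed by the face containing it: in a triangulation two
   distinct edges lie together on the boundary of at most one bounded face, since two triangular
   faces sharing two edges have the same boundary curve, and one of them is its outside. *)
definition conjugated_triangulation ::
    "'v set \<Rightarrow> 'v set set \<Rightarrow> ('v \<Rightarrow> complex) \<Rightarrow> ('v set \<Rightarrow> real \<Rightarrow> complex) \<Rightarrow>
     ('v set set \<Rightarrow> real \<Rightarrow> complex) \<Rightarrow> bool" where
  "conjugated_triangulation V E p \<gamma> \<mu> \<longleftrightarrow>
     plane_embedding E (medians V E p \<gamma>) (edge_midpoint \<gamma>) \<mu> \<and>
     (\<forall>F \<in> bounded_faces V E p \<gamma>. \<forall>s \<in> face_medians E \<gamma> F.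
        path_image (\<mu> s) - edge_midpoint \<gamma> ` s \<subseteq> F)"

definition conjugated_faces ::
    "'v set \<Rightarrow> 'v set set \<Rightarrow> ('v \<Rightarrow> complex) \<Rightarrow> ('v set \<Rightarrow> real \<Rightarrow> complex) \<Rightarrow>
     ('v set set \<Rightarrow> real \<Rightarrow> complex) \<Rightarrow> complex set set" where
  "conjugated_faces V E p \<gamma> \<mu> = faces E (medians V E p \<gamma>) (edge_midpoint \<gamma>) \<mu>"

definition first_class_face ::
    "'v set \<Rightarrow> 'v set set \<Rightarrow> ('v \<Rightarrow> complex) \<Rightarrow> ('v set \<Rightarrow> real \<Rightarrow> complex) \<Rightarrow>
     ('v set set \<Rightarrow> real \<Rightarrow> complex) \<Rightarrow> complex set \<Rightarrow> bool" where
  "first_class_face V E p \<gamma> \<mu> T \<longleftrightarrow>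
     T \<in> conjugated_faces V E p \<gamma> \<mu> \<and>
     (\<exists>F \<in> bounded_faces V E p \<gamma>. T = inside (\<Union>s \<in> face_medians E \<gamma> F. path_image (\<mu> s)))"

definition second_class_face ::
    "'v set \<Rightarrow> 'v set set \<Rightarrow> ('v \<Rightarrow> complex) \<Rightarrow> ('v set \<Rightarrow> real \<Rightarrow> complex) \<Rightarrow>
     ('v set set \<Rightarrow> real \<Rightarrow> complex) \<Rightarrow> complex set \<Rightarrow> bool" where
  "second_class_face V E p \<gamma> \<mu> P \<longleftrightarrow>
     P \<in> conjugated_faces V E p \<gamma> \<mu> \<and> bounded P \<and> (\<exists>v\<in>V. p v \<in> interior P)"

definition common_vertices ::
    "'v set set \<Rightarrow> ('v set \<Rightarrow> real \<Rightarrow> complex) \<Rightarrow> complex set \<Rightarrow> complex set \<Rightarrow> 'v set set" where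
  "common_vertices E \<gamma> T P =
     boundary_vertices E (edge_midpoint \<gamma>) T \<inter> boundary_vertices E (edge_midpoint \<gamma>) P"

definition common_edges ::
    "'v set \<Rightarrow> 'v set set \<Rightarrow> ('v \<Rightarrow> complex) \<Rightarrow> ('v set \<Rightarrow> real \<Rightarrow> complex) \<Rightarrow>
     ('v set set \<Rightarrow> real \<Rightarrow> complex) \<Rightarrow> complex set \<Rightarrow> complex set \<Rightarrow> 'v set set set" where
  "common_edges V E p \<gamma> \<mu> T P =
     boundary_edges (medians V E p \<gamma>) \<mu> T \<inter> boundary_edges (medians V E p \<gamma>) \<mu> P"

end

(*
  A plane graph separates two points only if one of its simple closed curves does: this follows from
  Janiszewski's theorem by adding the edges one at a time. Hence the boundary edges of a bounded face
  F contain a cycle around F. If F had a fourth boundary edge e besides three edges of that cycle,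
  then two of the medians among these four edges would be crossing chords of the disc bounded by the
  cycle, the midpoint of e being joined to the cycle inside the graph. So the boundary of F is a
  triangle. A maximal planar graph is connected (two components could be redrawn side by side and
  joined by an edge), so F is the whole inside of this triangle, and the three medians cut it into
  the first-class face and three corners. A bounded face of H around the vertex v consists of v, the
  half-edges at v and the corners at v. Hence the midpoint of an edge e lies on its boundary if and
  only if v is an end of e, which for the three edges of a triangle happens exactly twice or never.
*)

theory Submission
  imports Defs
begin

section \<open>Separation in the plane\<close>

text \<open>Edges are arbitrary Jordan arcs, so no incidence can be read off a picture: every
  separation argument is reduced to Janiszewski's theorem or to the splitting of a disc by a chord.
  The shape of a bounded face is not extracted from maximality but from the drawing of
  \<open>H\<close>: \<open>conjugated_triangulation\<close> asks for pairwise non-crossing medians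
  between all boundary edges of the face, and a face with four boundary edges has no room for them.
  Maximality enters through connectedness of the drawing. The face of \<open>H\<close> around
  \<open>v\<close> is never computed exactly. Only the upper bound \<open>region v\<close> is
  proved, by a connectedness argument; the incidences in the other direction come from the
  half-edges and corners at \<open>v\<close>, which are connected, avoid the drawing of
  \<open>H\<close> up to midpoints, and come arbitrarily close to \<open>p v\<close>.\<close>

lemma connected_component_arc_compl:
  fixes g :: "real \<Rightarrow> complex"
  assumes "arc g" "x \<notin> path_image g" "y \<notin> path_image g"
  shows "connected_component (- path_image g) x y"
  using connected_arc_complement[OF assms(1)] assms(2,3)
  by (simp add: connected_iff_connected_component)

text \<open>The form in which Janiszewski's theorem is mostly applied: an arc alone never separates,
  so attaching it to \<open>K\<close> along a connected (possibly empty) set creates no new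
  separation.\<close>

lemma connected_component_Un_arc:
  fixes g :: "real \<Rightarrow> complex"
  assumes "closed K" "arc g" "connected (K \<inter> path_image g)"
    and "connected_component (- K) x y" "x \<notin> path_image g" "y \<notin> path_image g"
  shows "connected_component (- (K \<union> path_image g)) x y"
  using Janiszewski[of "path_image g" K x y] connected_component_arc_compl[OF assms(2,5,6)] assms
  by (simp add: Un_commute Int_commute compact_arc_image)

lemma connected_subset_singleton: "A \<subseteq> {a} \<Longrightarrow> connected A"
  by (metis connected_empty connected_sing subset_singleton_iff)

text \<open>Finitely many points never separate an open connected set of the plane; this lets the
  vertices of a drawing be ignored when its edges are studied.\<close>

lemma connected_component_Diff_finite:
  fixes S :: "complex set"
  assumes "open S" "finite Z" "connected_component S x y" "x \<notin> Z" "y \<notin> Z"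
  shows "connected_component (S - Z) x y"
proof -
  let ?A = "connected_component_set S x"
  have "connected (?A - Z)"
    by (rule connected_open_delete_finite) (auto simp: assms open_connected_component)
  moreover have "x \<in> ?A - Z" "y \<in> ?A - Z" "?A - Z \<subseteq> S - Z"
    using assms connected_component_refl connected_component_in connected_component_subset by blast+
  ultimately show ?thesis unfolding connected_component_def by blast
qed

lemma connected_component_clopen:
  assumes "connected_component S x y" "x \<in> F" "S \<inter> frontier F = {}"
  shows "y \<in> F"
proof (rule ccontr)
  assume "y \<notin> F"
  obtain A where "connected A" "A \<subseteq> S" "x \<in> A" "y \<in> A"
    using assms(1) unfolding connected_component_def by blast
  then show False using connected_Int_frontier[of A F] assms \<open>y \<notin> F\<close> by blast
qed

lemma frontier_component_compl_subset:
  fixes D :: "complex set"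
  assumes "closed D" "F \<in> components (- D)"
  shows "frontier F \<subseteq> D"
proof -
  have "frontier F \<subseteq> frontier (- D)"
    using assms frontier_of_components_subset by blast
  then show ?thesis
    using assms(1) frontier_subset_closed by force
qed

text \<open>If \<open>g t\<close> is not in the closure of \<open>F\<close>, then \<open>F\<close> remains a component after deleting a short piece
  of \<open>g\<close> around \<open>g t\<close>. By Janiszewski's theorem the remaining end of \<open>g\<close> that contains \<open>g s\<close> is
  irrelevant for the separation of \<open>F\<close> from \<open>g t\<close>, yet without it \<open>F\<close> is connected to \<open>g t\<close> through \<open>g s\<close>.\<close>

lemma closure_face_arc_upward:
  fixes g :: "real \<Rightarrow> complex"
  assumes K: "closed K" and g: "arc g"
    and Kg: "K \<inter> path_image g \<subseteq> {pathstart g, pathfinish g}"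
    and F: "F \<in> components (- (K \<union> path_image g))"
    and s: "0 < s" "g s \<in> closure F" and st: "s < t" "t < 1"
  shows "g t \<in> closure F"
proof (rule ccontr)
  assume nt: "g t \<notin> closure F"
  have injg: "inj_on g {0..1}" and contg: "continuous_on {0..1} g"
    using g by (auto simp: arc_def path_def)
  have inj: "g u = g v \<longleftrightarrow> u = v" if "u \<in> {0..1}" "v \<in> {0..1}" for u v
    using injg that by (auto simp: inj_on_def)
  have "continuous_on {s<..<1} g"
    by (rule continuous_on_subset[OF contg]) (use s in auto)
  then have "open ({s<..<1} \<inter> g -` (- closure F))"
    by (intro continuous_open_preimage) auto
  then obtain d where d: "d > 0" "ball t d \<subseteq> {s<..<1} \<inter> g -` (- closure F)"
    unfolding open_contains_ball using nt st
    by (meson ComplI IntI greaterThanLessThan_iff vimageI2)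
  define t1 where "t1 = t - d/2"
  define t2 where "t2 = t + d/2"
  have tm: "u \<in> {s<..<1} \<and> g u \<notin> closure F" if "u \<in> {t1..t2}" for u
  proof -
    have "u \<in> ball t d" using that d(1) by (auto simp: t1_def t2_def dist_real_def)
    then show ?thesis using d(2) by auto
  qed
  have t12: "s < t1" "t1 < t" "t < t2" "t2 < 1"
    using tm[of t1] tm[of t2] d(1) by (auto simp: t1_def t2_def)
  \<comment> \<open>The cut at \<open>s/2\<close> leaves a first stump of the arc in
    \<open>D3\<close>, so that \<open>?h\<close>, running from \<open>s/2\<close> to
    \<open>t1\<close>, meets \<open>D3\<close> in the single point \<open>g (s/2)\<close>. The gap
    between \<open>t1\<close> and \<open>t2\<close> is never filled again.\<close>
  define D3 where "D3 = K \<union> g ` {0..s/2} \<union> g ` {t2..1}"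
  have cl3: "closed D3"
    unfolding D3_def using s t12 st
    by (intro closed_Un K compact_imp_closed compact_continuous_image continuous_on_subset[OF contg]) auto
  let ?h = "subpath (s/2) t1 g"
  have h: "arc ?h" using arc_subpath_arc[OF g, of "s/2" t1] s t12 by auto
  have hi: "path_image ?h = g ` {s/2..t1}" using s t12 by (simp add: path_image_subpath)
  have Kmem: "u = 0 \<or> u = 1" if "g u \<in> K" "u \<in> {0..1}" for u
    using Kg that inj[of u 0] inj[of u 1] by (auto simp: path_image_def pathstart_def pathfinish_def)
  have D3mem: "u \<le> s/2 \<or> t2 \<le> u" if "g u \<in> D3" "u \<in> {0..1}" for u
  proof -
    have im: "u \<in> A" if "g u \<in> g ` A" "A \<subseteq> {0..1}" for A
      using that \<open>u \<in> {0..1}\<close> inj by blast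
    have "{0..s/2} \<subseteq> {0..1}" "{t2..1} \<subseteq> {0..1}" using s t12 by auto
    then show ?thesis
      using that Kmem[OF _ that(2)] s t12 im[of "{0..s/2}"] im[of "{t2..1}"] unfolding D3_def by fastforce
  qed
  have gs: "g s \<notin> D3" using D3mem[of s] s t12 by force
  obtain r where r: "r > 0" "ball (g s) r \<subseteq> - D3"
    using open_Compl[OF cl3] gs unfolding open_contains_ball by auto
  obtain x where x: "x \<in> F" "dist x (g s) < r"
    using s(2) r(1) by (metis closure_approachable)
  have Fsub: "F \<subseteq> - (K \<union> path_image g)" using F in_components_subset by blast
  \<comment> \<open>With \<open>?h\<close> removed, a small disc around \<open>g s\<close> followed
    by the arc from \<open>s\<close> to \<open>t\<close> leads from a point of \<open>F\<close> to
    \<open>g t\<close>.\<close>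
  have "connected_component (- D3) x (g t)"
  proof -
    have c1: "connected (g ` {s..t})"
      by (intro connected_continuous_image continuous_on_subset[OF contg]) (use s st in auto)
    have c2: "connected (ball (g s) r \<union> g ` {s..t})"
    proof (rule connected_Un[OF _ c1])
      show "ball (g s) r \<inter> g ` {s..t} \<noteq> {}"
      proof -
        have "g s \<in> ball (g s) r" "g s \<in> g ` {s..t}" using r(1) st by auto
        then show ?thesis by blast
      qed
    qed simp
    have "g ` {s..t} \<subseteq> - D3"
    proof (intro image_subsetI ComplI)
      fix u assume "u \<in> {s..t}" "g u \<in> D3"
      then show False using D3mem[of u] s t12 st by auto
    qed
    then have "ball (g s) r \<union> g ` {s..t} \<subseteq> - D3" using r by auto
    moreover have "x \<in> ball (g s) r" using x by (simp add: dist_commute)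
    ultimately show ?thesis unfolding connected_component_def
      using c2 st by (intro exI[of _ "ball (g s) r \<union> g ` {s..t}"]) auto
  qed
  moreover have "connected (D3 \<inter> path_image ?h)"
  proof (rule connected_subset_singleton)
    show "D3 \<inter> path_image ?h \<subseteq> {g (s/2)}"
    proof
      fix z assume "z \<in> D3 \<inter> path_image ?h"
      then obtain u where "u \<in> {s/2..t1}" "z = g u" "g u \<in> D3" unfolding hi by auto
      then show "z \<in> {g (s/2)}" using D3mem[of u] s t12 st by auto
    qed
  qed
  moreover have "x \<notin> path_image ?h"
    using x Fsub hi s t12 by (auto simp: path_image_def)
  moreover have "g t \<notin> path_image ?h"
  proof
    assume "g t \<in> path_image ?h"
    then obtain u where "u \<in> {s/2..t1}" "g u = g t" unfolding hi by auto
    then show False using inj[of u t] s t12 by auto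
  qed
  ultimately have "connected_component (- (D3 \<union> path_image ?h)) x (g t)"
    using connected_component_Un_arc[OF cl3 h] by blast
  \<comment> \<open>The gap misses \<open>closure F\<close>, so \<open>D3\<close> and
    \<open>?h\<close> still contain the whole frontier of \<open>F\<close>.\<close>
  moreover have "- (D3 \<union> path_image ?h) \<inter> frontier F = {}"
  proof -
    have cK: "closed (K \<union> path_image g)" using K g by (simp add: closed_Un closed_arc_image)
    have "frontier F \<subseteq> K \<union> path_image g"
      by (rule frontier_component_compl_subset[OF cK F])
    moreover have "g u \<in> D3 \<union> path_image ?h" if "g u \<in> frontier F" "u \<in> {0..1}" for u
    proof (cases "u \<in> {t1..t2}")
      case True then show ?thesis using tm[of u] that by (auto simp: frontier_def)
    next
      case False
      then consider "u \<le> s/2" | "s/2 \<le> u" "u \<le> t1" | "t2 \<le> u" by fastforce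
      then show ?thesis unfolding hi D3_def using that by cases auto
    qed
    moreover have "path_image g = g ` {0..1}" by (simp add: path_image_def)
    ultimately have "z \<in> D3 \<union> path_image ?h" if z: "z \<in> frontier F" for z
    proof (cases "z \<in> K")
      case False
      then obtain u where "u \<in> {0..1}" "z = g u"
        using z \<open>frontier F \<subseteq> K \<union> path_image g\<close> by (auto simp: path_image_def)
      then show ?thesis using \<open>\<And>u. g u \<in> frontier F \<Longrightarrow> u \<in> {0..1} \<Longrightarrow> g u \<in> D3 \<union> path_image ?h\<close> z by blast
    qed (simp add: D3_def)
    then show ?thesis by blast
  qed
  ultimately have "g t \<in> F" using connected_component_clopen x(1) by blast
  then show False using nt closure_subset by blast
qed

lemma closure_face_arc:
  fixes g :: "real \<Rightarrow> complex"
  assumes K: "closed K" and g: "arc g"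
    and Kg: "K \<inter> path_image g \<subseteq> {pathstart g, pathfinish g}"
    and F: "F \<in> components (- (K \<union> path_image g))"
    and s: "s \<in> {0<..<1}" "g s \<in> closure F" and t: "t \<in> {0<..<1}"
  shows "g t \<in> closure F"
proof (cases s t rule: linorder_cases)
  case less then show ?thesis using closure_face_arc_upward[OF K g Kg F _ s(2)] s t by auto
next
  case equal then show ?thesis using s by simp
next
  case greater
  have "reversepath g (1 - t) \<in> closure F"
  proof (rule closure_face_arc_upward)
    show "K \<inter> path_image (reversepath g) \<subseteq> {pathstart (reversepath g), pathfinish (reversepath g)}"
      using Kg by auto
    show "F \<in> components (- (K \<union> path_image (reversepath g)))"
      using F by (simp only: path_image_reversepath)
    show "reversepath g (1 - s) \<in> closure F" using s by (simp add: reversepath_def)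
  qed (use K g s t greater in \<open>auto simp: arc_reversepath\<close>)
  then show ?thesis by (simp add: reversepath_def)
qed

lemma path_image_subset_closure_face:
  fixes g :: "real \<Rightarrow> complex"
  assumes K: "closed K" and g: "arc g"
    and Kg: "K \<inter> path_image g \<subseteq> {pathstart g, pathfinish g}"
    and F: "F \<in> components (- (K \<union> path_image g))"
    and q: "q \<in> closure F" "q \<in> path_image g" "q \<notin> {pathstart g, pathfinish g}"
  shows "path_image g \<subseteq> closure F"
proof -
  obtain s where s: "s \<in> {0..1}" "q = g s" using q by (auto simp: path_image_def)
  then have "s \<in> {0<..<1}" using q by (cases "s = 0 \<or> s = 1") (auto simp: pathstart_def pathfinish_def)
  then have "g ` {0<..<1} \<subseteq> closure F" using closure_face_arc[OF K g Kg F] q s by blast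
  moreover have "continuous_on (closure {0<..<1}) g"
    using g by (simp add: arc_def path_def)
  ultimately have "g ` closure {0<..<1} \<subseteq> closure F"
    by (intro image_closure_subset) auto
  then show ?thesis by (simp add: path_image_def)
qed

lemma arc_subset_closure_endless:
  assumes "arc g"
  shows "path_image g \<subseteq> closure (path_image g - {pathstart g, pathfinish g})"
proof -
  have "g ` {0<..<1} \<subseteq> path_image g - {pathstart g, pathfinish g}"
  proof
    fix q assume "q \<in> g ` {0<..<1}"
    then obtain t where t: "t \<in> {0<..<1}" "q = g t" by blast
    have "inj_on g {0..1}" using assms by (simp add: arc_def)
    then have "g t \<noteq> g 0" "g t \<noteq> g 1" using t(1) by (auto simp: inj_on_eq_iff)
    then show "q \<in> path_image g - {pathstart g, pathfinish g}"
      using t by (auto simp: path_image_def pathstart_def pathfinish_def)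
  qed
  then have "g ` {0<..<1} \<subseteq> closure (path_image g - {pathstart g, pathfinish g})"
    using closure_subset by blast
  moreover have "continuous_on (closure {0<..<1}) g" using assms by (simp add: arc_def path_def)
  ultimately have "g ` closure {0<..<1} \<subseteq> closure (path_image g - {pathstart g, pathfinish g})"
    by (intro image_closure_subset) auto
  then show ?thesis by (simp add: path_image_def)
qed

text \<open>Decides on which side of a cut a chord runs: without its ends it is connected, hence
  lies in \<open>U\<close> or in \<open>W\<close>, and one point of the arc off
  \<open>closure U\<close>, usually an end, rules out \<open>U\<close>.\<close>

lemma arc_endless_in_region:
  assumes g: "arc g" "q \<in> path_image g" "q \<notin> closure U" and UW: "open U" "open W" "U \<inter> W = {}"
    and sub: "path_image g - {pathstart g, pathfinish g} \<subseteq> U \<union> W"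
  shows "path_image g - {pathstart g, pathfinish g} \<subseteq> W"
proof -
  let ?g = "path_image g - {pathstart g, pathfinish g}"
  have con: "connected ?g" using g(1) connected_simple_path_endless arc_imp_simple_path by blast
  have "U \<inter> ?g = {} \<or> W \<inter> ?g = {}"
    using connectedD[OF con UW(1,2)] UW(3) sub by blast
  moreover have "\<not> ?g \<subseteq> U"
    using g(2,3) arc_subset_closure_endless[OF g(1)] closure_mono by blast
  ultimately show ?thesis using sub by blast
qed

lemma inside_two_arcs:
  fixes c d :: "real \<Rightarrow> complex"
  assumes "arc c" "arc d" "pathstart c = a" "pathfinish c = b" "pathstart d = a" "pathfinish d = b"
    and "path_image c \<inter> path_image d = {a, b}"
  defines "I \<equiv> inside (path_image c \<union> path_image d)"
  shows "open I" "connected I" "I \<noteq> {}" "frontier I = path_image c \<union> path_image d"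
    "closure I = I \<union> path_image c \<union> path_image d"
proof -
  have "simple_path (c +++ reversepath d)"
    using assms by (intro simple_path_join_loop) (auto simp: arc_reversepath)
  moreover have "path_image (c +++ reversepath d) = path_image c \<union> path_image d"
    using assms by (simp add: path_image_join)
  ultimately show *: "open I" "connected I" "I \<noteq> {}" "frontier I = path_image c \<union> path_image d"
    using Jordan_inside_outside[of "c +++ reversepath d"] assms by simp_all
  show "closure I = I \<union> path_image c \<union> path_image d"
    using closure_Un_frontier[of I] *(4) by auto
qed

text \<open>Two chords of a disc whose endpoints interleave on the boundary cross each other.\<close>

lemma theta_separates:
  fixes c :: "real \<Rightarrow> complex"
  assumes arcs: "arc c1" "arc c2" "arc c"
    and ends: "pathstart c1 = a" "pathfinish c1 = b" "pathstart c2 = a" "pathfinish c2 = b"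
      "pathstart c = a" "pathfinish c = b"
    and c12: "path_image c1 \<inter> path_image c2 = {a, b}"
    and cin: "path_image c - {a, b} \<subseteq> inside (path_image c1 \<union> path_image c2)"
    and S: "connected S" "S \<subseteq> path_image c1 \<union> path_image c2 \<union> inside (path_image c1 \<union> path_image c2)"
      "S \<inter> path_image c = {}" "S \<inter> path_image c1 \<noteq> {}"
  shows "S \<inter> path_image c2 = {}"
proof -
  have ab: "a \<noteq> b" using arc_distinct_ends arcs ends by metis
  have sp: "simple_path c1" "simple_path c2" "simple_path c" using arcs arc_imp_simple_path by auto
  have ne: "path_image c - {a,b} \<noteq> {}"
    using nonempty_simple_path_endless[OF sp(3)] ends by simp
  define J where "J = path_image c1 \<union> path_image c2"
  have jj: "inside J \<inter> J = {}" by (simp add: inside_no_overlap)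
  have "a \<in> path_image c" "b \<in> path_image c"
    using pathstart_in_path_image[of c] pathfinish_in_path_image[of c] ends by simp_all
  moreover have "(path_image c - {a, b}) \<inter> J = {}"
    using cin jj J_def by blast
  ultimately have c1c: "path_image c1 \<inter> path_image c = {a, b}" and c2c: "path_image c2 \<inter> path_image c = {a, b}"
    using c12 unfolding J_def by blast+
  obtain ds: "inside(path_image c1 \<union> path_image c) \<inter> inside(path_image c2 \<union> path_image c) = {}"
    and un: "inside(path_image c1 \<union> path_image c) \<union> inside(path_image c2 \<union> path_image c) \<union>
           (path_image c - {a,b}) = inside J"
    using split_inside_simple_closed_curve[OF sp(1) ends(1,2) sp(2) ends(3,4) sp(3) ends(5,6) ab c12 c1c c2c]
      cin ne J_def by blast
  define I1 where "I1 = inside (path_image c1 \<union> path_image c)"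
  define I2 where "I2 = inside (path_image c2 \<union> path_image c)"
  have cls: "closure I1 = I1 \<union> path_image c1 \<union> path_image c" "closure I2 = I2 \<union> path_image c2 \<union> path_image c"
    unfolding I1_def I2_def
    by (rule inside_two_arcs(5)[OF arcs(1,3) ends(1,2,5,6) c1c], rule inside_two_arcs(5)[OF arcs(2,3) ends(3,4,5,6) c2c])
  have II: "I1 \<inter> I2 = {}" "I1 \<union> I2 \<subseteq> inside J" using ds un by (auto simp: I1_def I2_def)
  have d12: "path_image c1 \<inter> path_image c2 \<subseteq> path_image c" using c12 c1c by blast
  have SS: "S \<subseteq> closure I1 \<union> closure I2"
    using S(2) un cls by (auto simp: J_def I1_def I2_def)
  have I1c: "closure I1 \<inter> path_image c2 \<subseteq> path_image c" and I2c: "closure I2 \<inter> path_image c1 \<subseteq> path_image c"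
    using cls II jj d12 unfolding J_def by blast+
  \<comment> \<open>The two closed halves of the disc meet only on the chord \<open>c\<close>, which
    \<open>S\<close> avoids; so the connected set \<open>S\<close> lies in one half.\<close>
  have "S \<inter> closure I1 \<inter> closure I2 = {}"
    using I1c I2c cls II S(3) by blast
  then have "closure I1 \<inter> S = {} \<or> closure I2 \<inter> S = {}"
    by (intro connected_closedD[OF S(1)] SS) auto
  then show ?thesis
  proof
    assume "closure I1 \<inter> S = {}"
    then show ?thesis using S(4) cls(1) by blast
  next
    assume "closure I2 \<inter> S = {}"
    then show ?thesis using cls(2) by blast
  qed
qed

section \<open>The four pieces of a disc cut by three chords\<close>

lemma Int_eq_singletonI: "B \<inter> J = {a, b} \<Longrightarrow> A \<subseteq> J \<Longrightarrow> a \<in> A \<Longrightarrow> a \<in> B \<Longrightarrow> b \<notin> A \<Longrightarrow> A \<inter> B = {a}"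
  by blast

text \<open>The chords are peeled off one at a time by
  \<open>split_inside_simple_closed_curve\<close>. Each cut needs to know that the remaining chords
  run in the remaining disc; an end of the chord off the closure of the piece already cut away shows
  this. Later the \<open>m\<close>s are the midpoints of the sides of a triangle and each
  \<open>k\<close> turns around one of its vertices.\<close>

lemma hexagon_regions:
  fixes k12 k23 k31 n12 n23 n31 :: "real \<Rightarrow> complex"
  assumes arcs: "arc k12" "arc k23" "arc k31" "arc n12" "arc n23" "arc n31"
    and ks: "pathstart k12 = m1" "pathfinish k12 = m2" "pathstart k23 = m2" "pathfinish k23 = m3"
      "pathstart k31 = m3" "pathfinish k31 = m1"
    and ns: "pathstart n12 = m1" "pathfinish n12 = m2" "pathstart n23 = m2" "pathfinish n23 = m3"
      "pathstart n31 = m3" "pathfinish n31 = m1"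
    and kk: "path_image k12 \<inter> path_image k23 = {m2}" "path_image k23 \<inter> path_image k31 = {m3}"
      "path_image k31 \<inter> path_image k12 = {m1}"
    and nn: "path_image n12 \<inter> path_image n23 = {m2}" "path_image n23 \<inter> path_image n31 = {m3}"
      "path_image n31 \<inter> path_image n12 = {m1}"
    and J: "J = path_image k12 \<union> path_image k23 \<union> path_image k31"
    and N: "N = path_image n12 \<union> path_image n23 \<union> path_image n31"
    and nJ: "N - {m1, m2, m3} \<subseteq> inside J"
    and I: "I12 = inside (path_image k12 \<union> path_image n12)" "I23 = inside (path_image k23 \<union> path_image n23)"
      "I31 = inside (path_image k31 \<union> path_image n31)" "T = inside N"
  shows "inside J \<subseteq> I12 \<union> I23 \<union> I31 \<union> T \<union> N"
    and "I12 \<subseteq> inside J" "I23 \<subseteq> inside J" "I31 \<subseteq> inside J" "T \<subseteq> inside J"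
    and "I12 \<inter> I23 = {}" "I12 \<inter> I31 = {}" "I23 \<inter> I31 = {}" "I12 \<inter> T = {}" "I23 \<inter> T = {}" "I31 \<inter> T = {}"
    and "I12 \<inter> N = {}" "I23 \<inter> N = {}" "I31 \<inter> N = {}" "T \<inter> N = {}"
    and "connected I12" "connected I23" "connected I31"
    and "closure I12 = I12 \<union> path_image k12 \<union> path_image n12"
      "closure I23 = I23 \<union> path_image k23 \<union> path_image n23"
      "closure I31 = I31 \<union> path_image k31 \<union> path_image n31"
    and "open T" "closure T = T \<union> N" "frontier T = N"
proof -
  let ?k12 = "path_image k12" and ?k23 = "path_image k23" and ?k31 = "path_image k31"
  let ?n12 = "path_image n12" and ?n23 = "path_image n23" and ?n31 = "path_image n31"
  have m: "m1 \<noteq> m2" "m2 \<noteq> m3" "m3 \<noteq> m1" using arc_distinct_ends arcs ks by metis+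
  have mk: "m1 \<in> ?k12" "m2 \<in> ?k12" "m2 \<in> ?k23" "m3 \<in> ?k23" "m3 \<in> ?k31" "m1 \<in> ?k31"
    using pathstart_in_path_image pathfinish_in_path_image ks by metis+
  have mn: "m1 \<in> ?n12" "m2 \<in> ?n12" "m2 \<in> ?n23" "m3 \<in> ?n23" "m3 \<in> ?n31" "m1 \<in> ?n31"
    using pathstart_in_path_image pathfinish_in_path_image ns by metis+
  have jj: "inside J \<inter> J = {}" by (simp add: inside_no_overlap)
  have NJ: "N \<inter> J = {m1, m2, m3}" using nJ jj mk mn unfolding J N by blast
  have m3n: "m3 \<notin> ?n12" "m1 \<notin> ?n23" "m2 \<notin> ?n31" using nn mn m by blast+
  have m3k: "m3 \<notin> ?k12" "m1 \<notin> ?k23" "m2 \<notin> ?k31" using kk mk m by blast+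
  have n12J: "?n12 \<inter> J = {m1, m2}" and n23J: "?n23 \<inter> J = {m2, m3}" and n31J: "?n31 \<inter> J = {m3, m1}"
    using NJ m3n mn unfolding N by auto
  have kn: "?k12 \<inter> ?n12 = {m1, m2}" "?k23 \<inter> ?n23 = {m2, m3}" "?k31 \<inter> ?n31 = {m3, m1}"
    using n12J n23J n31J mk mn unfolding J by blast+
  have kJ: "?k12 \<subseteq> J" "?k23 \<subseteq> J" "?k31 \<subseteq> J" using J by blast+
  have kn': "?k23 \<inter> ?n12 = {m2}" "?k31 \<inter> ?n12 = {m1}" "?k12 \<inter> ?n23 = {m2}" "?k31 \<inter> ?n23 = {m3}"
      "?k12 \<inter> ?n31 = {m1}" "?k23 \<inter> ?n31 = {m3}"
    using Int_eq_singletonI[of ?n12 J m2 m1 ?k23] Int_eq_singletonI[of ?n12 J m1 m2 ?k31]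
      Int_eq_singletonI[of ?n23 J m2 m3 ?k12] Int_eq_singletonI[of ?n23 J m3 m2 ?k31]
      Int_eq_singletonI[of ?n31 J m1 m3 ?k12] Int_eq_singletonI[of ?n31 J m3 m1 ?k23]
      n12J n23J n31J m3k mk mn kJ by (simp_all add: insert_commute)
  note i12 = inside_two_arcs[OF arcs(1,4) ks(1,2) ns(1,2) kn(1), folded I]
  note i23 = inside_two_arcs[OF arcs(2,5) ks(3,4) ns(3,4) kn(2), folded I]
  note i31 = inside_two_arcs[OF arcs(3,6) ks(5,6) ns(5,6) kn(3), folded I]
  have ne: "?n12 - {m1, m2} \<noteq> {}" "?n23 - {m2, m3} \<noteq> {}" "?n31 - {m3, m1} \<noteq> {}"
    using nonempty_simple_path_endless arc_imp_simple_path arcs ns by metis+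
  have sub: "?n12 - {m1, m2} \<subseteq> inside J" "?n23 - {m2, m3} \<subseteq> inside J" "?n31 - {m3, m1} \<subseteq> inside J"
    using nJ m3n unfolding N by blast+

  \<comment> \<open>\<open>c2\<close> is the rest of the curve \<open>J\<close> beside
    \<open>k12\<close>, so \<open>I'\<close> is what remains of the disc after cutting off
    \<open>I12\<close>.\<close>
  define c2 where "c2 = reversepath (k23 +++ k31)"
  have c2: "arc c2" "pathstart c2 = m1" "pathfinish c2 = m2" "path_image c2 = ?k23 \<union> ?k31"
    using arcs ks kk by (auto simp: c2_def path_image_join intro!: arc_reversepath arc_join)
  have c2n: "path_image c2 \<inter> ?n12 = {m1, m2}" using c2(4) kn' by auto
  define I' where "I' = inside (path_image c2 \<union> ?n12)"
  have J2: "J = ?k12 \<union> path_image c2" using c2(4) J by blast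
  have k12c2: "?k12 \<inter> path_image c2 = {m1, m2}" using c2(4) kk by auto
  have A: "I12 \<inter> I' = {}" "I12 \<union> I' \<union> (?n12 - {m1, m2}) = inside J"
    using split_inside_simple_closed_curve[OF arcs(1)[THEN arc_imp_simple_path] ks(1,2) c2(1)[THEN arc_imp_simple_path]
        c2(2,3) arcs(4)[THEN arc_imp_simple_path] ns(1,2) m(1) k12c2 kn(1) c2n] ne(1) sub(1)
    unfolding J2[symmetric] I'_def[symmetric] I(1)[symmetric] by blast+
  note i' = inside_two_arcs[OF c2(1) arcs(4) c2(2,3) ns(1,2) c2n, folded I'_def]
  have "?n23 - {m2, m3} \<subseteq> I12 \<union> I'" using sub(2) A(2) nn by blast
  \<comment> \<open>Both remaining chords end in \<open>m3\<close>, so this single fact keeps both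
    of them out of \<open>I12\<close>.\<close>
  moreover have m3c: "m3 \<notin> closure I12" using i12(5) m3n m3k A(2) jj mk unfolding J by blast
  ultimately have n23I: "?n23 - {m2, m3} \<subseteq> I'"
    using arc_endless_in_region[OF arcs(5) _ _ i12(1) i'(1) A(1)] mn ns by simp

  \<comment> \<open>The remaining disc \<open>I'\<close> has boundary \<open>k23\<close> and
    \<open>c3\<close>, and \<open>n23\<close> is a chord between the ends of these two arcs.\<close>
  define c3 where "c3 = reversepath n12 +++ reversepath k31"
  have c3: "arc c3" "pathstart c3 = m2" "pathfinish c3 = m3" "path_image c3 = ?n12 \<union> ?k31"
    using arcs ks ns kn' by (auto simp: c3_def path_image_join arc_reversepath intro!: arc_join)
  have c3n: "path_image c3 \<inter> ?n23 = {m2, m3}" using c3(4) kn' nn by auto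
  have k23c3: "?k23 \<inter> path_image c3 = {m2, m3}" using c3(4) kn' kk by auto
  define I'' where "I'' = inside (path_image c3 \<union> ?n23)"
  have J3: "path_image c2 \<union> ?n12 = ?k23 \<union> path_image c3" using c2(4) c3(4) by blast
  have n23m: "?n23 \<inter> inside (?k23 \<union> path_image c3) \<noteq> {}"
    using n23I ne(2) unfolding I'_def J3 by blast
  have B: "I23 \<inter> I'' = {}" "I23 \<union> I'' \<union> (?n23 - {m2, m3}) = I'"
    using split_inside_simple_closed_curve[OF arcs(2)[THEN arc_imp_simple_path] ks(3,4) c3(1)[THEN arc_imp_simple_path]
        c3(2,3) arcs(5)[THEN arc_imp_simple_path] ns(3,4) m(2) k23c3 kn(2) c3n n23m]
    unfolding J3[symmetric] I'_def[symmetric] I''_def[symmetric] I(2)[symmetric] by blast+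
  note i'' = inside_two_arcs[OF c3(1) arcs(5) c3(2,3) ns(3,4) c3n, folded I''_def]
  have AB: "I12 \<inter> (I23 \<union> I'') = {}" using A(1) B(2) by blast
  \<comment> \<open>The last chord must be kept out of two pieces: its end \<open>m3\<close>
    excludes \<open>I12\<close>, its end \<open>m1\<close> excludes \<open>I23\<close>.\<close>
  have "?n31 - {m3, m1} \<subseteq> I12 \<union> (I23 \<union> I'')" using sub(3) A(2) B(2) nn by blast
  then have "?n31 - {m3, m1} \<subseteq> I23 \<union> I''"
    using arc_endless_in_region[OF arcs(6) _ _ i12(1) open_Un[OF i23(1) i''(1)] AB, of m3] m3c mn ns by simp
  moreover have "m1 \<notin> closure I23" using i23(5) m3n m3k B(2) A(2) jj mk unfolding J by blast
  ultimately have n31I: "?n31 - {m3, m1} \<subseteq> I''"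
    using arc_endless_in_region[OF arcs(6) _ _ i23(1) i''(1) B(1), of m1] mn ns by simp

  \<comment> \<open>Now \<open>I''\<close> has boundary \<open>k31\<close> and \<open>c4\<close>;
    cutting along \<open>n31\<close> leaves the centre, whose boundary \<open>c4\<close> with
    \<open>n31\<close> is all of \<open>N\<close>.\<close>
  define c4 where "c4 = reversepath n23 +++ reversepath n12"
  have c4: "arc c4" "pathstart c4 = m3" "pathfinish c4 = m1" "path_image c4 = ?n12 \<union> ?n23"
    using arcs ns nn by (auto simp: c4_def path_image_join arc_reversepath intro!: arc_join)
  have c4n: "path_image c4 \<inter> ?n31 = {m3, m1}" using c4(4) nn by auto
  have k31c4: "?k31 \<inter> path_image c4 = {m3, m1}" using c4(4) kn' by auto
  have J4: "path_image c3 \<union> ?n23 = ?k31 \<union> path_image c4" "N = path_image c4 \<union> ?n31"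
    using c3(4) c4(4) N by blast+
  have n31m: "?n31 \<inter> inside (?k31 \<union> path_image c4) \<noteq> {}"
    using n31I ne(3) unfolding I''_def J4(1) by blast
  have C: "I31 \<inter> T = {}" "I31 \<union> T \<union> (?n31 - {m3, m1}) = I''"
    using split_inside_simple_closed_curve[OF arcs(3)[THEN arc_imp_simple_path] ks(5,6) c4(1)[THEN arc_imp_simple_path]
        c4(2,3) arcs(6)[THEN arc_imp_simple_path] ns(5,6) m(3) k31c4 kn(3) c4n n31m]
    unfolding J4(1)[symmetric] I''_def[symmetric] I(3)[symmetric] J4(2)[symmetric] I(4)[symmetric] by blast+
  note i4 = inside_two_arcs[OF c4(1) arcs(6) c4(2,3) ns(5,6) c4n, folded J4(2), folded I(4)]
  show "connected I12" "connected I23" "connected I31" "closure I12 = I12 \<union> ?k12 \<union> ?n12"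
    "closure I23 = I23 \<union> ?k23 \<union> ?n23" "closure I31 = I31 \<union> ?k31 \<union> ?n31" "open T"
    using i12 i23 i31 i4 by blast+
  show "frontier T = N" using i4(4) J4(2) by simp
  show "closure T = T \<union> N" using i4(5) J4(2) by blast
  show s: "I12 \<subseteq> inside J" "I23 \<subseteq> inside J" "I31 \<subseteq> inside J" "T \<subseteq> inside J"
    using A B C by blast+
  show "I12 \<inter> I23 = {}" "I12 \<inter> I31 = {}" "I23 \<inter> I31 = {}" "I12 \<inter> T = {}" "I23 \<inter> T = {}" "I31 \<inter> T = {}"
    using A B C by blast+
  show "T \<inter> N = {}" by (simp add: I(4) inside_no_overlap)
  have o: "I12 \<inter> ?n12 = {}" "I23 \<inter> ?n23 = {}" "I31 \<inter> ?n31 = {}" "I' \<inter> ?n12 = {}" "I'' \<inter> ?n23 = {}"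
    using inside_no_overlap[of "?k12 \<union> ?n12"] inside_no_overlap[of "?k23 \<union> ?n23"] inside_no_overlap[of "?k31 \<union> ?n31"]
      inside_no_overlap[of "path_image c2 \<union> ?n12"] inside_no_overlap[of "path_image c3 \<union> ?n23"]
    unfolding I I'_def I''_def by blast+
  have oJ: "I12 \<inter> {m1, m2, m3} = {}" "I23 \<inter> {m1, m2, m3} = {}" "I31 \<inter> {m1, m2, m3} = {}"
    using s jj mk unfolding J by blast+
  show "I12 \<inter> N = {}" using o(1) oJ(1) n23I n31I A(1) B(2) unfolding N by blast
  show "I23 \<inter> N = {}" using o(2,4) oJ(2) n31I B unfolding N by blast
  show "I31 \<inter> N = {}" using o(3,4,5) oJ(3) B(2) C(2) unfolding N by blast
  show "inside J \<subseteq> I12 \<union> I23 \<union> I31 \<union> T \<union> N" using A(2) B(2) C(2) unfolding N by blast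
qed

text \<open>Says that the pair \<open>a\<close>, \<open>b\<close> interleaves with \<open>z\<close>,
  \<open>w\<close> on the closed curve. The two arcs are made explicit because
  \<open>theta_separates\<close> takes the boundary of the disc in this form.\<close>

definition loop_separates :: "(real \<Rightarrow> complex) \<Rightarrow> complex \<Rightarrow> complex \<Rightarrow> complex \<Rightarrow> complex \<Rightarrow> bool" where
  "loop_separates c a b z w \<longleftrightarrow> (\<exists>u d. arc u \<and> arc d \<and> pathstart u = a \<and> pathfinish u = b \<and>
     pathstart d = a \<and> pathfinish d = b \<and> path_image u \<inter> path_image d = {a, b} \<and>
     path_image u \<union> path_image d = path_image c \<and> z \<in> path_image u \<and> w \<in> path_image d)"

lemma loop_separates_sym:
  assumes "loop_separates c a b z w"
  shows "loop_separates c b a z w"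
proof -
  obtain u d where "arc u" "arc d" "pathstart u = a" "pathfinish u = b"
     "pathstart d = a" "pathfinish d = b" "path_image u \<inter> path_image d = {a, b}"
     "path_image u \<union> path_image d = path_image c" "z \<in> path_image u" "w \<in> path_image d"
    using assms unfolding loop_separates_def by blast
  then show ?thesis
    unfolding loop_separates_def
    by (intro exI[of _ "reversepath u"] exI[of _ "reversepath d"]) (auto simp: arc_reversepath)
qed

lemma loop_separates_ordered:
  assumes c: "simple_path c" "c 1 = c 0" and t: "0 < s" "s < r" "r < t" "t < (1::real)"
  shows "loop_separates c (c s) (c t) (c 0) (c r)"
proof -
  \<comment> \<open>Before reversal, the first arc runs from parameter \<open>t\<close> to 1 and on
    from 0 to \<open>s\<close>, through the base point.\<close>
  let ?u = "reversepath (subpath t 1 c +++ subpath 0 s c)" and ?d = "subpath s t c"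
  have inj: "x = y \<or> {x, y} = {0, 1}" if "c x = c y" "x \<in> {0..1}" "y \<in> {0..1}" for x y
    using c(1) that unfolding simple_path_def loop_free_def by blast
  have a: "arc (subpath t 1 c)" "arc (subpath 0 s c)" "arc ?d"
    using t by (auto intro!: arc_simple_path_subpath_interior c)
  have i: "path_image (subpath t 1 c) = c ` {t..1}" "path_image (subpath 0 s c) = c ` {0..s}"
    "path_image ?d = c ` {s..t}"
    using t by (auto simp: path_image_subpath)
  have "c ` {t..1} \<inter> c ` {0..s} \<subseteq> {c 0}"
  proof
    fix q assume "q \<in> c ` {t..1} \<inter> c ` {0..s}"
    then obtain x y where xy: "x \<in> {t..1}" "y \<in> {0..s}" "q = c x" "c x = c y" by blast
    then have "x \<noteq> y" "x \<in> {0..1}" "y \<in> {0..1}" using t by auto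
    then have "{x, y} = {0, 1}" using inj xy by blast
    then show "q \<in> {c 0}" using xy c(2) by (auto simp: doubleton_eq_iff)
  qed
  then have u: "arc ?u"
    using a i c(2) by (intro arc_reversepath arc_join) (auto simp: pathstart_def pathfinish_def subpath_def)
  have ui: "path_image ?u = c ` {t..1} \<union> c ` {0..s}"
    using i c(2) by (simp add: path_image_join)
  have un: "(c ` {t..1} \<union> c ` {0..s}) \<union> c ` {s..t} = path_image c"
  proof -
    have "{t..1} \<union> {0..s} \<union> {s..t} = {0..1}" using t by auto
    then show ?thesis unfolding path_image_def image_Un[symmetric] by simp
  qed
  have int: "(c ` {t..1} \<union> c ` {0..s}) \<inter> c ` {s..t} = {c s, c t}"
  proof
    show "(c ` {t..1} \<union> c ` {0..s}) \<inter> c ` {s..t} \<subseteq> {c s, c t}"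
    proof
      fix q assume q: "q \<in> (c ` {t..1} \<union> c ` {0..s}) \<inter> c ` {s..t}"
      then obtain x where "x \<in> {t..1} \<union> {0..s}" "q = c x" by blast
      moreover obtain y where "y \<in> {s..t}" "q = c y" using q by blast
      ultimately have xy: "x \<in> {t..1} \<union> {0..s}" "y \<in> {s..t}" "q = c x" "c x = c y" by auto
      have "{x, y} \<noteq> {0, 1}" using xy(2) t by (auto simp: doubleton_eq_iff)
      moreover have "x \<in> {0..1}" "y \<in> {0..1}" using xy(1,2) t by auto
      ultimately have "x = y" using inj xy(4) by blast
      then show "q \<in> {c s, c t}" using xy t by auto
    qed
    show "{c s, c t} \<subseteq> (c ` {t..1} \<union> c ` {0..s}) \<inter> c ` {s..t}" using t by auto
  qed
  show ?thesis
    unfolding loop_separates_def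
  proof (intro exI conjI)
    show "arc ?u" "arc ?d" by (rule u a(3))+
    show "pathstart ?u = c s" "pathfinish ?u = c t" "pathstart ?d = c s" "pathfinish ?d = c t"
      by simp_all
    show "path_image ?u \<inter> path_image ?d = {c s, c t}" "path_image ?u \<union> path_image ?d = path_image c"
      unfolding ui i(3) by (rule int un)+
    show "c 0 \<in> path_image ?u" unfolding ui using t by auto
    show "c r \<in> path_image ?d" unfolding i(3) using t by auto
  qed
qed

text \<open>Shifting the parametrisation to start at \<open>z\<close> turns the cyclic order into a
  linear one. Of the three parameters the middle one belongs to the point that the other two
  separate from \<open>z\<close>.\<close>

lemma loop_separates_three:
  assumes c: "simple_path c" "pathfinish c = pathstart c"
    and m: "m1 \<in> path_image c" "m2 \<in> path_image c" "m3 \<in> path_image c" "z \<in> path_image c"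
      "distinct [z, m1, m2, m3]"
  shows "loop_separates c m1 m2 z m3 \<or> loop_separates c m1 m3 z m2 \<or> loop_separates c m2 m3 z m1"
proof -
  obtain w where w: "w \<in> {0..1}" "c w = z" using m(4) by (auto simp: path_image_def)
  define d where "d = shiftpath w c"
  have d: "simple_path d" "pathfinish d = pathstart d"
    using c w by (auto simp: d_def simple_path_shiftpath pathfinish_shiftpath pathstart_shiftpath)
  have di: "path_image d = path_image c" using c w by (simp add: d_def path_image_shiftpath)
  have d0: "d 0 = z" using w by (auto simp: d_def shiftpath_def)
  have d1: "d 1 = d 0" using d(2) by (simp add: pathfinish_def pathstart_def)
  have ls: "loop_separates c a b x y = loop_separates d a b x y" for a b x y
    by (simp add: loop_separates_def di)
  have ex: "\<exists>t. 0 < t \<and> t < 1 \<and> d t = q" if q: "q \<in> path_image c" "q \<noteq> z" for q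
  proof -
    obtain t where t: "t \<in> {0..1}" "d t = q" using q(1) unfolding di[symmetric] by (auto simp: path_image_def)
    then have "t \<noteq> 0" "t \<noteq> 1" using d0 d1 q(2) by auto
    then show ?thesis using t by (intro exI[of _ t]) auto
  qed
  obtain t1 t2 t3 where t: "0 < t1" "t1 < 1" "d t1 = m1" "0 < t2" "t2 < 1" "d t2 = m2"
    "0 < t3" "t3 < 1" "d t3 = m3"
    using ex[of m1] ex[of m2] ex[of m3] m by auto
  have "t1 \<noteq> t2" "t1 \<noteq> t3" "t2 \<noteq> t3" using t m(5) by auto
  then consider "t1 < t2" "t2 < t3" | "t1 < t3" "t3 < t2" | "t2 < t1" "t1 < t3" | "t2 < t3" "t3 < t1"
    | "t3 < t1" "t1 < t2" | "t3 < t2" "t2 < t1" by linarith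
  then show ?thesis
    unfolding ls using t d0 loop_separates_ordered[OF d(1) d1] loop_separates_sym by cases metis+
qed

section \<open>Plane graphs\<close>

locale plane_graph =
  fixes V :: "'v set" and E :: "'v set set"
    and p :: "'v \<Rightarrow> complex" and \<gamma> :: "'v set \<Rightarrow> real \<Rightarrow> complex"
  assumes simple: "simple_graph V E" and emb: "plane_embedding V E p \<gamma>"
begin

definition arcs :: "'v set set \<Rightarrow> complex set" where
  "arcs A = (\<Union>e\<in>A. path_image (\<gamma> e))"

lemma finite_V: "finite V" and edge_subset: "e \<in> E \<Longrightarrow> e \<subseteq> V" and card_edge: "e \<in> E \<Longrightarrow> card e = 2"
  using simple by (auto simp: simple_graph_def)

lemma finite_E: "finite E"
  by (rule finite_subset[of _ "Pow V"]) (use finite_V edge_subset in auto)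

lemma inj_p: "inj_on p V"
  using emb by (simp add: plane_embedding_def)

lemma arc_edge: "e \<in> E \<Longrightarrow> arc (\<gamma> e)"
  and edge_ends: "e \<in> E \<Longrightarrow> {pathstart (\<gamma> e), pathfinish (\<gamma> e)} = p ` e"
  and edge_Int_vertices: "e \<in> E \<Longrightarrow> path_image (\<gamma> e) \<inter> p ` V = p ` e"
  using emb by (simp_all add: plane_embedding_def)

lemma edges_Int: "e \<in> E \<Longrightarrow> e' \<in> E \<Longrightarrow> e \<noteq> e' \<Longrightarrow> path_image (\<gamma> e) \<inter> path_image (\<gamma> e') \<subseteq> p ` (e \<inter> e')"
  using emb unfolding plane_embedding_def by blast

lemma vertex_in_edge_iff: "e \<in> E \<Longrightarrow> v \<in> V \<Longrightarrow> p v \<in> path_image (\<gamma> e) \<longleftrightarrow> v \<in> e"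
  using edge_Int_vertices[of e] edge_subset[of e] inj_p
  by (metis IntI Int_iff image_eqI inj_on_image_mem_iff)

lemma compact_arcs: "A \<subseteq> E \<Longrightarrow> compact (arcs A)"
  unfolding arcs_def using finite_E arc_edge
  by (intro compact_UN) (auto intro: finite_subset compact_arc_image)

lemma closed_arcs: "A \<subseteq> E \<Longrightarrow> closed (arcs A)"
  using compact_arcs compact_imp_closed by blast

lemma arcs_mono: "A \<subseteq> B \<Longrightarrow> arcs A \<subseteq> arcs B"
  by (auto simp: arcs_def)

lemma arcs_insert: "arcs (insert e A) = arcs A \<union> path_image (\<gamma> e)"
  by (auto simp: arcs_def)

lemma arcs_Int_edge:
  assumes "A \<subseteq> E" "e \<in> E" "e \<notin> A"
  shows "arcs A \<inter> path_image (\<gamma> e) \<subseteq> {pathstart (\<gamma> e), pathfinish (\<gamma> e)}"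
proof -
  have "path_image (\<gamma> e') \<inter> path_image (\<gamma> e) \<subseteq> p ` e" if "e' \<in> A" for e'
    using edges_Int[of e' e] that assms by blast
  then show ?thesis unfolding arcs_def edge_ends[OF assms(2)] by blast
qed

text \<open>Induction on the edges. If adding \<open>e\<close> creates the separation, Janiszewski's
  theorem forces both ends of \<open>e\<close> into the old part \<open>?K\<close>, and even into
  one path component of it; an arc of \<open>?K\<close> between these ends closes up with
  \<open>e\<close> to the desired curve.\<close>

lemma separating_simple_closed_curve:
  assumes "finite A" "A \<subseteq> E" "x \<notin> arcs A" "y \<notin> arcs A"
    and "\<not> connected_component (- arcs A) x y"
  shows "\<exists>c. simple_path c \<and> pathfinish c = pathstart c \<and> path_image c \<subseteq> arcs A \<and>
    \<not> connected_component (- path_image c) x y"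
  using assms
proof (induction A)
  case empty
  have "connected (UNIV :: complex set)" by (rule connected_UNIV)
  then have "connected_component (UNIV :: complex set) x y" unfolding connected_component_def by blast
  then show ?case using empty.prems by (simp add: arcs_def)
next
  case (insert e A)
  let ?K = "arcs A" and ?g = "\<gamma> e"
  define a where "a = pathstart ?g"
  define b where "b = pathfinish ?g"
  have AE: "A \<subseteq> E" and eE: "e \<in> E" using insert.prems by auto
  have g: "arc ?g" using arc_edge eE by blast
  have cK: "closed ?K" using closed_arcs AE by blast
  have Kg: "?K \<inter> path_image ?g \<subseteq> {a, b}"
    using arcs_Int_edge[OF AE eE insert.hyps(2)] by (simp add: a_def b_def)
  have xy: "x \<notin> ?K" "y \<notin> ?K" "x \<notin> path_image ?g" "y \<notin> path_image ?g"
    and ncc: "\<not> connected_component (- (?K \<union> path_image ?g)) x y"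
    using insert.prems by (auto simp: arcs_insert)
  have sub: "?K \<subseteq> arcs (insert e A)" by (auto simp: arcs_insert)
  show ?case
  proof (cases "connected_component (- ?K) x y")
    case False
    then show ?thesis using insert.IH AE xy sub by blast
  next
    case True
    have "\<not> connected (?K \<inter> path_image ?g)"
      using connected_component_Un_arc[OF cK g _ True] xy ncc by blast
    then have abK: "a \<in> ?K" "b \<in> ?K"
      using Kg connected_subset_singleton[of "?K \<inter> path_image ?g"] by blast+
    have ab: "a \<noteq> b" "a \<in> path_image ?g" "b \<in> path_image ?g"
      using arc_distinct_ends[OF g] by (auto simp: a_def b_def)
    show ?thesis
    proof (cases "path_component ?K b a")
      case pc: True
      then obtain h where h: "arc h" "path_image h \<subseteq> ?K" "pathstart h = b" "pathfinish h = a"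
        unfolding path_component_def using path_contains_arc ab(1) by (metis order_trans)
      let ?c = "?g +++ h"
      have c: "simple_path ?c" "pathfinish ?c = pathstart ?c"
        using g h Kg by (auto simp: a_def b_def intro!: simple_path_join_loop)
      have ci: "path_image ?c = path_image ?g \<union> path_image h"
        using h by (simp add: path_image_join b_def)
      \<comment> \<open>The curve meets \<open>?K\<close> exactly in the connected set
        \<open>path_image h\<close>. If neither of the two separated, their union, which is
        \<open>?K\<close> with \<open>e\<close>, would not separate either.\<close>
      have "\<not> connected_component (- path_image ?c) x y"
      proof
        assume cc: "connected_component (- path_image ?c) x y"
        have "a \<in> path_image h" "b \<in> path_image h"
          using h(3,4) pathstart_in_path_image[of h] pathfinish_in_path_image[of h] by auto
        then have "path_image ?c \<inter> ?K = path_image h" using ci Kg h(2) by blast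
        then have "connected (path_image ?c \<inter> ?K)" using h(1) connected_arc_image by metis
        moreover have "compact (path_image ?c)" using c(1) compact_simple_path_image by blast
        ultimately have "connected_component (- (path_image ?c \<union> ?K)) x y"
          using Janiszewski cK cc True by blast
        moreover have "path_image ?c \<union> ?K = ?K \<union> path_image ?g" using ci h(2) by blast
        ultimately show False using ncc by simp
      qed
      moreover have "path_image ?c \<subseteq> arcs (insert e A)" using ci h(2) by (auto simp: arcs_insert)
      ultimately show ?thesis using c by blast
    next
      case npc: False
      \<comment> \<open>The edges reachable from the end \<open>a\<close>. The edge \<open>e\<close>
        meets them in at most \<open>a\<close> and the other edges in at most \<open>b\<close>, so
        the union can be built in two steps without ever separating \<open>x\<close> from
        \<open>y\<close>.\<close>
      define A1 where "A1 = {e'\<in>A. \<exists>z\<in>path_image (\<gamma> e'). path_component ?K a z}"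
      have pc: "path_component ?K z w" if "e' \<in> A" "z \<in> path_image (\<gamma> e')" "w \<in> path_image (\<gamma> e')" for e' z w
      proof -
        have "path_component (path_image (\<gamma> e')) z w"
          using that AE arc_edge arc_imp_path path_connected_path_image path_connected_component by (meson subsetD)
        then show ?thesis
          by (rule path_component_of_subset[rotated]) (use that in \<open>auto simp: arcs_def\<close>)
      qed
      have in1: "path_component ?K a z" if "z \<in> arcs A1" for z
        using that pc path_component_trans unfolding arcs_def A1_def by blast
      have in2: "\<not> path_component ?K a z" if "z \<in> arcs (A - A1)" for z
        using that unfolding arcs_def A1_def by blast
      have un: "?K = arcs A1 \<union> arcs (A - A1)" unfolding arcs_def A1_def by blast
      have "b \<notin> arcs A1" using in1 npc path_component_sym by blast
      moreover have "a \<notin> arcs (A - A1)" using in2 abK(1) path_component_refl by blast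
      ultimately have i: "arcs A1 \<inter> path_image ?g \<subseteq> {a}" "(path_image ?g \<union> arcs A1) \<inter> arcs (A - A1) \<subseteq> {b}"
        using Kg un in1 in2 by blast+
      have A1E: "A1 \<subseteq> E" "A - A1 \<subseteq> E" using AE by (auto simp: A1_def)
      have "connected_component (- (arcs A1 \<union> path_image ?g)) x y"
      proof (rule connected_component_Un_arc[OF closed_arcs[OF A1E(1)] g connected_subset_singleton[OF i(1)]])
        show "connected_component (- arcs A1) x y"
          by (rule connected_component_of_subset[OF True]) (use un in blast)
      qed (use xy in auto)
      moreover have "connected_component (- arcs (A - A1)) x y"
        by (rule connected_component_of_subset[OF True]) (use un in blast)
      moreover have "compact (path_image ?g \<union> arcs A1)"
        using compact_arcs[OF A1E(1)] g compact_arc_image by blast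
      ultimately have "connected_component (- ((path_image ?g \<union> arcs A1) \<union> arcs (A - A1))) x y"
        using Janiszewski[of "path_image ?g \<union> arcs A1"] closed_arcs[OF A1E(2)]
          connected_subset_singleton[OF i(2)] by (simp add: Un_commute)
      moreover have "(path_image ?g \<union> arcs A1) \<union> arcs (A - A1) = ?K \<union> path_image ?g"
        using un by blast
      ultimately show ?thesis using ncc by simp
    qed
  qed
qed

end

section \<open>Boundary edges of faces and minimal separating sets of edges\<close>

context plane_graph
begin

lemma drawing_eq: "drawing V E p \<gamma> = p ` V \<union> arcs E"
  by (simp add: drawing_def arcs_def)

lemma compact_drawing: "compact (drawing V E p \<gamma>)"
  unfolding drawing_eq using finite_V compact_arcs by (simp add: compact_Un finite_imp_compact)

lemma drawing_minus_edge:
  assumes "e \<in> E" "q \<in> path_image (\<gamma> e)" "q \<notin> p ` V"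
  shows "q \<notin> p ` V \<union> arcs (E - {e})"
  using assms arcs_Int_edge[of "E - {e}" e] edge_ends[of e] edge_subset[of e] by blast

lemma frontier_face_subset: "F \<in> faces V E p \<gamma> \<Longrightarrow> frontier F \<subseteq> drawing V E p \<gamma>"
  unfolding faces_def using frontier_component_compl_subset compact_drawing compact_imp_closed by blast

lemma face_disjoint_drawing: "F \<in> faces V E p \<gamma> \<Longrightarrow> F \<inter> drawing V E p \<gamma> = {}"
  unfolding faces_def using in_components_subset by blast

text \<open>The rest \<open>?K\<close> of the drawing meets the edge only in its ends, so
  \<open>path_image_subset_closure_face\<close> spreads the frontier from one inner point to the
  whole edge.\<close>

lemma boundary_edgeI:
  assumes F: "F \<in> faces V E p \<gamma>" and e: "e \<in> E"
    and q: "q \<in> frontier F" "q \<in> path_image (\<gamma> e)" "q \<notin> p ` V"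
  shows "e \<in> boundary_edges E \<gamma> F"
proof -
  let ?K = "p ` V \<union> arcs (E - {e})"
  have "closed ?K" using finite_V closed_arcs[of "E - {e}"] by (simp add: closed_Un finite_imp_closed)
  moreover have "?K \<inter> path_image (\<gamma> e) \<subseteq> {pathstart (\<gamma> e), pathfinish (\<gamma> e)}"
    using arcs_Int_edge[of "E - {e}" e] e edge_Int_vertices[OF e] edge_ends[OF e] by blast
  moreover have "?K \<union> path_image (\<gamma> e) = drawing V E p \<gamma>"
    using e unfolding drawing_eq arcs_def by blast
  moreover have "q \<notin> {pathstart (\<gamma> e), pathfinish (\<gamma> e)}"
    using q(3) edge_ends[OF e] edge_subset[OF e] by blast
  ultimately have "path_image (\<gamma> e) \<subseteq> closure F"
    using path_image_subset_closure_face[of ?K "\<gamma> e" F q] arc_edge[OF e] F q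
    by (simp add: faces_def frontier_def)
  moreover have "open F"
    using F compact_drawing compact_imp_closed open_components unfolding faces_def by blast
  moreover have "path_image (\<gamma> e) \<inter> F = {}"
    using face_disjoint_drawing[OF F] e unfolding drawing_eq arcs_def by blast
  ultimately show ?thesis
    using e by (auto simp: boundary_edges_def frontier_def interior_open)
qed

text \<open>The vertices appear separately because an isolated vertex lies on the frontier of a face
  without being on any boundary edge.\<close>

lemma frontier_face_edges:
  assumes "F \<in> faces V E p \<gamma>"
  shows "frontier F \<subseteq> p ` V \<union> arcs (boundary_edges E \<gamma> F)"
proof
  fix q assume q: "q \<in> frontier F"
  show "q \<in> p ` V \<union> arcs (boundary_edges E \<gamma> F)"
  proof (cases "q \<in> p ` V")
    case False
    then obtain e where "e \<in> E" "q \<in> path_image (\<gamma> e)"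
      using frontier_face_subset[OF assms] q unfolding drawing_eq arcs_def by blast
    then show ?thesis using boundary_edgeI[OF assms _ q] False unfolding arcs_def by blast
  qed simp
qed

lemma other_endpoint:
  assumes "e \<in> E" "v \<in> e"
  obtains w where "e = {v, w}" "w \<noteq> v"
  using card_edge[OF assms(1)] assms(2) by (auto simp: card_2_iff)

text \<open>An edge with a loose end meets the other edges in at most one point, so by Janiszewski's
  theorem it contributes nothing to a separation.\<close>

lemma minimal_separating_degree:
  assumes A: "A \<subseteq> E" "x \<notin> arcs A" "y \<notin> arcs A" "\<not> connected_component (- arcs A) x y"
    and min: "\<And>e. e \<in> A \<Longrightarrow> connected_component (- arcs (A - {e})) x y"
    and e: "e \<in> A" "v \<in> e"
  shows "\<exists>e'\<in>A - {e}. v \<in> e'"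
proof (rule ccontr)
  assume neg: "\<not> ?thesis"
  have eE: "e \<in> E" using e A by blast
  obtain w where w: "e = {v, w}" "w \<noteq> v" using other_endpoint eE e(2) by blast
  have "v \<in> V" using edge_subset eE e by blast
  have "p v \<notin> path_image (\<gamma> e')" if "e' \<in> A - {e}" for e'
    using vertex_in_edge_iff[of e' v] \<open>v \<in> V\<close> neg that A by blast
  then have "p v \<notin> arcs (A - {e})" unfolding arcs_def by blast
  then have "arcs (A - {e}) \<inter> path_image (\<gamma> e) \<subseteq> {p w}"
    using arcs_Int_edge[of "A - {e}" e] A(1) eE edge_ends[OF eE] w(1) by auto
  moreover have "arcs (A - {e}) \<union> path_image (\<gamma> e) = arcs A" using e by (auto simp: arcs_def)
  moreover have "closed (arcs (A - {e}))" using A by (intro closed_arcs) auto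
  ultimately show False
    using connected_component_Un_arc[OF _ arc_edge[OF eE] connected_subset_singleton min[OF e(1)],
        of "p w"] A e by auto
qed

text \<open>A separating curve found inside \<open>arcs A\<close> must use all of it. If it missed a
  point of an edge, the edge could be interrupted there; its two stumps are attached to the other
  edges in at most one point each and hence, by minimality, what is left does not separate, although
  it still contains the curve.\<close>

lemma minimal_separating_loop:
  assumes A: "A \<subseteq> E" "x \<notin> arcs A" "y \<notin> arcs A" "\<not> connected_component (- arcs A) x y"
    and min: "\<And>e. e \<in> A \<Longrightarrow> connected_component (- arcs (A - {e})) x y"
  shows "\<exists>c. simple_path c \<and> pathfinish c = pathstart c \<and> path_image c = arcs A \<and>
    \<not> connected_component (- path_image c) x y"
proof -
  have "finite A" using A finite_E finite_subset by blast
  then obtain c where c: "simple_path c" "pathfinish c = pathstart c" "path_image c \<subseteq> arcs A"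
    "\<not> connected_component (- path_image c) x y"
    using separating_simple_closed_curve A by blast
  have "path_image (\<gamma> e) \<subseteq> path_image c" if e: "e \<in> A" for e
  proof (rule ccontr)
    let ?g = "\<gamma> e"
    assume "\<not> path_image ?g \<subseteq> path_image c"
    then obtain w where w: "w \<in> {0..1}" "?g w \<notin> path_image c"
      unfolding path_image_def[of ?g] by blast
    have eE: "e \<in> E" using e A by blast
    have g: "arc ?g" using arc_edge eE by blast
    have inj: "u = v" if "?g u = ?g v" "u \<in> {0..1}" "v \<in> {0..1}" for u v
      using g that by (auto simp: arc_def inj_on_def)
    \<comment> \<open>The image of the curve is closed, so it cannot contain all inner points of the
      edge and miss an end.\<close>
    have "\<exists>t\<in>{0<..<1}. ?g t \<notin> path_image c"
    proof (rule ccontr)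
      assume "\<not> ?thesis"
      then have "?g ` {0<..<1} \<subseteq> path_image c" by auto
      then have "?g ` closure {0<..<1} \<subseteq> path_image c"
        using g c(1) by (intro image_closure_subset) (auto simp: arc_def path_def closed_simple_path_image)
      then have "?g ` {0..1} \<subseteq> path_image c" by simp
      then show False using w by blast
    qed
    then obtain t where t: "t \<in> {0<..<1}" "?g t \<notin> path_image c" by blast
    have "continuous_on {0<..<1} ?g"
      by (rule continuous_on_subset[of "{0..1}"]) (use g in \<open>auto simp: arc_def path_def\<close>)
    then have op: "open ({0<..<1} \<inter> ?g -` (- path_image c))"
      using c(1) by (intro continuous_open_preimage) (auto simp: closed_simple_path_image)
    have "t \<in> {0<..<1} \<inter> ?g -` (- path_image c)" using t by simp
    then obtain d where d: "d > 0" "ball t d \<subseteq> {0<..<1} \<inter> ?g -` (- path_image c)"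
      using op unfolding open_contains_ball by blast
    define t1 where "t1 = t - d/2"
    define t2 where "t2 = t + d/2"
    have tm: "u \<in> {0<..<1} \<and> ?g u \<notin> path_image c" if "u \<in> {t1..t2}" for u
    proof -
      have "u \<in> ball t d" using that d(1) by (auto simp: t1_def t2_def dist_real_def)
      then show ?thesis using d(2) by auto
    qed
    have t12: "0 < t1" "t1 < t2" "t2 < 1"
      using tm[of t1] tm[of t2] d(1) by (auto simp: t1_def t2_def)
    let ?K = "arcs (A - {e})"
    let ?h1 = "subpath 0 t1 ?g" and ?h2 = "subpath t2 1 ?g"
    have h: "arc ?h1" "arc ?h2" using t12 by (auto intro!: arc_subpath_arc g)
    have hi: "path_image ?h1 = ?g ` {0..t1}" "path_image ?h2 = ?g ` {t2..1}"
      using t12 by (auto simp: path_image_subpath)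
    have AK: "arcs A = ?K \<union> path_image ?g" using e by (auto simp: arcs_def)
    have Kg: "?K \<inter> path_image ?g \<subseteq> {?g 0, ?g 1}"
      using arcs_Int_edge[of "A - {e}" e] A(1) eE by (auto simp: pathstart_def pathfinish_def)
    have hsub: "path_image ?h1 \<subseteq> path_image ?g" "path_image ?h2 \<subseteq> path_image ?g"
      using t12 by (simp_all add: path_image_subpath_subset)
    have cK: "closed ?K" using A by (intro closed_arcs) auto
    have n1: "?g 1 \<notin> path_image ?h1" "?g 0 \<notin> path_image ?h2" "path_image ?h1 \<inter> path_image ?h2 = {}"
      unfolding hi using inj t12 by fastforce+
    have "connected_component (- (?K \<union> path_image ?h1)) x y"
      by (rule connected_component_Un_arc[OF cK h(1) connected_subset_singleton min[OF e]])
        (use Kg n1 hsub A AK in auto)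
    then have "connected_component (- ((?K \<union> path_image ?h1) \<union> path_image ?h2)) x y"
      by (rule connected_component_Un_arc[OF _ h(2) connected_subset_singleton, rotated 2])
        (use Kg n1 hsub A AK cK h(1) in \<open>auto intro!: closed_Un closed_arc_image\<close>)
    moreover have "path_image c \<subseteq> (?K \<union> path_image ?h1) \<union> path_image ?h2"
    proof
      fix q assume q: "q \<in> path_image c"
      show "q \<in> (?K \<union> path_image ?h1) \<union> path_image ?h2"
      proof (cases "q \<in> ?K")
        case False
        then have "q \<in> path_image ?g" using c(3) AK q by blast
        then obtain u where u: "u \<in> {0..1}" "q = ?g u" by (auto simp: path_image_def)
        then have "u \<notin> {t1..t2}" using tm q by blast
        then show ?thesis using u unfolding hi by auto
      qed simp
    qed
    ultimately show False
      using c(4) connected_component_of_subset[of "- ((?K \<union> path_image ?h1) \<union> path_image ?h2)" x y "- path_image c"] by blast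
  qed
  then have "path_image c = arcs A" using c(3) unfolding arcs_def by blast
  then show ?thesis using c by blast
qed

text \<open>Extends one edge \<open>{a, b}\<close> at both ends to \<open>c\<close> and
  \<open>d\<close>, which yields three distinct edges. If there are no others, the second edge at
  \<open>c\<close> can only be \<open>{b, d}\<close>, so the three edges form a triangle.\<close>

lemma min_degree_two_triple:
  assumes A: "A \<subseteq> E" "A \<noteq> {}" and deg: "\<And>e v. e \<in> A \<Longrightarrow> v \<in> e \<Longrightarrow> \<exists>e'\<in>A - {e}. v \<in> e'"
  obtains a b c d where "{a, b} \<in> A" "{a, c} \<in> A" "{b, d} \<in> A" "a \<noteq> b" "a \<noteq> c" "b \<noteq> c" "a \<noteq> d" "b \<noteq> d"
    "A = {{a, b}, {a, c}, {b, d}} \<longrightarrow> c = d"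
proof -
  obtain e where e: "e \<in> A" using A by blast
  then obtain a b where ab: "e = {a, b}" "a \<noteq> b" using card_edge A(1) by (metis card_2_iff subsetD)
  obtain e1 where e1: "e1 \<in> A" "e1 \<noteq> e" "a \<in> e1" using deg[OF e, of a] ab by blast
  obtain e2 where e2: "e2 \<in> A" "e2 \<noteq> e" "b \<in> e2" using deg[OF e, of b] ab by blast
  obtain c where c: "e1 = {a, c}" "c \<noteq> a" using other_endpoint e1 A by blast
  obtain d where d: "e2 = {b, d}" "d \<noteq> b" using other_endpoint e2 A by blast
  have ne: "c \<noteq> b" "d \<noteq> a" using c d e1 e2 ab by auto
  have "c = d" if "A = {{a, b}, {a, c}, {b, d}}"
    using deg[OF e1(1), of c] c ne ab that by auto
  then show ?thesis using that[of a b c d] e ab e1 e2 c d ne by auto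
qed

end

section \<open>Connectedness of triangulations\<close>

text \<open>A radius of a circle is determined by any of its points other than the centre; hence
  distinct radii meet only in the centre.\<close>

lemma segment_point_unique:
  fixes c s q :: complex
  assumes "q \<in> closed_segment s c" "q \<noteq> c" "dist c s = r"
  shows "s = c + (r / dist c q) *\<^sub>R (q - c)"
proof -
  obtain t where t: "0 \<le> t" "t \<le> 1" "q = (1 - t) *\<^sub>R s + t *\<^sub>R c"
    using assms(1) by (auto simp: in_segment)
  have q: "q - c = (1 - t) *\<^sub>R (s - c)" using t(3) by (simp add: algebra_simps)
  have "dist c q = (1 - t) * r"
    using q t(2) assms(3) by (simp add: dist_norm norm_minus_commute[of c])
  moreover have "1 - t \<noteq> 0" "r \<noteq> 0" using q assms(2,3) by auto
  ultimately show ?thesis using q by simp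
qed

section \<open>Redrawing a plane graph around one vertex\<close>

context plane_graph
begin

lemma plane_embedding_compose:
  assumes "continuous_on (drawing V E p \<gamma>) f" "inj_on f (drawing V E p \<gamma>)"
  shows "plane_embedding V E (f \<circ> p) (\<lambda>e. f \<circ> \<gamma> e)"
proof -
  let ?D = "drawing V E p \<gamma>"
  have pV: "p ` A \<subseteq> ?D" if "A \<subseteq> V" for A using that unfolding drawing_eq by blast
  have gE: "path_image (\<gamma> e) \<subseteq> ?D" if "e \<in> E" for e using that unfolding drawing_eq arcs_def by blast
  have Int: "f ` A \<inter> f ` B = f ` (A \<inter> B)" if "A \<subseteq> ?D" "B \<subseteq> ?D" for A B
    using inj_on_image_Int[OF assms(2) that] by simp
  show ?thesis
    unfolding plane_embedding_def
  proof (intro conjI ballI impI)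
    show "inj_on (f \<circ> p) V"
      using inj_p inj_on_subset[OF assms(2) pV[OF order_refl]] by (rule comp_inj_on)
  next
    fix e assume e: "e \<in> E"
    show "arc (f \<circ> \<gamma> e)"
      using arc_edge[OF e] path_continuous_image[OF _ continuous_on_subset[OF assms(1) gE[OF e]]]
        comp_inj_on[OF _ inj_on_subset[OF assms(2) gE[OF e, unfolded path_image_def]]]
      by (simp add: arc_def)
    have "f ` {pathstart (\<gamma> e), pathfinish (\<gamma> e)} = f ` (p ` e)" by (simp only: edge_ends[OF e])
    then show "{pathstart (f \<circ> \<gamma> e), pathfinish (f \<circ> \<gamma> e)} = (f \<circ> p) ` e"
      by (simp add: pathstart_compose pathfinish_compose image_comp)
    show "path_image (f \<circ> \<gamma> e) \<inter> (f \<circ> p) ` V = (f \<circ> p) ` e"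
      using Int[OF gE[OF e] pV[OF order_refl]] edge_Int_vertices[OF e]
      by (simp add: path_image_compose image_image)
  next
    fix e e' assume e: "e \<in> E" "e' \<in> E" "e \<noteq> e'"
    show "path_image (f \<circ> \<gamma> e) \<inter> path_image (f \<circ> \<gamma> e') \<subseteq> (f \<circ> p) ` (e \<inter> e')"
      using Int[OF gE[OF e(1)] gE[OF e(2)]] image_mono[OF edges_Int[OF e], of f]
      by (simp add: path_image_compose image_comp)
  qed
qed

lemma drawing_compose: "drawing V E (f \<circ> p) (\<lambda>e. f \<circ> \<gamma> e) = f ` drawing V E p \<gamma>"
  by (simp add: drawing_def path_image_compose image_Un image_UN image_comp)

text \<open>The edge is followed from its other end up to the first point in the closed disc around
  \<open>p u\<close>. The part behind that point, which may enter and leave the disc repeatedly, is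
  to be replaced by a radius.\<close>

lemma edge_tail:
  assumes e: "e \<in> E" "u \<in> e" and r: "0 < r" "cball (p u) r \<inter> p ` V = {p u}"
  shows "\<exists>t. arc t \<and> {pathstart t, p u} = p ` e \<and> dist (p u) (pathfinish t) = r \<and>
    path_image t \<inter> cball (p u) r = {pathfinish t} \<and> path_image t \<subseteq> path_image (\<gamma> e)"
proof -
  obtain g where g: "arc g" "pathfinish g = p u" "path_image g = path_image (\<gamma> e)" "{pathstart g, p u} = p ` e"
  proof (cases "pathfinish (\<gamma> e) = p u")
    case True
    then show ?thesis using that[of "\<gamma> e"] arc_edge[OF e(1)] edge_ends[OF e(1)] by simp
  next
    case False
    have "p u \<in> {pathstart (\<gamma> e), pathfinish (\<gamma> e)}" unfolding edge_ends[OF e(1)] using e(2) by blast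
    then have "pathstart (\<gamma> e) = p u" using False by simp
    then show ?thesis using that[of "reversepath (\<gamma> e)"] arc_edge[OF e(1)] edge_ends[OF e(1)]
      by (simp add: arc_reversepath insert_commute)
  qed
  have pg: "path g" using g(1) arc_imp_path by blast
  have st: "pathstart g \<notin> cball (p u) r"
  proof
    assume a: "pathstart g \<in> cball (p u) r"
    have "pathstart g \<in> p ` V" using g(4) edge_subset[OF e(1)] by blast
    then have "pathstart g = p u" using a r(2) by blast
    then show False using arc_distinct_ends[OF g(1)] g(2) by simp
  qed
  let ?S = "- cball (p u) r"
  have "pathfinish g \<notin> ?S" using g(2) r(1) by simp
  then have "\<exists>x. 0 \<le> x \<and> x \<le> 1 \<and> (\<forall>y. 0 \<le> y \<and> y < x \<longrightarrow> g y \<in> interior ?S) \<and>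
      g x \<notin> interior ?S \<and> (x = 0 \<or> g x \<in> closure ?S)"
    by (rule subpath_to_frontier_explicit[OF pg]) blast
  then obtain x where x: "0 \<le> x" "x \<le> 1" "\<forall>y. 0 \<le> y \<and> y < x \<longrightarrow> g y \<in> interior ?S"
      "g x \<notin> interior ?S" "x = 0 \<or> g x \<in> closure ?S"
    by blast
  have int: "interior ?S = ?S" by (simp add: interior_open open_Compl)
  have x0: "x \<noteq> 0" using x(4) st unfolding int by (auto simp: pathstart_def)
  have "closure ?S \<subseteq> - ball (p u) r" by (rule closure_minimal) (auto simp: closed_Compl)
  then have d: "dist (p u) (g x) = r" using x(4,5) x0 unfolding int by auto
  have i: "path_image (subpath 0 x g) = g ` {0..x}" using x(1) by (simp add: path_image_subpath)
  have "g ` {0..x} \<inter> cball (p u) r = {g x}"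
  proof
    show "g ` {0..x} \<inter> cball (p u) r \<subseteq> {g x}"
    proof
      fix q assume "q \<in> g ` {0..x} \<inter> cball (p u) r"
      then obtain y where y: "y \<in> {0..x}" "q = g y" "g y \<in> cball (p u) r" by blast
      then have "\<not> y < x" using x(3) unfolding int by auto
      then show "q \<in> {g x}" using y by simp
    qed
    show "{g x} \<subseteq> g ` {0..x} \<inter> cball (p u) r" using d x(1) by simp
  qed
  moreover have "arc (subpath 0 x g)" using arc_subpath_arc[OF g(1), of 0 x] x(1,2) x0 by simp
  moreover have "path_image (subpath 0 x g) \<subseteq> path_image (\<gamma> e)"
    using path_image_subpath_subset[of 0 x g] x(1,2) g(3) by simp
  ultimately show ?thesis
    using d g(4)[unfolded pathstart_def] i by (intro exI[of _ "subpath 0 x g"]) simp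
qed

text \<open>Near one vertex the edges can be replaced by straight segments; every other direction is then free.\<close>

lemma free_segment:
  assumes u: "u \<in> V"
  shows "\<exists>\<gamma>' w. plane_embedding V E p \<gamma>' \<and> w \<noteq> p u \<and> closed_segment (p u) w \<inter> drawing V E p \<gamma>' = {p u}"
proof -
  \<comment> \<open>Everything in the drawing that does not touch \<open>u\<close>. A disc around
    \<open>p u\<close> that misses it can be entered only by the edges at \<open>u\<close>.\<close>
  let ?K = "p ` (V - {u}) \<union> arcs {e\<in>E. u \<notin> e}"
  have "closed ?K" using finite_V closed_arcs[of "{e\<in>E. u \<notin> e}"] by (simp add: closed_Un finite_imp_closed)
  moreover have "p u \<in> - ?K"
  proof -
    have "p u \<notin> p ` (V - {u})" using inj_p u by (auto simp: inj_on_eq_iff)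
    moreover have "p u \<notin> arcs {e\<in>E. u \<notin> e}" using vertex_in_edge_iff[OF _ u] unfolding arcs_def by blast
    ultimately show ?thesis by blast
  qed
  ultimately obtain r where r: "r > 0" "cball (p u) r \<subseteq> - ?K"
    using open_contains_cball[of "- ?K"] by blast
  have rV: "cball (p u) r \<inter> p ` V = {p u}" using r u by auto
  have rE: "cball (p u) r \<inter> path_image (\<gamma> e) = {}" if "e \<in> E" "u \<notin> e" for e
    using r(2) that unfolding arcs_def by blast
  let ?Eu = "{e\<in>E. u \<in> e}"
  have "\<forall>e\<in>?Eu. \<exists>t. arc t \<and> {pathstart t, p u} = p ` e \<and> dist (p u) (pathfinish t) = r \<and>
    path_image t \<inter> cball (p u) r = {pathfinish t} \<and> path_image t \<subseteq> path_image (\<gamma> e)"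
    using edge_tail[OF _ _ r(1) rV] by blast
  then obtain t where t: "\<forall>e\<in>?Eu. arc (t e) \<and> {pathstart (t e), p u} = p ` e \<and> dist (p u) (pathfinish (t e)) = r \<and>
    path_image (t e) \<inter> cball (p u) r = {pathfinish (t e)} \<and> path_image (t e) \<subseteq> path_image (\<gamma> e)"
    by (rule bchoice[THEN exE])
  define s where "s e = pathfinish (t e)" for e
  have ts: "arc (t e) \<and> {pathstart (t e), p u} = p ` e \<and> pathfinish (t e) = s e \<and>
    dist (p u) (s e) = r \<and> path_image (t e) \<inter> cball (p u) r = {s e} \<and> path_image (t e) \<subseteq> path_image (\<gamma> e)"
    if "e \<in> ?Eu" for e
    using t that unfolding s_def by blast
  define \<gamma>' where "\<gamma>' e = (if u \<in> e then t e +++ linepath (s e) (p u) else \<gamma> e)" for e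
  have seg: "closed_segment (s e) (p u) \<subseteq> cball (p u) r" if "e \<in> ?Eu" for e
    using ts[OF that] r(1) by (intro closed_segment_subset) auto
  have img: "path_image (\<gamma>' e) = path_image (t e) \<union> closed_segment (s e) (p u)" if "e \<in> ?Eu" for e
    using ts[OF that] that by (simp add: \<gamma>'_def path_image_join)
  have sne: "s e \<noteq> p u" if "e \<in> ?Eu" for e using ts[OF that] r(1) by auto
  have old: "\<gamma>' e = \<gamma> e" if "u \<notin> e" for e using that by (simp add: \<gamma>'_def)
  have seg_s: "q = s e" if "e \<in> ?Eu" "q \<in> closed_segment (s e) (p u)" "dist (p u) q = r" for e q
  proof -
    have "q \<noteq> p u" using that(3) r(1) by auto
    then have "s e = p u + (r / dist (p u) q) *\<^sub>R (q - p u)"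
      using segment_point_unique[OF that(2)] ts[OF that(1)] by blast
    then show ?thesis using that(3) r(1) by simp
  qed
  have tq: "q = s e" "dist (p u) (s e) = r" if "e \<in> ?Eu" "q \<in> path_image (t e)" "q \<in> cball (p u) r" for e q
    using ts[OF that(1)] that(2,3) by blast+
  have emb': "plane_embedding V E p \<gamma>'"
    unfolding plane_embedding_def
  proof (intro conjI ballI impI)
    show "inj_on p V" by (rule inj_p)
  next
    fix e assume e: "e \<in> E"
    have "arc (\<gamma>' e) \<and> {pathstart (\<gamma>' e), pathfinish (\<gamma>' e)} = p ` e \<and> path_image (\<gamma>' e) \<inter> p ` V = p ` e"
    proof (cases "u \<in> e")
      case False
      then show ?thesis using arc_edge[OF e] edge_ends[OF e] edge_Int_vertices[OF e] old by simp
    next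
      case True
      then have eu: "e \<in> ?Eu" using e by simp
      note T = ts[OF eu]
      have "path_image (t e) \<inter> closed_segment (s e) (p u) \<subseteq> {s e}" using T seg[OF eu] by blast
      then have "arc (t e +++ linepath (s e) (p u))"
        using T sne[OF eu] by (intro arc_join) auto
      moreover have ends: "{pathstart (\<gamma>' e), pathfinish (\<gamma>' e)} = p ` e"
        using T True by (simp add: \<gamma>'_def)
      moreover have "path_image (\<gamma>' e) \<inter> p ` V \<subseteq> p ` e"
      proof -
        have "path_image (t e) \<inter> p ` V \<subseteq> p ` e" using T edge_Int_vertices[OF e] by blast
        moreover have "closed_segment (s e) (p u) \<inter> p ` V \<subseteq> p ` e" using seg[OF eu] rV True by blast
        ultimately show ?thesis unfolding img[OF eu] by blast
      qed
      moreover have "p ` e \<subseteq> path_image (\<gamma>' e) \<inter> p ` V"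
      proof (rule Int_greatest)
        show "p ` e \<subseteq> path_image (\<gamma>' e)" unfolding ends[symmetric]
          using pathstart_in_path_image[of "\<gamma>' e"] pathfinish_in_path_image[of "\<gamma>' e"] by blast
        show "p ` e \<subseteq> p ` V" using edge_subset[OF e] by (rule image_mono)
      qed
      ultimately show ?thesis using True by (simp add: \<gamma>'_def subset_antisym)
    qed
    then show "arc (\<gamma>' e)" "{pathstart (\<gamma>' e), pathfinish (\<gamma>' e)} = p ` e" "path_image (\<gamma>' e) \<inter> p ` V = p ` e"
      by blast+
  next
    have mixed: "path_image (\<gamma>' e) \<inter> path_image (\<gamma>' e') \<subseteq> p ` (e \<inter> e')"
      if "e \<in> ?Eu" "e' \<in> E" "u \<notin> e'" for e e'
    proof -
      have "e \<noteq> e'" "e \<in> E" using that by auto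
      then have "path_image (t e) \<inter> path_image (\<gamma> e') \<subseteq> p ` (e \<inter> e')" using ts[OF that(1)] that(2) edges_Int[of e e'] by blast
      then show ?thesis unfolding img[OF that(1)] old[OF that(3)] using seg[OF that(1)] rE[OF that(2,3)] by blast
    qed
    fix e e' assume e: "e \<in> E" "e' \<in> E" "e \<noteq> e'"
    show "path_image (\<gamma>' e) \<inter> path_image (\<gamma>' e') \<subseteq> p ` (e \<inter> e')"
    proof (cases "u \<in> e"; cases "u \<in> e'")
      assume "u \<notin> e" "u \<notin> e'" then show ?thesis using edges_Int[OF e] old by simp
    next
      assume "u \<in> e" "u \<notin> e'" then show ?thesis using mixed[of e e'] e by simp
    next
      assume "u \<notin> e" "u \<in> e'" then show ?thesis using mixed[of e' e] e by (simp add: Int_commute)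
    next
      assume ue: "u \<in> e" "u \<in> e'"
      have eu: "e \<in> ?Eu" "e' \<in> ?Eu" using e ue by auto
      have tt: "path_image (t e) \<inter> path_image (t e') \<subseteq> p ` (e \<inter> e')"
        using ts[OF eu(1)] ts[OF eu(2)] edges_Int[OF e] by blast
      have sin: "s f \<in> path_image (t f)" if "f \<in> ?Eu" for f using ts[OF that] by blast
      \<comment> \<open>A common end of two tails would lie on both original edges and thus be a
        vertex, but the only vertex in the disc is its centre.\<close>
      have ss: "s e \<noteq> s e'"
      proof
        assume "s e = s e'"
        then have "s e \<in> p ` V" using sin[OF eu(1)] sin[OF eu(2)] tt edge_subset[OF e(1)] by auto
        moreover have "s e \<in> cball (p u) r" using ts[OF eu(1)] by simp
        ultimately show False using rV sne[OF eu(1)] by blast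
      qed
      have ts': "path_image (t f) \<inter> closed_segment (s f') (p u) = {}"
        if "f \<in> ?Eu" "f' \<in> ?Eu" "s f \<noteq> s f'" for f f'
      proof -
        have "q = s f \<and> q = s f'" if q: "q \<in> path_image (t f)" "q \<in> closed_segment (s f') (p u)" for q
        proof -
          have "q \<in> cball (p u) r" using seg[OF \<open>f' \<in> ?Eu\<close>] q(2) by blast
          then have "q = s f" "dist (p u) q = r" using tq[OF \<open>f \<in> ?Eu\<close> q(1)] by auto
          then show ?thesis using seg_s[OF \<open>f' \<in> ?Eu\<close> q(2)] by simp
        qed
        then show ?thesis using that(3) by blast
      qed
      have "q = p u" if "q \<in> closed_segment (s e) (p u)" "q \<in> closed_segment (s e') (p u)" for q
        using segment_point_unique[OF that(1)] segment_point_unique[OF that(2)] ts[OF eu(1)] ts[OF eu(2)] ss by metis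
      then have "closed_segment (s e) (p u) \<inter> closed_segment (s e') (p u) \<subseteq> {p u}" by blast
      then show ?thesis
        unfolding img[OF eu(1)] img[OF eu(2)]
        using tt ts'[OF eu ss] ts'[OF eu(2,1) ss[symmetric]] ue by blast
    qed
  qed
  have "finite (s ` ?Eu)" using finite_E by simp
  moreover have "infinite (sphere (p u) r)"
  proof -
    have "p u + of_real r \<in> sphere (p u) r" "p u - of_real r \<in> sphere (p u) r" "p u + of_real r \<noteq> p u - of_real r"
      using r(1) by (auto simp: dist_norm)
    moreover have "connected (sphere (p u) r)" by (rule connected_sphere) simp
    ultimately show ?thesis using connected_finite_iff_sing[of "sphere (p u) r"] by (metis empty_iff singletonD)
  qed
  ultimately obtain w where w: "w \<in> sphere (p u) r" "w \<notin> s ` ?Eu"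
    by (meson finite_subset subsetI)
  have wd: "dist (p u) w = r" using w(1) by simp
  have "closed_segment (p u) w \<inter> drawing V E p \<gamma>' \<subseteq> {p u}"
  proof
    fix q assume q: "q \<in> closed_segment (p u) w \<inter> drawing V E p \<gamma>'"
    have qc: "q \<in> cball (p u) r"
      using q closed_segment_subset[of "p u" "cball (p u) r" w] wd r(1) by auto
    show "q \<in> {p u}"
    proof (rule ccontr)
      assume "q \<notin> {p u}"
      then have n: "q \<noteq> p u" by simp
      have wq: "w = p u + (r / dist (p u) q) *\<^sub>R (q - p u)"
        using segment_point_unique[of q w "p u" r] q n wd by (simp add: closed_segment_commute)
      have "q \<notin> p ` V" using rV qc n by blast
      then obtain e where e: "e \<in> E" "q \<in> path_image (\<gamma>' e)" using q unfolding drawing_def by blast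
      show False
      proof (cases "u \<in> e")
        case False then show False using e(2) old[OF False] rE[OF e(1) False] qc by (metis IntI empty_iff)
      next
        case True
        then have eu: "e \<in> ?Eu" using e by simp
        have "w = s e"
        proof (cases "q \<in> path_image (t e)")
          case True
          then have "q = s e" "dist (p u) q = r" using tq[OF eu True qc] by auto
          then show ?thesis using wq r(1) by simp
        next
          case False
          then have "q \<in> closed_segment (s e) (p u)" using e(2) img[OF eu] by blast
          then show ?thesis using segment_point_unique[of q "s e" "p u" r] ts[OF eu] n wq by simp
        qed
        then show False using w(2) eu by blast
      qed
    qed
  qed
  moreover have "p u \<in> drawing V E p \<gamma>'" using u by (simp add: drawing_def)
  ultimately have "closed_segment (p u) w \<inter> drawing V E p \<gamma>' = {p u}" by auto
  moreover have "w \<noteq> p u" using wd r(1) by auto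
  ultimately show ?thesis using emb' by blast
qed

text \<open>The Moebius map \<open>f\<close> sends the far end \<open>w\<close> of the free segment
  to infinity and, by the choice of \<open>k\<close> and the subtracted 1, \<open>p u\<close> to 0.
  The segment becomes the nonnegative real axis: \<open>f z = x\<close> means
  \<open>z = w + k / (1 + x)\<close>, a point between \<open>w\<close> and \<open>p u\<close>. As
  \<open>w\<close> is off the drawing, \<open>f\<close> is continuous and injective on it.\<close>

lemma free_ray:
  assumes u: "u \<in> V"
  shows "\<exists>p' \<gamma>'. plane_embedding V E p' \<gamma>' \<and> p' u = 0 \<and> (\<forall>x\<ge>0. of_real x \<in> drawing V E p' \<gamma>' \<longrightarrow> x = 0)"
proof -
  obtain \<gamma>' w where g: "plane_embedding V E p \<gamma>'" "w \<noteq> p u" "closed_segment (p u) w \<inter> drawing V E p \<gamma>' = {p u}"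
    using free_segment[OF u] by blast
  interpret G: plane_graph V E p \<gamma>' using simple g(1) by unfold_locales
  define k where "k = p u - w"
  define f where "f z = k / (z - w) - 1" for z
  let ?D = "drawing V E p \<gamma>'"
  have k: "k \<noteq> 0" using g(2) by (simp add: k_def)
  have wD: "w \<notin> ?D" using g(2,3) ends_in_segment(2)[of w "p u"] by blast
  have "continuous_on ?D f"
    unfolding f_def using wD by (intro continuous_intros) auto
  moreover have "inj_on f ?D"
  proof (rule inj_onI)
    fix y z assume yz: "y \<in> ?D" "z \<in> ?D" "f y = f z"
    then have "y - w \<noteq> 0" "z - w \<noteq> 0" using wD by auto
    then show "y = z" using yz(3) k by (simp add: f_def field_simps)
  qed
  ultimately have "plane_embedding V E (f \<circ> p) (\<lambda>e. f \<circ> \<gamma>' e)" by (rule G.plane_embedding_compose)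
  moreover have "(f \<circ> p) u = 0" using k by (simp add: f_def k_def)
  moreover have "x = 0" if x: "x \<ge> 0" "of_real x \<in> drawing V E (f \<circ> p) (\<lambda>e. f \<circ> \<gamma>' e)" for x
  proof -
    obtain z where z: "z \<in> ?D" "of_real x = f z" using x(2) unfolding G.drawing_compose by blast
    have zw: "z - w \<noteq> 0" using z(1) wD by auto
    have x1: "of_real (1 + x) \<noteq> (0::complex)" using x(1) by (simp only: of_real_eq_0_iff)
    have "of_real (1 + x) * (z - w) = k" using z(2) zw by (simp add: f_def field_simps)
    then have "z = w + k / of_real (1 + x)" using x1 by (simp add: field_simps)
    then have "z = w + (1 / (1 + x)) *\<^sub>R (p u - w)" by (simp add: k_def scaleR_conv_of_real)
    then have "z = (1 - 1 / (1 + x)) *\<^sub>R w + (1 / (1 + x)) *\<^sub>R p u" by (simp add: algebra_simps)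
    moreover have "0 \<le> 1 / (1 + x)" "1 / (1 + x) \<le> 1" using x(1) by auto
    ultimately have "z \<in> closed_segment w (p u)" unfolding in_segment by blast
    then have "z = p u" using g(3) z(1) by (auto simp: closed_segment_commute)
    then have "f z = 0" using k by (simp add: f_def k_def)
    then show ?thesis using z(2) by simp
  qed
  ultimately show ?thesis by blast
qed

lemma plane_graph_subgraph:
  assumes "W \<subseteq> V"
  shows "plane_graph W {e\<in>E. e \<subseteq> W} p \<gamma>"
proof
  show "simple_graph W {e \<in> E. e \<subseteq> W}"
    using simple assms finite_subset by (auto simp: simple_graph_def)
  have "path_image (\<gamma> e) \<inter> p ` W = p ` e" if "e \<in> E" "e \<subseteq> W" for e
    using edge_Int_vertices[OF that(1)] that(2) assms by blast
  then show "plane_embedding W {e \<in> E. e \<subseteq> W} p \<gamma>"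
    using emb inj_on_subset[OF inj_p assms] unfolding plane_embedding_def by simp
qed

lemma bounded_drawing: "\<exists>R>0. drawing V E p \<gamma> \<subseteq> ball 0 R"
  using compact_imp_bounded[OF compact_drawing] bounded_subset_ballD by blast

end

text \<open>Both parts are redrawn with the vertex to be joined at 0 and the nonnegative real axis
  free. The map \<open>h\<close> turns the second drawing around and moves its vertex to
  \<open>m\<close>; the two free rays then face each other, and the segment from 0 to
  \<open>m\<close> is the new edge.\<close>

lemma planar_join_components:
  assumes G: "plane_graph V E p \<gamma>" and V: "V = V1 \<union> V2" "V1 \<inter> V2 = {}"
    and E: "\<And>e. e \<in> E \<Longrightarrow> e \<subseteq> V1 \<or> e \<subseteq> V2" and u: "u1 \<in> V1" "u2 \<in> V2"
  shows "planar V (insert {u1, u2} E)"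
proof -
  interpret plane_graph V E p \<gamma> by (rule G)
  let ?E1 = "{e\<in>E. e \<subseteq> V1}" and ?E2 = "{e\<in>E. e \<subseteq> V2}"
  obtain p1 g1 where e1: "plane_embedding V1 ?E1 p1 g1" "p1 u1 = 0"
    "\<forall>x\<ge>0. of_real x \<in> drawing V1 ?E1 p1 g1 \<longrightarrow> x = 0"
    using plane_graph.free_ray[OF plane_graph_subgraph u(1)] V by blast
  obtain p2 g2 where e2: "plane_embedding V2 ?E2 p2 g2" "p2 u2 = 0"
    "\<forall>x\<ge>0. of_real x \<in> drawing V2 ?E2 p2 g2 \<longrightarrow> x = 0"
    using plane_graph.free_ray[OF plane_graph_subgraph u(2)] V by blast
  have s: "simple_graph V1 ?E1" "simple_graph V2 ?E2"
    using plane_graph_subgraph[of V1] plane_graph_subgraph[of V2] V plane_graph.simple by blast+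
  interpret G1: plane_graph V1 ?E1 p1 g1 using s(1) e1(1) by unfold_locales
  interpret G2: plane_graph V2 ?E2 p2 g2 using s(2) e2(1) by unfold_locales
  let ?D1 = "drawing V1 ?E1 p1 g1" and ?D2 = "drawing V2 ?E2 p2 g2"
  obtain R1 R2 where R: "R1 > 0" "?D1 \<subseteq> ball 0 R1" "R2 > 0" "?D2 \<subseteq> ball 0 R2"
    using G1.bounded_drawing G2.bounded_drawing by blast
  \<comment> \<open>A common point \<open>z = m - y\<close> of the two drawings would give
    \<open>norm m < R1 + R2\<close>.\<close>
  define m :: complex where "m = of_real (R1 + R2)"
  define h where "h z = m - z" for z
  have "plane_embedding V2 ?E2 (h \<circ> p2) (\<lambda>e. h \<circ> g2 e)"
    unfolding h_def by (rule G2.plane_embedding_compose) (auto intro!: continuous_intros simp: inj_on_def)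
  then interpret H: plane_graph V2 ?E2 "h \<circ> p2" "\<lambda>e. h \<circ> g2 e" using s(2) by unfold_locales
  let ?D3 = "h ` ?D2"
  have D3: "drawing V2 ?E2 (h \<circ> p2) (\<lambda>e. h \<circ> g2 e) = ?D3" by (rule G2.drawing_compose)
  have dis: "?D1 \<inter> ?D3 = {}"
  proof -
    have False if "z \<in> ?D1" "y \<in> ?D2" "z = h y" for z y
    proof -
      have "norm z < R1" "norm y < R2" using that R by (auto simp: dist_norm)
      moreover have "norm m = R1 + R2" using R by (simp add: m_def del: of_real_add)
      moreover have "m = z + y" using that(3) by (simp add: h_def)
      ultimately show False using norm_triangle_ineq[of z y] by simp
    qed
    then show ?thesis by blast
  qed
  let ?e = "{u1, u2}"
  have m0: "m \<noteq> 0" using R by (simp add: m_def del: of_real_add)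
  have seg: "\<exists>x\<ge>0. x \<le> R1 + R2 \<and> z = of_real x" if z: "z \<in> closed_segment 0 m" for z
  proof -
    obtain t where t: "0 \<le> t" "t \<le> 1" "z = t *\<^sub>R m" using z by (auto simp: in_segment)
    have "t * (R1 + R2) \<le> 1 * (R1 + R2)" using t R by (intro mult_right_mono) auto
    then show ?thesis using t R by (intro exI[of _ "t * (R1 + R2)"]) (auto simp: m_def scaleR_conv_of_real)
  qed
  have line1: "closed_segment 0 m \<inter> ?D1 \<subseteq> {0}" using seg e1(3) by fastforce
  have line3: "closed_segment 0 m \<inter> ?D3 \<subseteq> {m}"
  proof
    fix z assume z: "z \<in> closed_segment 0 m \<inter> ?D3"
    then obtain x where x: "x \<ge> 0" "x \<le> R1 + R2" "z = of_real x" using seg by blast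
    obtain y where y: "y \<in> ?D2" "z = m - y" using z by (auto simp: h_def)
    have "y = m - z" using y(2) by simp
    then have "y = of_real (R1 + R2 - x)" using x(3) by (simp add: m_def)
    then have "complex_of_real (R1 + R2 - x) \<in> ?D2" using y(1) by metis
    moreover have "0 \<le> R1 + R2 - x" using x(2) by simp
    ultimately have "R1 + R2 - x = 0" using e2(3) by blast
    then show "z \<in> {m}" using x(3) by (simp add: m_def)
  qed
  define q where "q v = (if v \<in> V1 then p1 v else h (p2 v))" for v
  define g where "g e = (if e = ?e then linepath 0 m else if e \<subseteq> V1 then g1 e else h \<circ> g2 e)" for e
  have eE: "?e \<notin> E" using E u V(2) by blast
  have une: "u1 \<noteq> u2" using u V(2) by blast
  have ne: "e \<noteq> {}" if "e \<in> E" for e using card_edge[OF that] by auto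
  have q1: "q ` A = p1 ` A" if "A \<subseteq> V1" for A using that by (intro image_cong) (auto simp: q_def)
  have q2: "q ` A = (h \<circ> p2) ` A" if "A \<subseteq> V2" for A using that V(2) by (intro image_cong) (auto simp: q_def)
  have ge: "g ?e = linepath 0 m" by (simp add: g_def)
  have ge1: "g e = g1 e" if "e \<in> ?E1" for e using that eE by (auto simp: g_def)
  have ge2: "g e = h \<circ> g2 e" if "e \<in> ?E2" for e
  proof -
    have "e \<noteq> ?e" using that eE by auto
    moreover have "\<not> e \<subseteq> V1" using that ne[of e] V(2) by blast
    ultimately show ?thesis by (simp add: g_def)
  qed
  have in1: "p1 ` V1 \<subseteq> ?D1" "e \<in> ?E1 \<Longrightarrow> path_image (g1 e) \<subseteq> ?D1" for e
    by (auto simp: drawing_def)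
  have in3: "(h \<circ> p2) ` V2 \<subseteq> ?D3" "e \<in> ?E2 \<Longrightarrow> path_image (h \<circ> g2 e) \<subseteq> ?D3" for e
    unfolding D3[symmetric] by (auto simp: drawing_def)
  have qV: "q ` V = p1 ` V1 \<union> (h \<circ> p2) ` V2" using q1[of V1] q2[of V2] V(1) by (simp add: image_Un)
  have qe: "q u1 = 0" "q u2 = m" using u V(2) e1(2) e2(2) by (auto simp: q_def h_def)
  have "plane_embedding V (insert ?e E) q g"
    unfolding plane_embedding_def
  proof (intro conjI ballI impI)
    show "inj_on q V"
    proof (rule inj_onI)
      fix x y assume xy: "x \<in> V" "y \<in> V" "q x = q y"
      have cross: False if "x \<in> V1" "y \<in> V2" "q x = q y" for x y
      proof -
        have "q x \<in> ?D1" using that(1) in1(1) by (auto simp: q_def)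
        moreover have "q y \<in> ?D3" using that(2) in3(1) V(2) by (auto simp: q_def)
        ultimately show False using dis that(3) by auto
      qed
      consider "x \<in> V1" "y \<in> V1" | "x \<in> V2" "y \<in> V2" | "x \<in> V1" "y \<in> V2" | "x \<in> V2" "y \<in> V1"
        using xy V(1) by blast
      then show "x = y"
      proof cases
        case 1 then show ?thesis using xy(3) G1.inj_p by (simp add: q_def inj_on_eq_iff)
      next
        case 2
        then have "x \<notin> V1" "y \<notin> V1" using V(2) by auto
        then have "(h \<circ> p2) x = (h \<circ> p2) y" using xy(3) by (simp add: q_def)
        then show ?thesis using H.inj_p 2 inj_onD by metis
      next
        case 3 then show ?thesis using cross xy(3) by blast
      next
        case 4 then show ?thesis using cross[of y x] xy(3) by simp
      qed
    qed
  next
    fix e assume "e \<in> insert ?e E"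
    then consider "e = ?e" | "e \<in> ?E1" | "e \<in> ?E2" using E by blast
    then have "arc (g e) \<and> {pathstart (g e), pathfinish (g e)} = q ` e \<and> path_image (g e) \<inter> q ` V = q ` e"
    proof cases
      case 1
      have "closed_segment 0 m \<inter> q ` V \<subseteq> {0, m}" using line1 line3 in1(1) in3(1) unfolding qV by blast
      moreover have "{0, m} \<subseteq> q ` V" using qe u V(1) by force
      ultimately have "closed_segment 0 m \<inter> q ` V = {0, m}" by auto
      then show ?thesis using 1 ge qe m0 by simp
    next
      case 2
      have "path_image (g1 e) \<inter> (h \<circ> p2) ` V2 = {}" using in1(2)[OF 2] in3(1) dis by blast
      then have "path_image (g1 e) \<inter> q ` V = p1 ` e" unfolding qV using G1.edge_Int_vertices[OF 2] by blast
      then show ?thesis using G1.arc_edge[OF 2] G1.edge_ends[OF 2] q1[of e] 2 ge1[OF 2] by simp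
    next
      case 3
      have "path_image (h \<circ> g2 e) \<inter> p1 ` V1 = {}" using in3(2)[OF 3] in1(1) dis by blast
      then have "path_image (h \<circ> g2 e) \<inter> q ` V = (h \<circ> p2) ` e" unfolding qV using H.edge_Int_vertices[OF 3] by blast
      then show ?thesis using H.arc_edge[OF 3] H.edge_ends[OF 3] q2[of e] 3 ge2[OF 3] by simp
    qed
    then show "arc (g e)" "{pathstart (g e), pathfinish (g e)} = q ` e" "path_image (g e) \<inter> q ` V = q ` e"
      by blast+
  next
    have new: "path_image (g ?e) \<inter> path_image (g e) \<subseteq> q ` (?e \<inter> e)" if "e \<in> E" for e
    proof (cases "e \<subseteq> V1")
      case True
      then have e: "e \<in> ?E1" using that by simp
      have "path_image (g ?e) \<inter> path_image (g e) \<subseteq> {p1 u1} \<inter> path_image (g1 e)"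
        using line1 in1(2)[OF e] ge ge1[OF e] e1(2) by auto
      moreover have "u1 \<in> e" if "p1 u1 \<in> path_image (g1 e)" using G1.vertex_in_edge_iff[OF e u(1)] that by simp
      ultimately have "x = q u1 \<and> u1 \<in> ?e \<inter> e" if "x \<in> path_image (g ?e) \<inter> path_image (g e)" for x
        using that e1(2) qe(1) by auto
      then show ?thesis by blast
    next
      case False
      then have e: "e \<in> ?E2" using that E by blast
      have pm: "(h \<circ> p2) u2 = m" using e2(2) by (simp add: h_def)
      have "path_image (g ?e) \<inter> path_image (g e) \<subseteq> {m} \<inter> path_image (h \<circ> g2 e)"
        using line3 in3(2)[OF e] ge ge2[OF e] by auto
      moreover have "u2 \<in> e" if "m \<in> path_image (h \<circ> g2 e)" using H.vertex_in_edge_iff[OF e u(2)] that pm by simp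
      ultimately have "x = q u2 \<and> u2 \<in> ?e \<inter> e" if "x \<in> path_image (g ?e) \<inter> path_image (g e)" for x
        using that qe(2) by auto
      then show ?thesis by blast
    qed
    have mixed: "path_image (g e) \<inter> path_image (g e') = {}" if "e \<in> ?E1" "e' \<in> ?E2" for e e'
      using in1(2)[OF that(1)] in3(2)[OF that(2)] dis ge1[OF that(1)] ge2[OF that(2)] by auto
    fix e e' assume e: "e \<in> insert ?e E" "e' \<in> insert ?e E" "e \<noteq> e'"
    consider "e = ?e" "e' \<in> E" | "e' = ?e" "e \<in> E" | "e \<in> ?E1" "e' \<in> ?E1" | "e \<in> ?E2" "e' \<in> ?E2"
      | "e \<in> ?E1" "e' \<in> ?E2" | "e \<in> ?E2" "e' \<in> ?E1"
    proof -
      have "e = ?e \<or> e \<in> ?E1 \<or> e \<in> ?E2" "e' = ?e \<or> e' \<in> ?E1 \<or> e' \<in> ?E2" using e(1,2) E by auto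
      then show thesis using that e(3) by (elim disjE) simp_all
    qed
    then show "path_image (g e) \<inter> path_image (g e') \<subseteq> q ` (e \<inter> e')"
    proof cases
      case 1 then show ?thesis using new by simp
    next
      case 2 then show ?thesis using new[of e] by (simp add: Int_commute)
    next
      case 3
      have "q ` (e \<inter> e') = p1 ` (e \<inter> e')" by (rule q1) (use 3 in auto)
      then show ?thesis using G1.edges_Int[OF 3 e(3)] ge1[OF 3(1)] ge1[OF 3(2)] by simp
    next
      case 4
      have "q ` (e \<inter> e') = (h \<circ> p2) ` (e \<inter> e')" by (rule q2) (use 4 in auto)
      then show ?thesis using H.edges_Int[OF 4 e(3)] ge2[OF 4(1)] ge2[OF 4(2)] by simp
    next
      case 5 then show ?thesis using mixed by blast
    next
      case 6 then show ?thesis using mixed[of e' e] by blast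
    qed
  qed
  moreover have "simple_graph V (insert ?e E)"
    using simple u V(1) une by (auto simp: simple_graph_def)
  ultimately show ?thesis unfolding planar_def by blast
qed

theorem triangulation_connected:
  assumes T: "planar_triangulation V E" and emb: "plane_embedding V E p \<gamma>"
  shows "path_connected (drawing V E p \<gamma>)"
proof (cases "V = {}")
  case True
  then have "E = {}" using T unfolding planar_triangulation_def planar_def simple_graph_def by fastforce
  then show ?thesis using True by (simp add: drawing_def)
next
  case False
  have "simple_graph V E" using T by (simp add: planar_triangulation_def planar_def)
  then interpret plane_graph V E p \<gamma> using emb by unfold_locales
  let ?D = "drawing V E p \<gamma>"
  obtain v0 where v0: "v0 \<in> V" using False by blast
  have edge: "path_component ?D x y" if "e \<in> E" "x \<in> path_image (\<gamma> e)" "y \<in> path_image (\<gamma> e)" for e x y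
  proof -
    have "path_connected (path_image (\<gamma> e))" using arc_edge[OF that(1)] arc_imp_path path_connected_path_image by blast
    then have "path_component (path_image (\<gamma> e)) x y" using that path_connected_component by blast
    then show ?thesis
      by (rule path_component_of_subset[rotated]) (use that(1) in \<open>auto simp: drawing_eq arcs_def\<close>)
  qed
  define V1 where "V1 = {v\<in>V. path_component ?D (p v0) (p v)}"
  have pin: "p v \<in> path_image (\<gamma> e)" if "e \<in> E" "v \<in> e" for e v
    using that edge_Int_vertices[OF that(1)] by blast
  have split: "e \<subseteq> V1 \<or> e \<subseteq> V - V1" if e: "e \<in> E" for e
  proof -
    have "w \<in> V1" if "v \<in> e" "w \<in> e" "v \<in> V1" for v w
    proof -
      have "path_component ?D (p v) (p w)" using edge[OF e] pin[OF e] that by blast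
      then show ?thesis
        using that edge_subset[OF e] path_component_trans unfolding V1_def by blast
    qed
    then show ?thesis using edge_subset[OF e] by blast
  qed
  have "p v0 \<in> ?D" using v0 unfolding drawing_eq by blast
  then have v01: "v0 \<in> V1" using v0 path_component_refl unfolding V1_def by blast
  have "V \<subseteq> V1"
  proof (rule ccontr)
    assume "\<not> V \<subseteq> V1"
    then obtain w where w: "w \<in> V - V1" by blast
    \<comment> \<open>No edge leaves \<open>V1\<close>, the set of vertices reached from
      \<open>v0\<close> inside the drawing, so an edge from \<open>v0\<close> to a vertex outside
      \<open>V1\<close> is new.\<close>
    have "planar V (insert {v0, w} E)"
      by (rule planar_join_components[of V E p \<gamma> V1 "V - V1"])
        (use v01 w split V1_def in \<open>auto intro: plane_graph_axioms\<close>)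
    moreover have "{v0, w} \<notin> E" using split[of "{v0, w}"] v01 w by blast
    ultimately show False using T unfolding planar_triangulation_def by blast
  qed
  then have pv: "path_component ?D (p v0) (p v)" if "v \<in> V" for v using that unfolding V1_def by blast
  have px: "path_component ?D (p v0) x" if x: "x \<in> ?D" for x
  proof (cases "x \<in> p ` V")
    case True then show ?thesis using pv by blast
  next
    case False
    then obtain e where e: "e \<in> E" "x \<in> path_image (\<gamma> e)" using x unfolding drawing_eq arcs_def by blast
    obtain v where v: "v \<in> e" using card_edge[OF e(1)] by fastforce
    have "path_component ?D (p v) x" using edge[OF e(1) pin[OF e(1) v] e(2)] .
    moreover have "path_component ?D (p v0) (p v)" using pv v edge_subset[OF e(1)] by blast
    ultimately show ?thesis using path_component_trans by blast
  qed
  show ?thesis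
    unfolding path_connected_component using px path_component_sym path_component_trans by meson
qed

section \<open>Bounded faces are triangles\<close>

lemma outside_component_unbounded:
  assumes "y \<in> outside D" "F \<in> components (- D)" "y \<in> F"
  shows "\<not> bounded F"
proof -
  have "connected_component_set (- D) y = F"
    using assms(2,3) by (metis components_iff connected_component_eq)
  then show ?thesis using assms(1) by (auto simp: outside_def)
qed

text \<open>Connectedness of the drawing stands here in the place of maximality;
  \<open>triangulation_connected\<close> supplies it.\<close>

locale conjugated_graph = plane_graph V E p \<gamma>
  for V :: "'v set" and E :: "'v set set"
    and p :: "'v \<Rightarrow> complex" and \<gamma> :: "'v set \<Rightarrow> real \<Rightarrow> complex" +
  fixes \<mu> :: "'v set set \<Rightarrow> real \<Rightarrow> complex"
  assumes conj: "conjugated_triangulation V E p \<gamma> \<mu>"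
    and connected_graph: "path_connected (drawing V E p \<gamma>)"
begin

abbreviation "mid \<equiv> edge_midpoint \<gamma>"
abbreviation "M \<equiv> medians V E p \<gamma>"

lemma simple_graph_medians: "simple_graph E M"
  unfolding simple_graph_def medians_def face_medians_def boundary_edges_def using finite_E by auto

text \<open>All facts on plane graphs thereby hold for both drawings; vertices of the second graph
  are edges of the first.\<close>

sublocale H: plane_graph E M mid \<mu>
  using simple_graph_medians conj by unfold_locales (simp_all add: conjugated_triangulation_def)

lemma mid_in_edge: "mid e \<in> path_image (\<gamma> e)"
  by (simp add: edge_midpoint_def path_image_def)

lemma mid_not_vertex:
  assumes "e \<in> E" shows "mid e \<notin> p ` V"
proof
  assume "mid e \<in> p ` V"
  then have "mid e \<in> {pathstart (\<gamma> e), pathfinish (\<gamma> e)}"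
    using edge_Int_vertices[OF assms] mid_in_edge[of e] edge_ends[OF assms] by blast
  then have "\<gamma> e (1/2) = \<gamma> e 0 \<or> \<gamma> e (1/2) = \<gamma> e 1"
    by (auto simp: edge_midpoint_def pathstart_def pathfinish_def)
  moreover have "inj_on (\<gamma> e) {0..1}" using arc_edge[OF assms] by (simp add: arc_def)
  ultimately show False using inj_onD[of "\<gamma> e" "{0..1}" "1/2"] by force
qed

lemma mid_in_edge_iff:
  assumes "e \<in> E" "e' \<in> E" shows "mid e \<in> path_image (\<gamma> e') \<longleftrightarrow> e = e'"
  using edges_Int[OF assms] mid_in_edge[of e] mid_not_vertex[OF assms(1)] edge_subset[OF assms(1)] by blast

lemma boundary_edges_subset: "boundary_edges E \<gamma> F \<subseteq> E"
  by (auto simp: boundary_edges_def)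

lemma bounded_face: "F \<in> bounded_faces V E p \<gamma> \<Longrightarrow> F \<in> faces V E p \<gamma>"
  by (simp add: bounded_faces_def)

lemma median_mem:
  assumes "F \<in> bounded_faces V E p \<gamma>" "e \<in> boundary_edges E \<gamma> F" "e' \<in> boundary_edges E \<gamma> F" "e \<noteq> e'"
  shows "{e, e'} \<in> face_medians E \<gamma> F" "{e, e'} \<in> M"
  using assms by (auto simp: face_medians_def medians_def)

lemma median_in_face:
  assumes "F \<in> bounded_faces V E p \<gamma>" "s \<in> face_medians E \<gamma> F"
  shows "path_image (\<mu> s) - mid ` s \<subseteq> F"
  using conj assms unfolding conjugated_triangulation_def by blast

lemma oriented_median:
  assumes "{e, e'} \<in> M" "e \<noteq> e'"
  obtains h where "arc h" "pathstart h = mid e" "pathfinish h = mid e'" "path_image h = path_image (\<mu> {e, e'})"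
proof -
  have "arc (\<mu> {e, e'})" "{pathstart (\<mu> {e, e'}), pathfinish (\<mu> {e, e'})} = {mid e, mid e'}"
    using H.arc_edge[OF assms(1)] H.edge_ends[OF assms(1)] by auto
  then show ?thesis
    using that[of "\<mu> {e, e'}"] that[of "reversepath (\<mu> {e, e'})"] by (auto simp: doubleton_eq_iff arc_reversepath)
qed

text \<open>The frontier of \<open>F\<close> lies in the boundary edges together with finitely many
  vertices, and finitely many points can be bypassed.\<close>

lemma boundary_arcs_separate:
  assumes F: "F \<in> faces V E p \<gamma>" and xy: "x \<in> F" "y \<notin> drawing V E p \<gamma>" "y \<notin> F"
  shows "\<not> connected_component (- arcs (boundary_edges E \<gamma> F)) x y"
proof
  let ?B = "boundary_edges E \<gamma> F"
  assume "connected_component (- arcs ?B) x y"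
  moreover have "open (- arcs ?B)" using closed_arcs[OF boundary_edges_subset] by blast
  moreover have "x \<notin> p ` V" "y \<notin> p ` V" using xy face_disjoint_drawing[OF F] unfolding drawing_eq by auto
  ultimately have "connected_component (- arcs ?B - p ` V) x y"
    using connected_component_Diff_finite finite_V by blast
  moreover have "(- arcs ?B - p ` V) \<inter> frontier F = {}" using frontier_face_edges[OF F] by blast
  ultimately show False using connected_component_clopen xy by blast
qed

text \<open>One chord is the median \<open>{e1, e2}\<close>. The other is \<open>S\<close> continued
  by the median \<open>{e3, e4}\<close>; the detour through \<open>S\<close> is there because
  \<open>e4\<close> need not lie on the curve. Interleaving ends force the two to meet, but medians
  with no common edge are disjoint and \<open>S\<close> avoids the first chord.\<close>

lemma chords_cross:
  assumes F: "F \<in> bounded_faces V E p \<gamma>" and FJ: "F \<subseteq> inside (path_image c)"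
    and e: "{e1, e2, e3, e4} \<subseteq> boundary_edges E \<gamma> F" "distinct [e1, e2, e3, e4]"
    and sep: "loop_separates c (mid e1) (mid e2) z (mid e3)"
    and S: "connected S" "z \<in> S" "mid e4 \<in> S" "S \<subseteq> path_image c \<union> inside (path_image c)"
      "S \<inter> path_image (\<mu> {e1, e2}) = {}"
    and e3: "mid e3 \<in> path_image c"
  shows False
proof -
  obtain u d where ud: "arc u" "arc d" "pathstart u = mid e1" "pathfinish u = mid e2"
     "pathstart d = mid e1" "pathfinish d = mid e2" "path_image u \<inter> path_image d = {mid e1, mid e2}"
     "path_image u \<union> path_image d = path_image c" "z \<in> path_image u" "mid e3 \<in> path_image d"
    using sep unfolding loop_separates_def by (elim exE conjE) (rule that)
  have m: "{e1, e2} \<in> face_medians E \<gamma> F" "{e1, e2} \<in> M" "{e3, e4} \<in> face_medians E \<gamma> F" "{e3, e4} \<in> M"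
    using median_mem[OF F] e by auto
  obtain h where h: "arc h" "pathstart h = mid e1" "pathfinish h = mid e2" "path_image h = path_image (\<mu> {e1, e2})"
    using oriented_median m(2) e(2) by auto
  let ?S = "S \<union> path_image (\<mu> {e3, e4})"
  have e34: "mid e3 \<in> path_image (\<mu> {e3, e4})" "mid e4 \<in> path_image (\<mu> {e3, e4})"
    using H.vertex_in_edge_iff[OF m(4)] e(1) boundary_edges_subset[of F] by auto
  have "connected (path_image (\<mu> {e3, e4}))" using H.arc_edge m(4) connected_arc_image by blast
  then have "connected ?S" using S e34 by (intro connected_Un) auto
  moreover have "?S \<subseteq> path_image u \<union> path_image d \<union> inside (path_image u \<union> path_image d)"
  proof -
    have "path_image (\<mu> {e3, e4}) \<subseteq> F \<union> {mid e3, mid e4}" using median_in_face[OF F m(3)] by auto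
    then show ?thesis unfolding ud(8) using S FJ e3 by blast
  qed
  moreover have "?S \<inter> path_image h = {}"
  proof -
    have "path_image (\<mu> {e3, e4}) \<inter> path_image (\<mu> {e1, e2}) \<subseteq> mid ` ({e3, e4} \<inter> {e1, e2})"
      using H.edges_Int[OF m(4) m(2)] e(2) by (auto simp: doubleton_eq_iff)
    then show ?thesis using S(5) h(4) e(2) by auto
  qed
  moreover have "path_image h - {mid e1, mid e2} \<subseteq> inside (path_image u \<union> path_image d)"
    unfolding ud(8) h(4) using median_in_face[OF F m(1)] FJ by auto
  moreover have "?S \<inter> path_image u \<noteq> {}" using S(2) ud(9) by blast
  ultimately have "?S \<inter> path_image d = {}"
    using theta_separates[OF ud(1,2) h(1) ud(3-6) h(2,3) ud(7)] by blast
  then show False using e34 ud(10) by blast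
qed

text \<open>If \<open>e4\<close> belongs to the loop, its midpoint serves as \<open>z\<close>.
  Otherwise that midpoint is inside the loop, and a path in the connected drawing from there to
  \<open>mid e1\<close> is followed until it first hits the loop. The set \<open>S\<close> stays in
  the drawing and so avoids \<open>F\<close>, where the medians run.\<close>

lemma connect_to_loop:
  assumes F: "F \<in> bounded_faces V E p \<gamma>" and FJ: "F \<subseteq> inside (path_image c)"
    and c: "simple_path c" "pathfinish c = pathstart c" "path_image c = arcs A" "A \<subseteq> boundary_edges E \<gamma> F"
    and A: "e1 \<in> A" "e2 \<in> A" "e3 \<in> A" and e4: "e4 \<in> boundary_edges E \<gamma> F" "e4 \<notin> {e1, e2, e3}"
    and dis: "distinct [e1, e2, e3]"
  obtains z S where "connected S" "z \<in> S" "mid e4 \<in> S" "S \<subseteq> path_image c \<union> inside (path_image c)"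
    "z \<in> path_image c" "z \<notin> {mid e1, mid e2, mid e3}"
    "\<forall>e\<in>{e1, e2, e3}. \<forall>e'\<in>{e1, e2, e3}. e \<noteq> e' \<longrightarrow> S \<inter> path_image (\<mu> {e, e'}) = {}"
proof -
  let ?J = "path_image c" and ?I = "inside (path_image c)" and ?D = "drawing V E p \<gamma>"
  have BE: "A \<subseteq> E" using c(4) boundary_edges_subset by blast
  have e4E: "e4 \<in> E" using e4 boundary_edges_subset by blast
  have midne: "mid e \<noteq> mid e'" if "e \<in> E" "e' \<in> E" "e \<noteq> e'" for e e'
    using H.inj_p that by (auto simp: inj_on_def)
  have eA: "e \<in> A" if "e \<in> {e1, e2, e3}" for e using that A by auto
  have med: "path_image (\<mu> {e, e'}) \<subseteq> F \<union> {mid e, mid e'}" if "e \<in> A" "e' \<in> A" "e \<noteq> e'" for e e'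
    using median_in_face[OF F median_mem(1)[OF F]] that c(4) by blast
  have FD: "F \<inter> ?D = {}" using face_disjoint_drawing bounded_face F by blast
  have midD: "mid e \<in> ?D" if "e \<in> E" for e
    using that mid_in_edge unfolding drawing_eq arcs_def by blast
  have AD: "arcs A \<subseteq> ?D" using BE unfolding drawing_eq arcs_def by blast
  have IJ: "?I \<inter> ?J = {}" by (simp add: inside_no_overlap)
  have cl: "closure ?I = ?I \<union> ?J" and opI: "open ?I"
    using Jordan_inside_outside[OF c(1,2)] closure_Un_frontier[of ?I] by auto
  show thesis
  proof (cases "e4 \<in> A")
    case True
    have "mid e4 \<in> ?J" using True mid_in_edge unfolding c(3) arcs_def by blast
    moreover have mu: "{mid e4} \<inter> path_image (\<mu> {e, e'}) = {}" if "e \<in> {e1,e2,e3}" "e' \<in> {e1,e2,e3}" "e \<noteq> e'" for e e'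
    proof -
      have "mid e4 \<noteq> mid e" "mid e4 \<noteq> mid e'" using midne[OF e4E] eA that e4(2) BE by blast+
      then show ?thesis using med[OF eA eA] that midD[OF e4E] FD by blast
    qed
    moreover have "mid e4 \<notin> {mid e1, mid e2, mid e3}" using midne[OF e4E] e4(2) A BE by blast
    ultimately show thesis by (intro that[of "{mid e4}" "mid e4"] ballI impI mu) auto
  next
    case False
    have "mid e4 \<notin> ?J"
      unfolding c(3) arcs_def using mid_in_edge_iff[OF e4E] False BE by blast
    moreover have "mid e4 \<in> closure ?I"
      using e4(1) mid_in_edge[of e4] closure_mono[OF FJ] by (auto simp: boundary_edges_def frontier_def)
    ultimately have mI: "mid e4 \<in> ?I" using cl by blast
    have m1J: "mid e1 \<in> ?J" using A mid_in_edge unfolding c(3) arcs_def by blast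
    obtain g where g: "path g" "path_image g \<subseteq> ?D" "pathstart g = mid e4" "pathfinish g = mid e1"
    proof -
      have "mid e4 \<in> ?D" "mid e1 \<in> ?D" using midD e4E A(1) BE by auto
      then have "\<exists>g. path g \<and> path_image g \<subseteq> ?D \<and> pathstart g = mid e4 \<and> pathfinish g = mid e1"
        using connected_graph[unfolded path_connected_def] by (elim ballE) auto
      then show thesis using that by (elim exE conjE)
    qed
    have "pathfinish g \<notin> ?I" unfolding g(4) using m1J IJ by blast
    then have "\<exists>u. 0 \<le> u \<and> u \<le> 1 \<and> (\<forall>x. 0 \<le> x \<and> x < u \<longrightarrow> g x \<in> interior ?I) \<and>
        g u \<notin> interior ?I \<and> (u = 0 \<or> g u \<in> closure ?I)"
      by (rule subpath_to_frontier_explicit[OF g(1)]) blast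
    then obtain u where u: "0 \<le> u" "u \<le> 1" "\<forall>x. 0 \<le> x \<and> x < u \<longrightarrow> g x \<in> interior ?I"
      "g u \<notin> interior ?I" "u = 0 \<or> g u \<in> closure ?I"
      by blast
    have u0: "u \<noteq> 0" using u(4) mI g(3) opI by (auto simp: pathstart_def interior_open)
    have gu: "g u \<in> ?J" "g u \<notin> ?I" using u(4,5) u0 cl opI by (auto simp: interior_open)
    have gx: "g x \<in> ?I" if "0 \<le> x" "x < u" for x using u(3) that opI by (simp add: interior_open)
    have contg: "continuous_on {0..1} g" using g(1) by (simp add: path_def)
    have gD: "g x \<in> ?D" if "x \<in> {0..1}" for x using g(2) that by (auto simp: path_image_def)
    \<comment> \<open>Near the midpoint of \<open>e\<close> the drawing consists of \<open>e\<close>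
      alone, and \<open>e\<close> is part of the loop. A path arriving there would have been on the
      loop before the first hit.\<close>
    have gm: "g u \<noteq> mid e" if "e \<in> A" for e
    proof
      assume eq: "g u = mid e"
      let ?K = "p ` V \<union> arcs (E - {e})"
      have eE: "e \<in> E" using that BE by blast
      have "closed ?K" using finite_V closed_arcs[of "E - {e}"] by (simp add: closed_Un finite_imp_closed)
      moreover have "g u \<in> - ?K"
        using drawing_minus_edge[OF eE mid_in_edge mid_not_vertex[OF eE]] eq by simp
      ultimately obtain r where r: "r > 0" "ball (g u) r \<subseteq> - ?K"
        using open_contains_ball[of "- ?K"] by blast
      obtain d where d: "d > 0" "\<And>x. x \<in> {0..1} \<Longrightarrow> dist x u < d \<Longrightarrow> dist (g x) (g u) < r"
        using contg u(1,2) r(1) unfolding continuous_on_iff by (metis atLeastAtMost_iff)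
      define x where "x = max 0 (u - d/2)"
      have x: "0 \<le> x" "x < u" "x \<in> {0..1}" "dist x u < d"
        using u(1,2) u0 d(1) by (auto simp: x_def dist_real_def)
      have "g x \<in> ball (g u) r" using d(2)[OF x(3,4)] by (simp add: dist_commute)
      then have "g x \<notin> ?K" using r(2) by blast
      moreover have "?D = ?K \<union> path_image (\<gamma> e)" using eE unfolding drawing_eq arcs_def by blast
      ultimately have "g x \<in> path_image (\<gamma> e)" using gD[OF x(3)] by blast
      then have "g x \<in> ?J" using that unfolding c(3) arcs_def by blast
      then show False using gx[OF x(1,2)] IJ by blast
    qed
    define S where "S = g ` {0..u}"
    have SI: "S \<subseteq> ?I \<union> {g u}" unfolding S_def using gx by force
    have SD: "S \<subseteq> ?D" unfolding S_def using gD u by auto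
    have "connected S"
      unfolding S_def by (intro connected_continuous_image continuous_on_subset[OF contg]) (use u in auto)
    moreover have "g u \<in> S" "mid e4 \<in> S" unfolding S_def using u(1) g(3) imageI[of 0 "{0..u}" g] by (auto simp: pathstart_def)
    \<comment> \<open>A median lies in \<open>F\<close> except for its two ends. These are on the
      loop, which \<open>S\<close> touches only in \<open>g u\<close>.\<close>
    moreover have mu: "S \<inter> path_image (\<mu> {e, e'}) = {}" if "e \<in> {e1,e2,e3}" "e' \<in> {e1,e2,e3}" "e \<noteq> e'" for e e'
    proof -
      have "mid e \<in> ?J" "mid e' \<in> ?J"
        using eA that mid_in_edge unfolding c(3) arcs_def by blast+
      moreover have "g u \<noteq> mid e" "g u \<noteq> mid e'" using gm eA that by blast+
      ultimately have "mid e \<notin> ?I \<union> {g u}" "mid e' \<notin> ?I \<union> {g u}" using inside_no_overlap[of ?J] by (metis IntI Un_iff empty_iff singletonD)+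
      then have "mid e \<notin> S" "mid e' \<notin> S" using SI by blast+
      moreover have "S \<inter> F = {}" using SD FD by blast
      moreover have "path_image (\<mu> {e, e'}) \<subseteq> F \<union> {mid e, mid e'}" using med[OF eA eA] that by blast
      ultimately show ?thesis by blast
    qed
    moreover have "S \<subseteq> ?J \<union> ?I" using SI gu(1) by blast
    moreover have "g u \<notin> {mid e1, mid e2, mid e3}" using gm A by blast
    ultimately show thesis using gu(1) by (intro that[of S "g u"] ballI impI mu)
  qed
qed

text \<open>A further boundary edge \<open>e\<close> is tied to a point \<open>z\<close> of the
  loop. One of the three midpoints is separated from \<open>z\<close> by the other two; the median
  from that one to \<open>e\<close> would cross the median of the other two.\<close>

lemma loop_boundary_edges:
  assumes F: "F \<in> bounded_faces V E p \<gamma>" and FJ: "F \<subseteq> inside (path_image l)"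
    and l: "simple_path l" "pathfinish l = pathstart l" "path_image l = arcs A" and AB: "A \<subseteq> boundary_edges E \<gamma> F"
    and A: "e1 \<in> A" "e2 \<in> A" "e3 \<in> A" and dis: "distinct [e1, e2, e3]"
  shows "boundary_edges E \<gamma> F \<subseteq> {e1, e2, e3}"
proof (rule subsetI, rule ccontr)
  fix e assume eB: "e \<in> boundary_edges E \<gamma> F" and ne: "e \<notin> {e1, e2, e3}"
  obtain z S where S: "connected S" "z \<in> S" "mid e \<in> S" "S \<subseteq> path_image l \<union> inside (path_image l)"
    "z \<in> path_image l" "z \<notin> {mid e1, mid e2, mid e3}"
    "\<forall>e\<in>{e1, e2, e3}. \<forall>e'\<in>{e1, e2, e3}. e \<noteq> e' \<longrightarrow> S \<inter> path_image (\<mu> {e, e'}) = {}"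
    by (rule connect_to_loop[OF F FJ l AB A eB ne dis])
  have m: "mid e1 \<in> path_image l" "mid e2 \<in> path_image l" "mid e3 \<in> path_image l"
    using A mid_in_edge unfolding l(3) arcs_def by blast+
  have "A \<subseteq> E" using AB boundary_edges_subset by blast
  then have "distinct [mid e1, mid e2, mid e3]"
    using H.inj_p A dis by (auto simp: inj_on_eq_iff subset_iff)
  then have dz: "distinct [z, mid e1, mid e2, mid e3]" using S(6) by auto
  have bs: "{e1, e2, e3, e} \<subseteq> boundary_edges E \<gamma> F" using A AB eB by blast
  have dS: "S \<inter> path_image (\<mu> {e1, e2}) = {}" "S \<inter> path_image (\<mu> {e1, e3}) = {}"
    "S \<inter> path_image (\<mu> {e2, e3}) = {}"
    using S(7) dis by auto
  consider "loop_separates l (mid e1) (mid e2) z (mid e3)" | "loop_separates l (mid e1) (mid e3) z (mid e2)"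
    | "loop_separates l (mid e2) (mid e3) z (mid e1)"
    using loop_separates_three[OF l(1,2) m S(5) dz] by blast
  then show False
  proof cases
    case 1
    show False
      by (rule chords_cross[OF F FJ _ _ 1 S(1-4) dS(1) m(3)]) (use bs dis ne in auto)
  next
    case 2
    show False
      by (rule chords_cross[OF F FJ _ _ 2 S(1-4) dS(2) m(2)]) (use bs dis ne in auto)
  next
    case 3
    show False
      by (rule chords_cross[OF F FJ _ _ 3 S(1-4) dS(3) m(1)]) (use bs dis ne in auto)
  qed
qed

theorem bounded_face_triangle:
  assumes F: "F \<in> bounded_faces V E p \<gamma>"
  obtains a b c l where "{a, b} \<in> E" "{a, c} \<in> E" "{b, c} \<in> E" "a \<noteq> b" "a \<noteq> c" "b \<noteq> c"
    "boundary_edges E \<gamma> F = {{a, b}, {a, c}, {b, c}}"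
    "simple_path l" "pathfinish l = pathstart l" "path_image l = arcs {{a, b}, {a, c}, {b, c}}"
    "F = inside (path_image l)"
proof -
  let ?D = "drawing V E p \<gamma>" and ?B = "boundary_edges E \<gamma> F"
  have Ff: "F \<in> faces V E p \<gamma>" and bF: "bounded F" using F by (auto simp: bounded_faces_def)
  have FD: "F \<inter> ?D = {}" using face_disjoint_drawing Ff by blast
  have Fcomp: "F \<in> components (- ?D)" using Ff by (simp add: faces_def)
  obtain x where x: "x \<in> F" using Fcomp in_components_nonempty by blast
  \<comment> \<open>Taking \<open>y\<close> in the unbounded region of the drawing puts it outside
    every closed curve in the drawing, so a curve that separates \<open>x\<close> from
    \<open>y\<close> has \<open>x\<close> inside.\<close>
  have "outside ?D \<noteq> {}"
    using outside_bounded_nonempty compact_drawing compact_imp_bounded by blast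
  then obtain y where y: "y \<in> outside ?D" by blast
  have yF: "y \<notin> F" using outside_component_unbounded[OF y Fcomp] bF by blast
  have yD: "y \<notin> ?D" using y by (simp add: outside_def)
  have sepB: "\<not> connected_component (- arcs ?B) x y"
    by (rule boundary_arcs_separate[OF Ff x yD yF])
  have finB: "finite ?B" using finite_E boundary_edges_subset finite_subset by blast
  \<comment> \<open>A minimal separating set of boundary edges is a single closed curve by
    \<open>minimal_separating_loop\<close> and has no loose ends by
    \<open>minimal_separating_degree\<close>.\<close>
  let ?P = "{A \<in> Pow ?B. \<not> connected_component (- arcs A) x y}"
  have "finite ?P" using finB by simp
  moreover have "?B \<in> ?P" using sepB by simp
  ultimately obtain A where "A \<in> ?P" "\<forall>A'\<in>?P. A' \<subseteq> A \<longrightarrow> A = A'"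
    using finite_has_minimal2[of ?P ?B] by blast
  then have AB: "A \<subseteq> ?B" and sepA: "\<not> connected_component (- arcs A) x y"
    and min: "\<And>e. e \<in> A \<Longrightarrow> connected_component (- arcs (A - {e})) x y"
    by blast+
  have AE: "A \<subseteq> E" using AB boundary_edges_subset by blast
  have AD: "arcs A \<subseteq> ?D" using AE arcs_mono unfolding drawing_eq by blast
  have xA: "x \<notin> arcs A" "y \<notin> arcs A" using AD x FD yD by auto
  obtain l where l: "simple_path l" "pathfinish l = pathstart l" "path_image l = arcs A"
    "\<not> connected_component (- path_image l) x y"
    using minimal_separating_loop[OF AE xA sepA min] by blast
  let ?J = "path_image l"
  have Jord: "open (inside ?J)" "connected (inside ?J)" "connected (outside ?J)" "inside ?J \<union> outside ?J = - ?J"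
    using Jordan_inside_outside[OF l(1,2)] by blast+
  have JD: "?J \<subseteq> ?D" using AD l(3) by simp
  have "y \<in> outside ?J" using outside_mono[OF JD] y by blast
  moreover have "outside ?J \<subseteq> - ?J" by (auto simp: outside_def)
  ultimately have "x \<notin> outside ?J"
    using l(4) Jord(3) unfolding connected_component_def by blast
  then have xI: "x \<in> inside ?J" using Jord(4) xA(1) l(3) by blast
  have FJ: "F \<subseteq> inside ?J"
  proof
    fix w assume "w \<in> F"
    moreover have "connected F" using Fcomp in_components_connected by blast
    moreover have "F \<subseteq> - ?J" using FD JD by blast
    ultimately have "connected_component (- ?J) x w" unfolding connected_component_def using x by blast
    then show "w \<in> inside ?J" using inside_same_component xI by blast
  qed
  have deg: "\<exists>e'\<in>A - {e}. v \<in> e'" if "e \<in> A" "v \<in> e" for e v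
    by (rule minimal_separating_degree[OF AE xA sepA min that])
  have "A \<noteq> {}" using l(3) path_image_nonempty[of l] by (auto simp: arcs_def)
  obtain a b c d where abcd: "{a, b} \<in> A" "{a, c} \<in> A" "{b, d} \<in> A" "a \<noteq> b" "a \<noteq> c" "b \<noteq> c" "a \<noteq> d" "b \<noteq> d"
    "A = {{a, b}, {a, c}, {b, d}} \<longrightarrow> c = d"
    by (rule min_degree_two_triple[OF AE \<open>A \<noteq> {}\<close> deg])
  have dis: "distinct [{a, b}, {a, c}, {b, d}]" using abcd by (auto simp: doubleton_eq_iff)
  have "?B \<subseteq> {{a, b}, {a, c}, {b, d}}"
    by (rule loop_boundary_edges[OF F FJ l(1-3) AB abcd(1-3) dis])
  then have BA: "?B = A" "A = {{a, b}, {a, c}, {b, d}}" using abcd(1-3) AB by blast+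
  have cd: "c = d" using abcd(9) BA(2) by blast
  have "F = inside ?J"
  proof
    show "F \<subseteq> inside ?J" by (rule FJ)
    \<comment> \<open>The vertices inside the curve. The inside without them is connected and misses
      the frontier of \<open>F\<close>, hence lies in \<open>F\<close>. So the drawing has only
      these points inside the curve, and as isolated points they contradict its
      connectedness.\<close>
    define Z where "Z = p ` V \<inter> inside ?J"
    have finZ: "finite Z" using finite_V by (simp add: Z_def)
    have "connected (inside ?J - Z)"
      by (rule connected_open_delete_finite) (use Jord finZ in auto)
    moreover have "x \<in> inside ?J - Z" using xI x FD unfolding drawing_eq Z_def by blast
    moreover have "(inside ?J - Z) \<inter> frontier F = {}"
      using frontier_face_edges[OF Ff] BA(1) l(3) inside_no_overlap[of ?J] unfolding Z_def by blast
    ultimately have sub: "inside ?J - Z \<subseteq> F" using x connected_Int_frontier[of "inside ?J - Z" F] by blast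
    then have DZ: "?D \<inter> inside ?J = Z" using FD unfolding Z_def drawing_eq by blast
    have "Z = {}"
    proof (rule ccontr)
      assume "Z \<noteq> {}"
      have "closed (?D - inside ?J)" using compact_drawing compact_imp_closed Jord(1) by blast
      moreover have "closed Z" using finZ finite_imp_closed by blast
      moreover have "connected ?D" using connected_graph path_connected_imp_connected by blast
      moreover have "?D \<subseteq> Z \<union> (?D - inside ?J)" "Z \<inter> (?D - inside ?J) \<inter> ?D = {}" using DZ by blast+
      ultimately have "Z \<inter> ?D = {} \<or> (?D - inside ?J) \<inter> ?D = {}"
        by (meson connected_closed)
      moreover have "?J \<subseteq> ?D - inside ?J" using JD inside_no_overlap[of ?J] by blast
      moreover have "?J \<noteq> {}" by simp
      ultimately show False using DZ \<open>Z \<noteq> {}\<close> by blast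
    qed
    then show "inside ?J \<subseteq> F" using sub by blast
  qed
  then show thesis
    using that[of a b c l] abcd AE BA cd l by (auto simp: insert_commute)
qed

end

section \<open>The faces of the conjugated triangulation\<close>

lemma two_subsets_of_three:
  assumes "x \<noteq> y" "x \<noteq> z" "y \<noteq> z"
  shows "{s. s \<subseteq> {x, y, z} \<and> card s = 2} = {{x, y}, {y, z}, {z, x}}"
proof (intro subset_antisym subsetI)
  fix s assume "s \<in> {s. s \<subseteq> {x, y, z} \<and> card s = 2}"
  then obtain u w where "s = {u, w}" "u \<noteq> w" "u = x \<or> u = y \<or> u = z" "w = x \<or> w = y \<or> w = z"
    by (auto simp: card_2_iff)
  then show "s \<in> {{x, y}, {y, z}, {z, x}}" by (elim disjE) (simp_all add: insert_commute)
next
  fix s assume "s \<in> {{x, y}, {y, z}, {z, x}}"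
  then show "s \<in> {s. s \<subseteq> {x, y, z} \<and> card s = 2}" using assms by auto
qed

section \<open>Half-edges, corners and the pieces of a triangular face\<close>

context conjugated_graph
begin

text \<open>Runs from the vertex to the midpoint whichever way \<open>\<gamma> e\<close> is
  oriented; \<open>subpath 1 (1/2)\<close> is the second half traversed backwards.\<close>

definition half :: "'v set \<Rightarrow> 'v \<Rightarrow> real \<Rightarrow> complex" where
  "half e v = (if pathstart (\<gamma> e) = p v then subpath 0 (1/2) (\<gamma> e) else subpath 1 (1/2) (\<gamma> e))"

abbreviation "hs e v \<equiv> path_image (half e v)"

text \<open>Meant for the vertex shared by both edges of \<open>s\<close>, where it is the piece
  that the median cuts off the triangle; hence the recurring condition
  \<open>v \<in> \<Inter>s\<close>.\<close>

definition corner :: "'v set set \<Rightarrow> 'v \<Rightarrow> complex set" where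
  "corner s v = inside ((\<Union>e\<in>s. hs e v) \<union> path_image (\<mu> s))"

definition centre_boundary :: "complex set \<Rightarrow> complex set" where
  "centre_boundary F = (\<Union>s\<in>face_medians E \<gamma> F. path_image (\<mu> s))"

abbreviation "centre F \<equiv> inside (centre_boundary F)"

lemma half_image:
  assumes "e \<in> E" "v \<in> e"
  shows "hs e v = (if pathstart (\<gamma> e) = p v then \<gamma> e ` {0..1/2} else \<gamma> e ` {1/2..1})"
  by (simp add: half_def path_image_subpath)

lemma half:
  assumes "e \<in> E" "v \<in> e"
  shows "arc (half e v)" "pathstart (half e v) = p v" "pathfinish (half e v) = mid e"
    "hs e v \<subseteq> path_image (\<gamma> e)" "hs e v \<inter> p ` V = {p v}"
proof -
  have g: "arc (\<gamma> e)" by (rule arc_edge[OF assms(1)])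
  show a: "arc (half e v)" using g by (auto simp: half_def intro!: arc_subpath_arc)
  have "p v \<in> {pathstart (\<gamma> e), pathfinish (\<gamma> e)}" using edge_ends[OF assms(1)] assms(2) by blast
  then show ps: "pathstart (half e v) = p v" by (auto simp: half_def pathstart_def pathfinish_def subpath_def)
  show "pathfinish (half e v) = mid e" by (simp add: half_def edge_midpoint_def)
  show sub: "hs e v \<subseteq> path_image (\<gamma> e)"
    unfolding half_image[OF assms] by (auto simp: path_image_def[of "\<gamma> e"])
  have inj: "inj_on (\<gamma> e) {0..1}" using g by (simp add: arc_def)
  have "q = p v" if q: "q \<in> hs e v" "q \<in> p ` V" for q
  proof -
    have "q \<in> {\<gamma> e 0, \<gamma> e 1}"
      using q sub edge_Int_vertices[OF assms(1)] edge_ends[OF assms(1)] by (auto simp: pathstart_def pathfinish_def)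
    moreover have "\<gamma> e 1 \<notin> \<gamma> e ` {0..1/2}" "\<gamma> e 0 \<notin> \<gamma> e ` {1/2..1}"
      using inj by (auto simp: inj_on_eq_iff)
    moreover have "p v \<in> {\<gamma> e 0, \<gamma> e 1}"
      using \<open>p v \<in> {pathstart (\<gamma> e), pathfinish (\<gamma> e)}\<close> by (simp add: pathstart_def pathfinish_def)
    ultimately show ?thesis
      using q(1) unfolding half_image[OF assms] pathstart_def by (metis empty_iff insert_iff)
  qed
  moreover have "p v \<in> hs e v" using pathstart_in_path_image[of "half e v"] ps by simp
  moreover have "p v \<in> p ` V" using assms edge_subset by blast
  ultimately show "hs e v \<inter> p ` V = {p v}" by blast
qed

lemma mid_in_half: "e \<in> E \<Longrightarrow> v \<in> e \<Longrightarrow> mid e \<in> hs e v"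
  using half(3) pathfinish_in_path_image by metis

lemma vertex_in_half: "e \<in> E \<Longrightarrow> v \<in> e \<Longrightarrow> p v \<in> hs e v"
  using half(2) pathstart_in_path_image by metis

lemma half_Un_Int:
  assumes "{v, w} \<in> E" "v \<noteq> w"
  shows "hs {v, w} v \<union> hs {v, w} w = path_image (\<gamma> {v, w})" "hs {v, w} v \<inter> hs {v, w} w = {mid {v, w}}"
proof -
  let ?g = "\<gamma> {v, w}"
  have ends: "{pathstart ?g, pathfinish ?g} = {p v, p w}" using edge_ends[OF assms(1)] by simp
  have pvw: "p v \<noteq> p w"
    using inj_p edge_subset[OF assms(1)] assms(2) by (auto simp: inj_on_eq_iff)
  have inj: "inj_on ?g {0..1}" using arc_edge[OF assms(1)] by (simp add: arc_def)
  have "{0..1::real} = {0..1/2} \<union> {1/2..1}" by auto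
  then have un: "?g ` {0..1/2} \<union> ?g ` {1/2..1} = path_image ?g" unfolding path_image_def by (metis image_Un)
  have "?g ` {0..1/2} \<inter> ?g ` {1/2..1} = ?g ` ({0..1/2} \<inter> {1/2..1})"
    by (rule inj_on_image_Int[OF inj, symmetric]) auto
  moreover have "{0..1/2} \<inter> {1/2..1::real} = {1/2}" by auto
  ultimately have int: "?g ` {0..1/2} \<inter> ?g ` {1/2..1} = {mid {v, w}}" by (simp add: edge_midpoint_def)
  have "pathstart ?g = p v \<longleftrightarrow> pathstart ?g \<noteq> p w" using ends pvw by (auto simp: doubleton_eq_iff)
  then show "hs {v, w} v \<union> hs {v, w} w = path_image ?g" "hs {v, w} v \<inter> hs {v, w} w = {mid {v, w}}"
    using half_image[OF assms(1), of v] half_image[OF assms(1), of w] un int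
    by (auto simp: Un_commute Int_commute split: if_splits)
qed

lemma half_Int:
  assumes "e \<in> E" "e' \<in> E" "e \<noteq> e'" "v \<in> e" "w \<in> e'"
  shows "hs e v \<inter> hs e' w \<subseteq> {p v} \<inter> {p w}"
proof
  fix q assume q: "q \<in> hs e v \<inter> hs e' w"
  then have "q \<in> p ` V" using edges_Int[OF assms(1-3)] half(4) assms edge_subset by blast
  then show "q \<in> {p v} \<inter> {p w}" using q half(5) assms by blast
qed

lemma half_Int_empty:
  assumes "e \<in> E" "e' \<in> E" "e \<noteq> e'" "v \<in> e" "w \<in> e'" "v \<noteq> w"
  shows "hs e v \<inter> hs e' w = {}"
proof -
  have "p v \<noteq> p w" using inj_p assms edge_subset by (metis inj_on_eq_iff subsetD)
  then show ?thesis using half_Int[OF assms(1-5)] by auto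
qed

text \<open>Supplies the outer arcs \<open>k12\<close>, \<open>k23\<close> and \<open>k31\<close>
  for \<open>hexagon_regions\<close>.\<close>

lemma corner_arc:
  assumes e: "e \<in> E" "e' \<in> E" "e \<noteq> e'" "v \<in> e" "v \<in> e'"
  obtains k where "arc k" "pathstart k = mid e" "pathfinish k = mid e'" "path_image k = hs e v \<union> hs e' v"
proof -
  let ?k = "reversepath (half e v) +++ half e' v"
  note h = half[OF e(1,4)] half[OF e(2,5)]
  have "arc ?k" using h half_Int[OF e(1-5)] by (intro arc_join) (auto simp: arc_reversepath)
  then show ?thesis using that[of ?k] h by (simp add: path_image_join)
qed

text \<open>The triangle is treated as a hexagon with its midpoints as additional corners: between
  two midpoints the boundary passes through one vertex, and \<open>hexagon_regions\<close> applies
  with the medians as chords. Two sides of a triangle share exactly one vertex, so quantifying over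
  \<open>s\<close> and \<open>v \<in> \<Inter>s\<close> lists each corner once.\<close>

lemma face_structure:
  assumes F: "F \<in> bounded_faces V E p \<gamma>"
  defines "N \<equiv> centre_boundary F"
  shows "F \<subseteq> centre F \<union> (\<Union>s\<in>face_medians E \<gamma> F. \<Union>v\<in>\<Inter>s. corner s v) \<union> N" (is ?cover)
    and "\<forall>s\<in>face_medians E \<gamma> F. \<forall>v\<in>\<Inter>s. corner s v \<subseteq> F \<and> connected (corner s v) \<and>
      closure (corner s v) = corner s v \<union> (\<Union>e\<in>s. hs e v) \<union> path_image (\<mu> s) \<and>
      corner s v \<inter> N = {} \<and> corner s v \<inter> centre F = {}" (is ?corners)
    and "\<forall>s\<in>face_medians E \<gamma> F. \<forall>t\<in>face_medians E \<gamma> F. \<forall>v\<in>\<Inter>s. \<forall>w\<in>\<Inter>t. v \<noteq> w \<longrightarrow>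
      corner s v \<inter> corner t w = {}" (is ?disjoint)
    and "centre F \<subseteq> F" "closure (centre F) = centre F \<union> N" "frontier (centre F) = N"
proof -
  obtain a b c l where abc: "{a, b} \<in> E" "{a, c} \<in> E" "{b, c} \<in> E" "a \<noteq> b" "a \<noteq> c" "b \<noteq> c"
    and B: "boundary_edges E \<gamma> F = {{a, b}, {a, c}, {b, c}}"
    and l: "path_image l = arcs {{a, b}, {a, c}, {b, c}}" "F = inside (path_image l)"
    by (rule bounded_face_triangle[OF F])
  define e1 where "e1 = {a, b}"
  define e2 where "e2 = {a, c}"
  define e3 where "e3 = {b, c}"
  have eE: "e1 \<in> E" "e2 \<in> E" "e3 \<in> E" using abc by (auto simp: e1_def e2_def e3_def)
  have ne: "e1 \<noteq> e2" "e1 \<noteq> e3" "e2 \<noteq> e3" using abc by (auto simp: e1_def e2_def e3_def doubleton_eq_iff)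
  have ve: "a \<in> e1" "b \<in> e1" "a \<in> e2" "c \<in> e2" "b \<in> e3" "c \<in> e3" by (auto simp: e1_def e2_def e3_def)
  have B': "boundary_edges E \<gamma> F = {e1, e2, e3}" using B by (simp add: e1_def e2_def e3_def)
  have fm: "face_medians E \<gamma> F = {{e1, e2}, {e2, e3}, {e3, e1}}"
    unfolding face_medians_def B' by (rule two_subsets_of_three[OF ne])
  have int: "\<Inter>{e1, e2} = {a}" "\<Inter>{e2, e3} = {c}" "\<Inter>{e3, e1} = {b}"
    using abc by (auto simp: e1_def e2_def e3_def)
  have M: "{e1, e2} \<in> M" "{e2, e3} \<in> M" "{e3, e1} \<in> M" using fm F unfolding medians_def by auto
  obtain k12 where k12: "arc k12" "pathstart k12 = mid e1" "pathfinish k12 = mid e2"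
    "path_image k12 = hs e1 a \<union> hs e2 a"
    by (rule corner_arc[OF eE(1,2) ne(1) ve(1,3)])
  obtain k23 where k23: "arc k23" "pathstart k23 = mid e2" "pathfinish k23 = mid e3"
    "path_image k23 = hs e2 c \<union> hs e3 c"
    by (rule corner_arc[OF eE(2,3) ne(3) ve(4,6)])
  obtain k31 where k31: "arc k31" "pathstart k31 = mid e3" "pathfinish k31 = mid e1"
    "path_image k31 = hs e3 b \<union> hs e1 b"
    by (rule corner_arc[OF eE(3,1) ne(2)[symmetric] ve(5,2)])
  obtain n12 where n12: "arc n12" "pathstart n12 = mid e1" "pathfinish n12 = mid e2"
    "path_image n12 = path_image (\<mu> {e1, e2})"
    by (rule oriented_median[OF M(1) ne(1)])
  obtain n23 where n23: "arc n23" "pathstart n23 = mid e2" "pathfinish n23 = mid e3"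
    "path_image n23 = path_image (\<mu> {e2, e3})"
    by (rule oriented_median[OF M(2) ne(3)])
  obtain n31 where n31: "arc n31" "pathstart n31 = mid e3" "pathfinish n31 = mid e1"
    "path_image n31 = path_image (\<mu> {e3, e1})"
    by (rule oriented_median[OF M(3) ne(2)[symmetric]])
  have h: "hs e1 a \<union> hs e1 b = path_image (\<gamma> e1)" "hs e2 a \<union> hs e2 c = path_image (\<gamma> e2)"
    "hs e3 b \<union> hs e3 c = path_image (\<gamma> e3)" "hs e1 a \<inter> hs e1 b = {mid e1}" "hs e2 a \<inter> hs e2 c = {mid e2}"
    "hs e3 b \<inter> hs e3 c = {mid e3}"
    using half_Un_Int[OF abc(1,4)] half_Un_Int[OF abc(2,5)] half_Un_Int[OF abc(3,6)]
    by (simp_all only: e1_def e2_def e3_def)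
  have z: "hs e1 a \<inter> hs e2 c = {}" "hs e1 a \<inter> hs e3 c = {}" "hs e2 a \<inter> hs e3 c = {}"
    "hs e2 c \<inter> hs e3 b = {}" "hs e2 c \<inter> hs e1 b = {}" "hs e3 c \<inter> hs e1 b = {}"
    "hs e3 b \<inter> hs e1 a = {}" "hs e3 b \<inter> hs e2 a = {}" "hs e1 b \<inter> hs e2 a = {}"
    using half_Int_empty[OF eE(1,2) ne(1) ve(1,4)] half_Int_empty[OF eE(1,3) ne(2) ve(1,6)]
      half_Int_empty[OF eE(2,3) ne(3) ve(3,6)] half_Int_empty[OF eE(2,3) ne(3) ve(4,5)]
      half_Int_empty[OF eE(2,1) ne(1)[symmetric] ve(4,2)] half_Int_empty[OF eE(3,1) ne(2)[symmetric] ve(6,2)]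
      half_Int_empty[OF eE(3,1) ne(2)[symmetric] ve(5,1)] half_Int_empty[OF eE(3,2) ne(3)[symmetric] ve(5,3)]
      half_Int_empty[OF eE(1,2) ne(1) ve(2,3)] abc(4-6) by auto
  have kk: "path_image k12 \<inter> path_image k23 = {mid e2}" "path_image k23 \<inter> path_image k31 = {mid e3}"
      "path_image k31 \<inter> path_image k12 = {mid e1}"
    unfolding k12 k23 k31 Int_Un_distrib Int_Un_distrib2 using h(4-6) z by (simp_all add: Int_commute)
  have mm: "mid e \<in> path_image (\<mu> s)" if "s \<in> M" "e \<in> s" for s e
    using H.vertex_in_edge_iff[OF that(1)] that H.edge_subset by blast
  have nn: "path_image n12 \<inter> path_image n23 = {mid e2}" "path_image n23 \<inter> path_image n31 = {mid e3}"
      "path_image n31 \<inter> path_image n12 = {mid e1}"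
  proof -
    have mt: "path_image (\<mu> s) \<inter> path_image (\<mu> t) = {mid e}" if "s \<in> M" "t \<in> M" "s \<noteq> t" "s \<inter> t = {e}" for s t e
      using H.edges_Int[OF that(1-3)] mm[OF that(1), of e] mm[OF that(2), of e] that(4) by auto
    have d: "{e1, e2} \<noteq> {e2, e3}" "{e2, e3} \<noteq> {e3, e1}" "{e3, e1} \<noteq> {e1, e2}"
      "{e1, e2} \<inter> {e2, e3} = {e2}" "{e2, e3} \<inter> {e3, e1} = {e3}" "{e3, e1} \<inter> {e1, e2} = {e1}"
      using ne by auto
    show "path_image n12 \<inter> path_image n23 = {mid e2}" "path_image n23 \<inter> path_image n31 = {mid e3}"
      "path_image n31 \<inter> path_image n12 = {mid e1}"
      unfolding n12 n23 n31 using mt[OF M(1,2) d(1,4)] mt[OF M(2,3) d(2,5)] mt[OF M(3,1) d(3,6)] by simp_all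
  qed
  have J: "path_image l = path_image k12 \<union> path_image k23 \<union> path_image k31"
    unfolding l(1) k12 k23 k31 arcs_def e1_def[symmetric] e2_def[symmetric] e3_def[symmetric]
    using h(1-3) by auto
  have N: "N = path_image n12 \<union> path_image n23 \<union> path_image n31"
    unfolding N_def centre_boundary_def fm n12 n23 n31 by auto
  have nJ: "N - {mid e1, mid e2, mid e3} \<subseteq> inside (path_image l)"
  proof -
    have "path_image (\<mu> s) - {mid e1, mid e2, mid e3} \<subseteq> F" if "s \<in> face_medians E \<gamma> F" for s
      using median_in_face[OF F that] that unfolding fm by auto
    then show ?thesis unfolding l(2)[symmetric] N_def centre_boundary_def by blast
  qed
  have I: "corner {e1, e2} a = inside (path_image k12 \<union> path_image n12)"
    "corner {e2, e3} c = inside (path_image k23 \<union> path_image n23)"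
    "corner {e3, e1} b = inside (path_image k31 \<union> path_image n31)"
    by (simp_all add: corner_def k12 k23 k31 n12 n23 n31)
  note R = hexagon_regions[OF k12(1) k23(1) k31(1) n12(1) n23(1) n31(1) k12(2,3) k23(2,3) k31(2,3)
      n12(2,3) n23(2,3) n31(2,3) kk nn J N nJ I refl, folded l(2)]
  show ?cover unfolding fm using R(1) int N_def by auto
  show ?corners
    unfolding fm using R(2-4,6-21) int k12(4) k23(4) k31(4) n12(4) n23(4) n31(4) N_def by (simp add: Un_assoc)
  show ?disjoint
    unfolding fm using R(6-8) int by (auto simp: Int_commute)
  show "centre F \<subseteq> F" "closure (centre F) = centre F \<union> N" "frontier (centre F) = N"
    using R(5) R(23) R(24) N_def by auto
qed

end

lemma Un_Int_Un_empty:
  "A \<inter> A' = {} \<Longrightarrow> B \<inter> B' = {} \<Longrightarrow> A \<subseteq> X \<Longrightarrow> A' \<subseteq> X \<Longrightarrow> B \<inter> X = {} \<Longrightarrow> B' \<inter> X = {} \<Longrightarrow>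
    (A \<union> B) \<inter> (A' \<union> B') = {}"
  by blast

lemma Un_Int_empty: "C \<inter> Z = {} \<Longrightarrow> H \<subseteq> X \<Longrightarrow> Z \<inter> X = {} \<Longrightarrow> (H \<union> C) \<inter> Z = {}"
  by blast

section \<open>Regions around the vertices and the second-class faces\<close>

context conjugated_graph
begin

text \<open>The candidate for the face of \<open>H\<close> around \<open>u\<close>; midpoints are
  left out since they are vertices of \<open>H\<close>. It is defined also for vertices on the
  unbounded face, so that regions and centres together cover everything a bounded face of
  \<open>H\<close> around a vertex could reach.\<close>

definition region :: "'v \<Rightarrow> complex set" where
  "region u = {p u} \<union> (\<Union>e\<in>{e\<in>E. u \<in> e}. hs e u - {mid e}) \<union> (\<Union>s\<in>{s\<in>M. u \<in> \<Inter>s}. corner s u)"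

abbreviation "D \<equiv> drawing V E p \<gamma>"
abbreviation "D' \<equiv> drawing E M mid \<mu>"

lemma medianE:
  assumes "s \<in> M"
  obtains F where "F \<in> bounded_faces V E p \<gamma>" "s \<in> face_medians E \<gamma> F"
  using assms by (auto simp: medians_def)

lemma bounded_face_disjoint: "F \<in> bounded_faces V E p \<gamma> \<Longrightarrow> F \<inter> D = {}"
  using bounded_face face_disjoint_drawing by blast

lemma faces_disjoint: "F \<in> faces V E p \<gamma> \<Longrightarrow> F' \<in> faces V E p \<gamma> \<Longrightarrow> F \<noteq> F' \<Longrightarrow> F \<inter> F' = {}"
  unfolding faces_def using components_nonoverlap by blast

lemma mid_in_drawing: "e \<in> E \<Longrightarrow> mid e \<in> D"
  using mid_in_edge unfolding drawing_eq arcs_def by blast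

lemma conjugated_drawing_Int_face:
  assumes F: "F \<in> bounded_faces V E p \<gamma>"
  shows "D' \<inter> F \<subseteq> centre_boundary F"
proof
  fix q assume q: "q \<in> D' \<inter> F"
  then have "q \<notin> mid ` E" using mid_in_drawing bounded_face_disjoint[OF F] by blast
  then obtain s where s: "s \<in> M" "q \<in> path_image (\<mu> s)" using q unfolding H.drawing_eq H.arcs_def by blast
  obtain F' where F': "F' \<in> bounded_faces V E p \<gamma>" "s \<in> face_medians E \<gamma> F'" by (rule medianE[OF s(1)])
  have "q \<in> F'"
    using median_in_face[OF F'] s \<open>q \<notin> mid ` E\<close> H.edge_subset[OF s(1)] by blast
  then have "F' = F" using faces_disjoint bounded_face F F'(1) q by blast
  then show "q \<in> centre_boundary F" using F'(2) s(2) unfolding centre_boundary_def by blast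
qed

lemma drawings_Int: "D \<inter> D' \<subseteq> mid ` E"
proof
  fix q assume q: "q \<in> D \<inter> D'"
  show "q \<in> mid ` E"
  proof (rule ccontr)
    assume n: "q \<notin> mid ` E"
    then obtain s where s: "s \<in> M" "q \<in> path_image (\<mu> s)" using q unfolding H.drawing_eq H.arcs_def by blast
    obtain F where F: "F \<in> bounded_faces V E p \<gamma>" "s \<in> face_medians E \<gamma> F" by (rule medianE[OF s(1)])
    have "q \<in> F" using median_in_face[OF F] s n H.edge_subset[OF s(1)] by blast
    then show False using bounded_face_disjoint[OF F(1)] q by blast
  qed
qed

lemma half_Int_mids:
  assumes "e \<in> E" "v \<in> e" "e' \<in> E" "mid e' \<in> hs e v"
  shows "e = e'"
  using half(4)[OF assms(1,2)] mid_in_edge_iff[OF assms(3,1)] assms(4) by blast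

lemma half_subset_drawing: "e \<in> E \<Longrightarrow> v \<in> e \<Longrightarrow> hs e v \<subseteq> D"
  using half(4) unfolding drawing_eq arcs_def by blast

lemma corner_in_face:
  assumes "s \<in> M" "v \<in> \<Inter>s"
  obtains F where "F \<in> bounded_faces V E p \<gamma>" "s \<in> face_medians E \<gamma> F" "corner s v \<subseteq> F" "corner s v \<inter> centre F = {}"
proof -
  obtain F where F: "F \<in> bounded_faces V E p \<gamma>" "s \<in> face_medians E \<gamma> F" by (rule medianE[OF assms(1)])
  then show ?thesis using that face_structure(2)[OF F(1)] assms(2) by blast
qed

lemma corner_facts:
  assumes "s \<in> M" "v \<in> \<Inter>s"
  shows "connected (corner s v)"
    "closure (corner s v) = corner s v \<union> (\<Union>e\<in>s. hs e v) \<union> path_image (\<mu> s)"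
    "corner s v \<inter> D = {}" "corner s v \<inter> D' = {}"
proof -
  obtain F where F: "F \<in> bounded_faces V E p \<gamma>" "s \<in> face_medians E \<gamma> F" by (rule medianE[OF assms(1)])
  have c: "corner s v \<subseteq> F" "connected (corner s v)"
    "closure (corner s v) = corner s v \<union> (\<Union>e\<in>s. hs e v) \<union> path_image (\<mu> s)"
    "corner s v \<inter> centre_boundary F = {}"
    using face_structure(2)[OF F(1)] F(2) assms(2) by blast+
  show "connected (corner s v)"
    "closure (corner s v) = corner s v \<union> (\<Union>e\<in>s. hs e v) \<union> path_image (\<mu> s)"
    by (rule c)+
  show "corner s v \<inter> D = {}" "corner s v \<inter> D' = {}"
    using c(1,4) bounded_face_disjoint[OF F(1)] conjugated_drawing_Int_face[OF F(1)] by blast+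
qed

lemma median_subset: "s \<in> M \<Longrightarrow> path_image (\<mu> s) \<subseteq> D'"
  unfolding H.drawing_eq H.arcs_def by blast

lemma centre_boundary_subset:
  assumes "F \<in> bounded_faces V E p \<gamma>"
  shows "centre_boundary F \<subseteq> D'"
proof -
  have "face_medians E \<gamma> F \<subseteq> M" using assms unfolding medians_def by blast
  then show ?thesis using median_subset unfolding centre_boundary_def by blast
qed

lemma mid_in_conjugated: "e \<in> E \<Longrightarrow> mid e \<in> D'"
  unfolding H.drawing_eq by blast

lemma half_in_region: "e \<in> E \<Longrightarrow> u \<in> e \<Longrightarrow> hs e u - {mid e} \<subseteq> region u"
  unfolding region_def by blast

lemma closure_region_subset:
  "closure (region u) \<subseteq> {p u} \<union> (\<Union>e\<in>{e\<in>E. u \<in> e}. hs e u) \<union>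
     (\<Union>s\<in>{s\<in>M. u \<in> \<Inter>s}. corner s u \<union> path_image (\<mu> s))" (is "_ \<subseteq> {p u} \<union> ?A \<union> ?C")
proof -
  let ?C' = "\<Union>s\<in>{s\<in>M. u \<in> \<Inter>s}. closure (corner s u)"
  have fin: "finite {e\<in>E. u \<in> e}" "finite {s\<in>M. u \<in> \<Inter>s}" using finite_E H.finite_E by auto
  have "\<forall>e\<in>{e\<in>E. u \<in> e}. closed (hs e u)" using half(1) closed_arc_image by blast
  then have "closed ?A" by (rule closed_UN[OF fin(1)])
  moreover have "closed ?C'" by (rule closed_UN[OF fin(2)]) simp
  ultimately have cl: "closed ({p u} \<union> ?A \<union> ?C')" by (simp add: closed_Un)
  have "region u \<subseteq> {p u} \<union> ?A \<union> ?C'"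
    unfolding region_def by (intro Un_mono UN_mono subset_refl Diff_subset closure_subset)
  then have c1: "closure (region u) \<subseteq> {p u} \<union> ?A \<union> ?C'" by (rule closure_minimal[OF _ cl])
  have c2: "?C' \<subseteq> ?A \<union> ?C"
  proof (rule UN_least)
    fix s assume "s \<in> {s\<in>M. u \<in> \<Inter>s}"
    then have s: "s \<in> M" "u \<in> \<Inter>s" by simp_all
    have "(\<Union>e\<in>s. hs e u) \<subseteq> ?A"
      by (rule UN_mono) (use H.edge_subset[OF s(1)] s(2) in auto)
    moreover have "corner s u \<union> path_image (\<mu> s) \<subseteq> ?C" using s by (intro UN_upper) simp
    ultimately show "closure (corner s u) \<subseteq> ?A \<union> ?C" unfolding corner_facts(2)[OF s] by (simp add: le_supI1 le_supI2)
  qed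
  have "closure (region u) \<subseteq> {p u} \<union> ?A \<union> (?A \<union> ?C)"
    by (rule order_trans[OF c1 Un_mono[OF subset_refl c2]])
  then show ?thesis by (simp only: Un_assoc Un_left_absorb)
qed

lemma closure_regionE:
  assumes "q \<in> closure (region u)"
  obtains "q = p u" | e where "e \<in> E" "u \<in> e" "q \<in> hs e u" | s where "s \<in> M" "u \<in> \<Inter>s" "q \<in> corner s u"
    | s where "s \<in> M" "u \<in> \<Inter>s" "q \<in> path_image (\<mu> s)"
  using subsetD[OF closure_region_subset assms] by (elim UnE UN_E) auto

text \<open>Makes each region relatively closed in the complement of the drawing of
  \<open>H\<close>, which is what the connectedness argument in \<open>face_subset_region\<close>
  needs.\<close>

lemma closure_region: "closure (region u) \<subseteq> region u \<union> D'"
proof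
  fix q assume "q \<in> closure (region u)"
  then show "q \<in> region u \<union> D'"
  proof (cases rule: closure_regionE)
    case 1 then show ?thesis by (simp add: region_def)
  next
    case (2 e) then show ?thesis using half_in_region mid_in_conjugated by blast
  next
    case (3 s) then show ?thesis unfolding region_def by blast
  next
    case (4 s) then show ?thesis using median_subset by blast
  qed
qed

lemma mid_in_closure_region:
  assumes "u \<in> V" "e \<in> E" "mid e \<in> closure (region u)"
  shows "u \<in> e"
  using assms(3)
proof (cases rule: closure_regionE)
  case 1 then show ?thesis using mid_not_vertex[OF assms(2)] imageI[OF assms(1), of p] by simp
next
  case (2 e') then show ?thesis using half_Int_mids assms(2) by blast
next
  case (3 s) then show ?thesis using corner_facts(3)[OF 3(1,2)] mid_in_drawing[OF assms(2)] by blast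
next
  case (4 s) then show ?thesis using H.vertex_in_edge_iff[OF 4(1) assms(2)] by blast
qed

text \<open>The parts on the drawing and the parts in the faces are compared separately. Halves of
  one edge meet only in the removed midpoint, and halves of different edges with different vertices
  do not meet; corners lie in different faces or are separated by
  \<open>face_structure\<close>.\<close>

lemma regions_disjoint:
  assumes uw: "u \<in> V" "w \<in> V" "u \<noteq> w"
  shows "region u \<inter> region w = {}"
proof -
  let ?H = "\<lambda>u. {p u} \<union> (\<Union>e\<in>{e\<in>E. u \<in> e}. hs e u - {mid e})" and ?C = "\<lambda>u. \<Union>s\<in>{s\<in>M. u \<in> \<Inter>s}. corner s u"
  have r: "region x = ?H x \<union> ?C x" for x by (simp add: region_def)
  have HD: "?H x \<subseteq> D" if "x \<in> V" for x
    using that half_subset_drawing unfolding drawing_eq by blast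
  have CD: "?C x \<inter> D = {}" for x
  proof -
    show ?thesis using corner_facts(3) by blast
  qed
  have pne: "p u \<noteq> p w" using inj_p uw by (auto simp: inj_on_eq_iff)
  have hp: "p x \<notin> hs e y" if "e \<in> E" "y \<in> e" "x \<in> V" "x \<noteq> y" for e x y
  proof -
    have "y \<in> V" using that edge_subset by blast
    then have "p x \<noteq> p y" using inj_p that(3,4) by (auto simp: inj_on_eq_iff)
    then show ?thesis using half(5)[OF that(1,2)] that(3) by blast
  qed
  have hh: "(hs e u - {mid e}) \<inter> (hs e' w - {mid e'}) = {}" if "e \<in> E" "u \<in> e" "e' \<in> E" "w \<in> e'" for e e'
  proof (cases "e = e'")
    case True
    then have "e = {u, w}" using other_endpoint[OF that(1,2)] that(4) uw(3) by (metis insertE singletonD)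
    then show ?thesis using half_Un_Int(2)[of u w] that(1) uw(3) True by blast
  next
    case False
    then show ?thesis using half_Int_empty[OF that(1,3) False that(2,4) uw(3)] by blast
  qed
  have "?H u \<inter> ?H w = {}"
  proof -
    have "p u \<notin> ?H w" using hp[OF _ _ uw(1,3)] pne by blast
    moreover have "p w \<notin> ?H u" using hp[OF _ _ uw(2) uw(3)[symmetric]] pne by auto
    ultimately show ?thesis using hh by blast
  qed
  moreover have "corner s u \<inter> corner t w = {}" if s: "s \<in> M" "u \<in> \<Inter>s" and t: "t \<in> M" "w \<in> \<Inter>t" for s t
  proof -
    obtain F where F: "F \<in> bounded_faces V E p \<gamma>" "s \<in> face_medians E \<gamma> F" "corner s u \<subseteq> F"
      using corner_in_face[OF s] by metis
    obtain G where G: "G \<in> bounded_faces V E p \<gamma>" "t \<in> face_medians E \<gamma> G" "corner t w \<subseteq> G"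
      using corner_in_face[OF t] by metis
    show ?thesis
    proof (cases "F = G")
      case True then show ?thesis using face_structure(3)[OF F(1)] F G s t uw(3) by blast
    next
      case False then show ?thesis using faces_disjoint bounded_face F G by blast
    qed
  qed
  then have "?C u \<inter> ?C w = {}" by blast
  ultimately show ?thesis
    unfolding r using HD[OF uw(1)] HD[OF uw(2)] CD[of u] CD[of w] by (rule Un_Int_Un_empty)
qed

lemma region_centre_disjoint:
  assumes u: "u \<in> V" and F: "F \<in> bounded_faces V E p \<gamma>"
  shows "region u \<inter> centre F = {}"
proof -
  have "centre F \<inter> D = {}" using face_structure(4)[OF F] bounded_face_disjoint[OF F] by blast
  have "corner s u \<inter> centre F = {}" if s: "s \<in> M" "u \<in> \<Inter>s" for s
  proof -
    obtain G where G: "G \<in> bounded_faces V E p \<gamma>" "s \<in> face_medians E \<gamma> G" "corner s u \<subseteq> G" "corner s u \<inter> centre G = {}"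
      by (rule corner_in_face[OF s])
    show ?thesis
    proof (cases "F = G")
      case True then show ?thesis using G by blast
    next
      case False then show ?thesis using faces_disjoint bounded_face F G face_structure(4)[OF F] by blast
    qed
  qed
  then have "(\<Union>s\<in>{s\<in>M. u \<in> \<Inter>s}. corner s u) \<inter> centre F = {}" by blast
  moreover have "{p u} \<union> (\<Union>e\<in>{e\<in>E. u \<in> e}. hs e u - {mid e}) \<subseteq> D"
  proof -
    have "p u \<in> D" using u unfolding drawing_eq by blast
    moreover have "(\<Union>e\<in>{e\<in>E. u \<in> e}. hs e u - {mid e}) \<subseteq> D"
      using half_subset_drawing by (intro UN_least) blast
    ultimately show ?thesis by simp
  qed
  ultimately show ?thesis unfolding region_def using \<open>centre F \<inter> D = {}\<close> by (rule Un_Int_empty)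
qed

text \<open>A bounded face is the inside of the union of its boundary edges, so it is determined by
  a set of edges. Finiteness makes the union of the closed centres closed.\<close>

lemma finite_bounded_faces: "finite (bounded_faces V E p \<gamma>)"
proof (rule finite_subset)
  show "bounded_faces V E p \<gamma> \<subseteq> (\<lambda>A. inside (arcs A)) ` Pow E"
  proof
    fix F assume F: "F \<in> bounded_faces V E p \<gamma>"
    obtain a b c l where "{a, b} \<in> E" "{a, c} \<in> E" "{b, c} \<in> E"
      "path_image l = arcs {{a, b}, {a, c}, {b, c}}" "F = inside (path_image l)"
      by (rule bounded_face_triangle[OF F])
    then show "F \<in> (\<lambda>A. inside (arcs A)) ` Pow E" by auto
  qed
qed (simp add: finite_E)

text \<open>No median enters \<open>F\<close>, so \<open>F\<close> is connected in the complement of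
  the drawing of \<open>H\<close>; if it met \<open>P\<close>, it would lie in the bounded set
  \<open>P\<close>.\<close>

lemma unbounded_face_disjoint:
  assumes P: "P \<in> components (- D')" "bounded P" and F: "F \<in> faces V E p \<gamma>" "\<not> bounded F"
  shows "P \<inter> F = {}"
proof (rule ccontr)
  assume ne: "P \<inter> F \<noteq> {}"
  have "F \<inter> D' = {}"
  proof (rule ccontr)
    assume "F \<inter> D' \<noteq> {}"
    then obtain q where q: "q \<in> F" "q \<in> D'" by blast
    have "q \<notin> mid ` E" using q mid_in_drawing face_disjoint_drawing[OF F(1)] by blast
    then obtain s where s: "s \<in> M" "q \<in> path_image (\<mu> s)" using q unfolding H.drawing_eq H.arcs_def by blast
    obtain G where G: "G \<in> bounded_faces V E p \<gamma>" "s \<in> face_medians E \<gamma> G" by (rule medianE[OF s(1)])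
    have "q \<in> G" using median_in_face[OF G] s \<open>q \<notin> mid ` E\<close> H.edge_subset[OF s(1)] by blast
    then have "G = F" using faces_disjoint[OF bounded_face[OF G(1)] F(1)] q by blast
    then show False using G(1) F(2) by (simp add: bounded_faces_def)
  qed
  moreover have "connected F" using F(1) in_components_connected unfolding faces_def by blast
  ultimately have "F \<subseteq> P" using components_maximal[OF P(1)] ne by blast
  then show False using bounded_subset P(2) F(2) by blast
qed

text \<open>The connected set \<open>P\<close> is covered by \<open>region v\<close> on one side and
  the other regions and the centres on the other. Within \<open>P\<close> both sides are closed and
  they are disjoint, so \<open>P\<close> lies on the side of \<open>p v\<close>.\<close>

lemma face_subset_region:
  assumes P: "P \<in> components (- D')" "bounded P" and v: "v \<in> V" "p v \<in> P"
  shows "P \<subseteq> region v"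
proof -
  have PD: "P \<inter> D' = {}" using in_components_subset[OF P(1)] by blast
  have cP: "connected P" using P(1) in_components_connected by blast
  define others where "others = (\<Union>u\<in>V - {v}. region u) \<union> (\<Union>F\<in>bounded_faces V E p \<gamma>. centre F)"
  have cover: "P \<subseteq> region v \<union> others"
  proof
    fix x assume x: "x \<in> P"
    have "x \<in> (\<Union>u\<in>V. region u) \<union> (\<Union>F\<in>bounded_faces V E p \<gamma>. centre F)"
    proof (cases "x \<in> D")
      case True
      then consider u where "u \<in> V" "x = p u" | e where "e \<in> E" "x \<in> path_image (\<gamma> e)"
        unfolding drawing_eq arcs_def by blast
      then show ?thesis
      proof cases
        case 1 then show ?thesis by (auto simp: region_def)
      next
        case 2
        obtain u w where uw: "e = {u, w}" "u \<noteq> w" using card_edge[OF 2(1)] by (auto simp: card_2_iff)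
        have "x \<noteq> mid e" using x PD 2(1) unfolding H.drawing_eq by blast
        moreover have "x \<in> hs e u \<or> x \<in> hs e w" using half_Un_Int(1)[of u w] 2 uw by blast
        moreover have "hs e u - {mid e} \<subseteq> region u" "hs e w - {mid e} \<subseteq> region w"
          by (rule half_in_region[OF 2(1)], simp add: uw)+
        ultimately have "x \<in> region u \<or> x \<in> region w" by blast
        then show ?thesis using edge_subset[OF 2(1)] uw by blast
      qed
    next
      case False
      then obtain F where F: "F \<in> faces V E p \<gamma>" "x \<in> F"
        unfolding faces_def using Union_components by blast
      then have Fb: "F \<in> bounded_faces V E p \<gamma>"
        using unbounded_face_disjoint[OF P] x unfolding bounded_faces_def by blast
      have "x \<notin> centre_boundary F"
        using x PD centre_boundary_subset[OF Fb] by blast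
      then have "x \<in> centre F \<or> (\<exists>s\<in>face_medians E \<gamma> F. \<exists>u\<in>\<Inter>s. x \<in> corner s u)"
        using subsetD[OF face_structure(1)[OF Fb] F(2)] by simp
      then consider "x \<in> centre F" | s u where "s \<in> face_medians E \<gamma> F" "u \<in> \<Inter>s" "x \<in> corner s u"
        by (elim disjE bexE)
      then show ?thesis
      proof cases
        case 1 then show ?thesis using Fb by blast
      next
        case 2
        have "s \<in> M" using 2(1) Fb unfolding medians_def by blast
        moreover have "u \<in> V"
        proof -
          have "s \<noteq> {}" using 2(1) by (auto simp: face_medians_def)
          then show ?thesis using H.edge_subset[OF \<open>s \<in> M\<close>] 2(2) edge_subset by blast
        qed
        ultimately show ?thesis using 2 unfolding region_def by blast
      qed
    qed
    then show "x \<in> region v \<union> others" unfolding others_def by blast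
  qed
  \<comment> \<open>The closed version of \<open>others\<close>: taking closures adds only points of
    the drawing of \<open>H\<close>, which \<open>P\<close> avoids.\<close>
  define oc where "oc = (\<Union>u\<in>V - {v}. closure (region u)) \<union> (\<Union>F\<in>bounded_faces V E p \<gamma>. closure (centre F))"
  have oc: "closed oc" unfolding oc_def using finite_V finite_bounded_faces by (intro closed_Un closed_UN) auto
  have "others \<subseteq> oc" unfolding others_def oc_def using closure_subset by blast
  have oc': "oc \<subseteq> others \<union> D'"
  proof -
    have "closure (centre F) \<subseteq> centre F \<union> D'" if "F \<in> bounded_faces V E p \<gamma>" for F
      using face_structure(5)[OF that] centre_boundary_subset[OF that] by blast
    then show ?thesis using closure_region unfolding oc_def others_def by blast
  qed
  have dis: "region v \<inter> others = {}"
    unfolding others_def using regions_disjoint[OF v(1)] region_centre_disjoint[OF v(1)] by blast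
  have "closure (region v) \<inter> oc \<inter> P = {}"
    using closure_region[of v] oc' dis PD by blast
  moreover have "P \<subseteq> closure (region v) \<union> oc" using cover \<open>others \<subseteq> oc\<close> closure_subset by blast
  ultimately have "closure (region v) \<inter> P = {} \<or> oc \<inter> P = {}"
    by (intro connected_closedD[OF cP _ _ closed_closure oc])
  moreover have "p v \<in> closure (region v)" using closure_subset[of "region v"] unfolding region_def by blast
  ultimately show ?thesis using v(2) cover \<open>others \<subseteq> oc\<close> by blast
qed

text \<open>From left to right by the closure of \<open>region v\<close>. Conversely, the half-edge
  at \<open>v\<close> without its midpoint is connected, misses the drawing of \<open>H\<close> and
  contains \<open>p v\<close>, so it lies in \<open>P\<close> and has the midpoint in its
  closure.\<close>

lemma mid_in_frontier_iff:
  assumes P: "P \<in> components (- D')" "bounded P" and v: "v \<in> V" "p v \<in> P" and e: "e \<in> E"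
  shows "mid e \<in> frontier P \<longleftrightarrow> v \<in> e"
proof
  assume "mid e \<in> frontier P"
  then have "mid e \<in> closure (region v)"
    using subsetD[OF closure_mono[OF face_subset_region[OF P v]]] by (simp add: frontier_def)
  then show "v \<in> e" using mid_in_closure_region[OF v(1) e] by blast
next
  assume ve: "v \<in> e"
  note h = half[OF e ve]
  have "mid e \<in> D'" using e unfolding H.drawing_eq by blast
  then have nP: "mid e \<notin> P" using in_components_subset[OF P(1)] by blast
  have pm: "p v \<noteq> mid e" using mid_not_vertex[OF e] imageI[OF v(1), of p] by metis
  have sub: "hs e v - {mid e} \<subseteq> - D'"
    using drawings_Int half_subset_drawing[OF e ve] half_Int_mids[OF e ve] by blast
  \<comment> \<open>An arc without one end lies between the arc without both ends and the closure of
    the latter.\<close>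
  have con: "connected (hs e v - {mid e})"
  proof (rule connected_intermediate_closure)
    show "connected (hs e v - {p v, mid e})"
      using connected_simple_path_endless[of "half e v"] h arc_imp_simple_path by metis
    show "hs e v - {p v, mid e} \<subseteq> hs e v - {mid e}" by blast
    show "hs e v - {mid e} \<subseteq> closure (hs e v - {p v, mid e})"
      using arc_subset_closure_endless[OF h(1)] h(2,3) by auto
  qed
  have "(hs e v - {mid e}) \<inter> P \<noteq> {}" using vertex_in_half[OF e ve] v(2) pm by blast
  then have "hs e v - {mid e} \<subseteq> P" using components_maximal[OF P(1) con sub] by blast
  then have "hs e v - {p v, mid e} \<subseteq> P" by blast
  then have "mid e \<in> closure P"
    using arc_subset_closure_endless[OF h(1)] closure_mono mid_in_half[OF e ve] h(2,3)
    by (metis subsetD)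
  then show "mid e \<in> frontier P" using nP interior_subset by (auto simp: frontier_def)
qed

text \<open>The open set \<open>P\<close> contains \<open>p v\<close>, a closure point of the
  corner, so \<open>P\<close> meets the corner and then contains it; the median lies in the closure
  of the corner.\<close>

lemma median_in_frontier:
  assumes P: "P \<in> components (- D')" and v: "v \<in> V" "p v \<in> P" and s: "s \<in> M" "v \<in> \<Inter>s"
  shows "path_image (\<mu> s) \<subseteq> frontier P"
proof -
  note c = corner_facts(1,4,2)[OF s]
  obtain e where e: "e \<in> s" using s(1) H.card_edge[of s] by fastforce
  have "e \<in> E" using H.edge_subset[OF s(1)] e by blast
  then have "p v \<in> closure (corner s v)" using c(3) vertex_in_half e s(2) by blast
  moreover have "open P"
    using P H.compact_drawing compact_imp_closed open_components open_Compl by blast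
  ultimately have "P \<inter> corner s v \<noteq> {}" using v(2) open_Int_closure_eq_empty by blast
  then have "corner s v \<subseteq> P" using components_maximal[OF P c(1)] c(2) by blast
  then have "path_image (\<mu> s) \<subseteq> closure P" using c(3) closure_mono by blast
  moreover have "path_image (\<mu> s) \<inter> P = {}"
    using in_components_subset[OF P] s(1) unfolding H.drawing_eq H.arcs_def by blast
  ultimately show ?thesis using interior_subset[of P] by (auto simp: frontier_def)
qed

theorem common_elements:
  assumes T: "first_class_face V E p \<gamma> \<mu> T" and P: "second_class_face V E p \<gamma> \<mu> P"
  shows "(\<exists>s. common_edges V E p \<gamma> \<mu> T P = {s} \<and> common_vertices E \<gamma> T P = s \<and> card s = 2) \<or>
    (common_edges V E p \<gamma> \<mu> T P = {} \<and> common_vertices E \<gamma> T P = {})"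
proof -
  let ?CE = "common_edges V E p \<gamma> \<mu> T P" and ?CV = "common_vertices E \<gamma> T P"
  obtain F where F: "F \<in> bounded_faces V E p \<gamma>" "T = centre F"
    using T unfolding first_class_face_def centre_boundary_def by blast
  obtain v where v: "v \<in> V" "p v \<in> P"
    using P interior_subset unfolding second_class_face_def by blast
  have P': "P \<in> components (- D')" "bounded P"
    using P unfolding second_class_face_def conjugated_faces_def faces_def by auto
  obtain a b c l where abc: "{a, b} \<in> E" "{a, c} \<in> E" "{b, c} \<in> E" "a \<noteq> b" "a \<noteq> c" "b \<noteq> c"
    and B: "boundary_edges E \<gamma> F = {{a, b}, {a, c}, {b, c}}"
    by (rule bounded_face_triangle[OF F(1)])
  let ?B = "boundary_edges E \<gamma> F"
  have fT: "frontier T = centre_boundary F" using face_structure(6)[OF F(1)] F(2) by simp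
  have midT: "mid e \<in> frontier T \<longleftrightarrow> e \<in> ?B" if "e \<in> E" for e
  proof
    assume "mid e \<in> frontier T"
    then obtain s where s: "s \<in> face_medians E \<gamma> F" "mid e \<in> path_image (\<mu> s)"
      unfolding fT centre_boundary_def by blast
    have "s \<in> M" using s(1) F(1) unfolding medians_def by blast
    then have "e \<in> s" using H.vertex_in_edge_iff that s(2) by blast
    then show "e \<in> ?B" using s(1) unfolding face_medians_def by blast
  next
    assume e: "e \<in> ?B"
    obtain e' where e': "e' \<in> ?B" "e' \<noteq> e" using e B abc by (auto simp: doubleton_eq_iff)
    note m = median_mem[OF F(1) e e'(1) e'(2)[symmetric]]
    have "mid e \<in> path_image (\<mu> {e, e'})" using H.vertex_in_edge_iff[OF m(2) that] by simp
    then show "mid e \<in> frontier T" using m(1) unfolding fT centre_boundary_def by blast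
  qed
  \<comment> \<open>The common vertices are the sides of the triangle at \<open>v\<close>, which
    reduces the theorem to counting the sides through a given vertex.\<close>
  have CV: "?CV = {e \<in> ?B. v \<in> e}"
    using midT mid_in_frontier_iff[OF P' v] boundary_edges_subset
    unfolding common_vertices_def boundary_vertices_def by blast
  have CE1: "s \<subseteq> ?CV \<and> card s = 2" if "s \<in> ?CE" for s
  proof -
    have s: "s \<in> M" "path_image (\<mu> s) \<subseteq> frontier T" "path_image (\<mu> s) \<subseteq> frontier P"
      using that unfolding common_edges_def boundary_edges_def by auto
    have "mid e \<in> path_image (\<mu> s) \<and> e \<in> E" if "e \<in> s" for e
      using H.vertex_in_edge_iff[OF s(1)] H.edge_subset[OF s(1)] that by blast
    then show ?thesis
      using s(2,3) H.card_edge[OF s(1)] unfolding common_vertices_def boundary_vertices_def by blast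
  qed
  \<comment> \<open>Two common vertices are sides of the triangle through \<open>v\<close>, so their
    median bounds both faces. By \<open>CE1\<close> any common median joins two common vertices, so
    there is no second one.\<close>
  have two: ?thesis if e: "?CV = {e, e'}" "e \<noteq> e'" for e e'
  proof -
    have eB: "e \<in> ?B" "e' \<in> ?B" "v \<in> e" "v \<in> e'" using e CV by auto
    note m = median_mem[OF F(1) eB(1,2) e(2)]
    have "path_image (\<mu> {e, e'}) \<subseteq> frontier T" using m(1) unfolding fT centre_boundary_def by blast
    moreover have "path_image (\<mu> {e, e'}) \<subseteq> frontier P"
      using median_in_frontier[OF P'(1) v m(2)] eB by blast
    ultimately have "{e, e'} \<in> ?CE" using m(2) unfolding common_edges_def boundary_edges_def by blast
    moreover have "s = {e, e'}" if "s \<in> ?CE" for s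
    proof (rule card_subset_eq)
      show "s \<subseteq> {e, e'}" "card s = card {e, e'}" using CE1[OF that] e by simp_all
    qed simp
    ultimately have "?CE = {{e, e'}}" by blast
    then show ?thesis using e by auto
  qed
  consider "v = a" | "v = b" | "v = c" | "v \<notin> {a, b, c}" by blast
  then show ?thesis
  proof cases
    case 1
    then have "?CV = {{a, b}, {a, c}}" unfolding CV B using abc by auto
    moreover have "{a, b} \<noteq> {a, c}" using abc by (auto simp: doubleton_eq_iff)
    ultimately show ?thesis by (rule two)
  next
    case 2
    then have "?CV = {{a, b}, {b, c}}" unfolding CV B using abc by auto
    moreover have "{a, b} \<noteq> {b, c}" using abc by (auto simp: doubleton_eq_iff)
    ultimately show ?thesis by (rule two)
  next
    case 3
    then have "?CV = {{a, c}, {b, c}}" unfolding CV B using abc by auto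
    moreover have "{a, c} \<noteq> {b, c}" using abc by (auto simp: doubleton_eq_iff)
    ultimately show ?thesis by (rule two)
  next
    case 4
    then have cv: "?CV = {}" unfolding CV B by auto
    have "s \<notin> ?CE" for s
    proof
      assume "s \<in> ?CE"
      then have "s \<subseteq> {}" "card s = 2" using CE1 cv by auto
      then show False by simp
    qed
    then show ?thesis using cv by blast
  qed
qed

end

theorem theorem11:
  fixes V :: "'v set" and E :: "'v set set"
    and p :: "'v \<Rightarrow> complex" and \<gamma> :: "'v set \<Rightarrow> real \<Rightarrow> complex"
    and \<mu> :: "'v set set \<Rightarrow> real \<Rightarrow> complex"
    and T P :: "complex set"
  assumes "planar_triangulation V E"
    and "card V \<ge> 3"
    and "plane_embedding V E p \<gamma>"
    and "conjugated_triangulation V E p \<gamma> \<mu>"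
    and "first_class_face V E p \<gamma> \<mu> T"
    and "second_class_face V E p \<gamma> \<mu> P"
  shows "((\<exists>s. common_edges V E p \<gamma> \<mu> T P = {s} \<and> common_vertices E \<gamma> T P = s) \<or>
          (common_edges V E p \<gamma> \<mu> T P = {} \<and> common_vertices E \<gamma> T P = {})) \<and>
         \<not> (common_edges V E p \<gamma> \<mu> T P = {} \<and> card (common_vertices E \<gamma> T P) = 1)"
proof -
  have "simple_graph V E" using assms(1) by (simp add: planar_triangulation_def planar_def)
  then interpret conjugated_graph V E p \<gamma> \<mu>
    using assms(3,4) triangulation_connected[OF assms(1,3)] by unfold_locales
  show ?thesis using common_elements[OF assms(5,6)] by auto
qed

end
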